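(* Let $Y$ and $\hat Y$ be Markov chains with values in a measurable space $(\mathcal X,\mathcal F)$ that are dual relative to a $\sigma$-finite measure $\mu$. Let $A\in\mathcal F$ be a set such that $\mu\bigl(N_A(Y)\,\Delta\, N_A(\hat Y)\bigr)=0$. Then the exit chain $Y^{A^c\rangle}$ and the entrance chain $\hat Y^{\rangle A^c}$ are dual relative to the measure $$\tilde\mu_{A^c}^{exit}(B):=\mu_{A^c}^{exit}(B\cap N_A(Y)),\qquad B\in\mathcal F^\dagger_{A^c}.$$ Likewise, the chains $Y^{\rangle A}$ and $\hat Y^{A\rangle}$ are dual relative to the measure $$\tilde\mu_A^{entr}(B):=\mu_A^{entr}(B\cap N_A(Y)),\qquad B\in\mathcal F^\dagger_A.$$ Moreover, it is true that $$\mathbb P_{\tilde\mu_A^{entr}}(Y_1^{\rangle A^c}\in\cdot)=\tilde\mu_{A^c}^{entr}\qquad\text{and}\qquad \mathbb P_{\tilde\mu_{A^c}^{entr}}(Y_1^{\rangle A}\in\cdot)=\tilde\mu_A^{entr},$$ where $\tilde\mu_{A^c}^{entr}(B):=\mu_{A^c}^{entr}(B\cap N_A(Y))$ for $B\in\mathcal F^\dagger_{A^c}$.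
   Context: All Markov chains are time-homogeneous. $\mathbb P_x$ is the law under which $Y$ is a Markov chain with its transition kernel $P$ and $\mathbb P_x(Y_0=x)=1$; for a (possibly infinite) measure $\nu$, $\mathbb P_\nu:=\int\mathbb P_x(\cdot)\,\nu(dx)$; analogous notation is used for $\hat Y$. Duality. Two Markov chains on a measurable space $(E,\mathcal E)$ with kernels $K,\hat K$ are dual relative to a measure $m$ on $(E,\mathcal E)$ if $m(dx)K(x,dy)=m(dy)\hat K(y,dx)$ as measures on $E\times E$. Notation. $\dagger\notin\mathcal X$ is a cemetery state. For $B\in\mathcal F$: $\mathcal F_B:=\{C\subset B:C\in\mathcal F\}$, $B_\dagger:=B\cup\{\dagger\}$, $\mathcal F_B^\dagger:=\mathcal F_B\cup\{C\cup\{\dagger\}:C\in\mathcal F_B\}$. $N_A(Y):=\{x\in\mathcal X:\mathbb P_x(Y_k\in A\text{ infinitely often and }Y_k\in A^c\text{ infinitely often})=1\}$, and $N_A(\hat Y)$ is defined in the same way for $\hat Y$. Entrance and exit chains. For a chain $Y$ and $B\in\mathcal F$ put $T_0^{\rangle B}:=0$, $T_n^{\rangle B}:=\inf\{k>T_{n-1}^{\rangle B}:Y_{k-1}\in B^c, Y_k\in B\}$ for $n\ge1$ ($\inf\varnothing=\infty$), $Y_n^{\rangle B}:=Y_{T_n^{\rangle B}}$, $Y_n^{B^c\rangle}:=Y_{T_n^{\rangle B}-1}$, with $Y_\infty:=\dagger$. The entrance chain $Y^{\rangle B}$ is the Markov chain $(Y_n^{\rangle B})_{n\ge1}$ on $B_\dagger$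 with kernel $P_B^{entr}(x,dy)=\mathbb P_x(Y_1^{\rangle B}\in dy)$, $x\in B$. The exit chain $Y^{B^c\rangle}$ is the Markov chain $(Y_n^{B^c\rangle})_{n\ge1}$ on $(B^c)_\dagger$ with kernel $P_{B^c}^{exit}(x,dy)=\int_B\mathbb P_z(Y_1^{B^c\rangle}\in dy)\,\mathbb P_x(Y_1\in dz\mid Y_1\in B)$ if $x\in B^c$ and $\mathbb P_x(Y_1\in B)>0$, and $P_{B^c}^{exit}(x,\{\dagger\})=1$ for other $x\in B^c$. Both kernels are absorbing at $\dagger$. (So $Y^{A^c\rangle}$ and $\hat Y^{\rangle A^c}$ are chains on $A^c_\dagger$, while $Y^{\rangle A}$ and $\hat Y^{A\rangle}$ are chains on $A_\dagger$.) Measures. $\mu_A^{entr}:=\int_{A^c}\mathbb P_x(Y_1\in\cdot)\,\mu(dx)$ on $(A,\mathcal F_A)$, $\mu_{A^c}^{entr}:=\int_{A}\mathbb P_x(Y_1\in\cdot)\,\mu(dx)$ on $(A^c,\mathcal F_{A^c})$, and $\mu_{A^c}^{exit}(dx):=\mathbb P_x(Y_1\in A)\,\mu(dx)$ on $(A^c,\mathcal F_{A^c})$. *)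

theory Defs
  imports "HOL-Probability.Probability"
begin

section \<open>Markov chains and duality\<close>

abbreviation path_space :: "'a measure \<Rightarrow> (nat \<Rightarrow> 'a) measure" where
  "path_space X \<equiv> PiM UNIV (\<lambda>_. X)"

definition markov_kernel :: "'a measure \<Rightarrow> ('a \<Rightarrow> 'a measure) \<Rightarrow> bool" where
  "markov_kernel X P \<longleftrightarrow> P \<in> X \<rightarrow>\<^sub>M prob_algebra X"

text \<open>
  \<open>Q\<close> is the law of a Markov chain started at \<open>x\<close>; the chain is the coordinate process
  on \<^term>\<open>path_space X\<close>. Singletons need not be measurable, so \<open>Y\<^sub>0 = x\<close> a.s.\ is
  expressed by the law of \<open>Y\<^sub>0\<close> being the point mass at \<open>x\<close>. The last conjunct is
  \<open>Q(Y\<^sub>n\<^sub>+\<^sub>1 \<in> B | Y\<^sub>0, \<dots>, Y\<^sub>n) = P(Y\<^sub>n, B)\<close>, integrated over \<open>{(Y\<^sub>0, \<dots>, Y\<^sub>n) \<in> C}\<close>.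
\<close>
definition is_chain_law ::
    "'a measure \<Rightarrow> ('a \<Rightarrow> 'a measure) \<Rightarrow> 'a \<Rightarrow> (nat \<Rightarrow> 'a) measure \<Rightarrow> bool" where
  "is_chain_law X P x Q \<longleftrightarrow>
     prob_space Q \<and> sets Q = sets (path_space X) \<and>
     distr Q X (\<lambda>\<omega>. \<omega> 0) = return X x \<and>
     (\<forall>n. \<forall>C\<in>sets (PiM {..n} (\<lambda>_. X)). \<forall>B\<in>sets X.
        emeasure Q {\<omega>\<in>space Q. restrict \<omega> {..n} \<in> C \<and> \<omega> (Suc n) \<in> B} =
        (\<integral>\<^sup>+\<omega>. indicator C (restrict \<omega> {..n}) * emeasure (P (\<omega> n)) B \<partial>Q))"

definition chain_law :: "'a measure \<Rightarrow> ('a \<Rightarrow> 'a measure) \<Rightarrow> 'a \<Rightarrow> (nat \<Rightarrow> 'a) measure" where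
  "chain_law X P x = (THE Q. is_chain_law X P x Q)"

lemma is_chain_law_exists:
  assumes P: "markov_kernel X P" and x: "x \<in> space X"
  shows "\<exists>Q. is_chain_law X P x Q"
proof -
  have P': "P \<in> X \<rightarrow>\<^sub>M subprob_algebra X"
    using P by (simp add: markov_kernel_def measurable_prob_algebraD)
  define \<kappa> where "\<kappa> i \<omega> = (case i of 0 \<Rightarrow> return X x | Suc n \<Rightarrow> P (\<omega> n))" for i and \<omega> :: "nat \<Rightarrow> 'a"
  interpret IT: Ionescu_Tulcea \<kappa> "\<lambda>_. X"
  proof (rule Ionescu_Tulcea.intro)
    fix i
    show "\<kappa> i \<in> PiM {0..<i} (\<lambda>_. X) \<rightarrow>\<^sub>M subprob_algebra X"
    proof (cases i)
      case 0
      have "return X x \<in> space (subprob_algebra X)"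
        using x by (simp add: space_subprob_algebra prob_space_return prob_space_imp_subprob_space)
      then show ?thesis by (simp add: 0 \<kappa>_def[abs_def])
    next
      case (Suc n)
      have "(\<lambda>\<omega>. \<omega> n) \<in> PiM {0..<Suc n} (\<lambda>_. X) \<rightarrow>\<^sub>M X"
        by (rule measurable_component_singleton) simp
      from measurable_compose[OF this P'] show ?thesis by (simp add: Suc \<kappa>_def[abs_def])
    qed
  next
    fix i and \<omega> :: "nat \<Rightarrow> 'a" assume \<omega>: "\<omega> \<in> space (PiM {0..<i} (\<lambda>_. X))"
    show "prob_space (\<kappa> i \<omega>)"
    proof (cases i)
      case 0 then show ?thesis using x by (simp add: \<kappa>_def prob_space_return)
    next
      case (Suc n)
      then have "\<omega> n \<in> space X" using \<omega> by (auto simp: space_PiM PiE_iff)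
      then show ?thesis
        using P measurable_space[of P X "prob_algebra X" "\<omega> n"]
        by (simp add: Suc \<kappa>_def markov_kernel_def space_prob_algebra)
    qed
  qed
  let ?Q = "IT.PF.lim" and ?C = "\<lambda>n. IT.C 0 n (\<lambda>_. undefined)" and ?M = "\<lambda>n::nat. PiM {0..<n} (\<lambda>_. X)"
  have [simp]: "(\<lambda>_. undefined) \<in> space (?M 0)" by (simp add: space_PiM PiE_def)
  have sC: "sets (?C n) = sets (?M n)" for n
    using IT.sets_C[of "\<lambda>_. undefined" 0 n] by simp
  have pC: "prob_space (?C n)" for n
    by (rule IT.prob_space_C) simp
  have CI: "IT.CI {0..<n} = ?C n" for n
  proof -
    have u: "IT.up_to {0..<n} = n"
      unfolding IT.up_to_def by (rule Least_equality) (auto simp: not_less[symmetric])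
    have "distr (?C n) (?M n) (\<lambda>f. restrict f {0..<n}) = ?C n"
      using IT.distr_C[of n n "\<lambda>_. undefined" 0] by simp
    then show ?thesis by (simp add: IT.CI_def u)
  qed
  have D: "distr ?Q (?M n) (\<lambda>\<omega>. restrict \<omega> {0..<n}) = ?C n" for n
    using IT.distr_lim[of "{0..<n}"] CI by simp
  have sQ: "sets ?Q = sets (path_space X)" by simp
  have spQ: "space ?Q = space (path_space X)" by simp
  have m_res: "(\<lambda>\<omega>. restrict \<omega> {0..<n}) \<in> ?Q \<rightarrow>\<^sub>M ?M n" for n
    unfolding measurable_cong_sets[OF sQ refl] by (rule measurable_restrict_subset) simp
  have pQ: "prob_space ?Q"
    by (rule prob_space_distrD[OF m_res[of 0]]) (simp only: D pC)
  have init: "distr ?Q X (\<lambda>\<omega>. \<omega> 0) = return X x"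
  proof -
    have m0: "(\<lambda>\<omega>. \<omega> 0) \<in> ?M 1 \<rightarrow>\<^sub>M X" by (rule measurable_component_singleton) simp
    have "distr ?Q X (\<lambda>\<omega>. \<omega> 0) = distr (distr ?Q (?M 1) (\<lambda>\<omega>. restrict \<omega> {0..<1})) X (\<lambda>\<omega>. \<omega> 0)"
      by (subst distr_distr[OF m0 m_res]) (simp add: comp_def)
    also have "\<dots> = distr (?C 1) X (\<lambda>\<omega>. \<omega> 0)" by (simp only: D)
    also have "?C 1 = IT.eP 0 (\<lambda>_. undefined)"
    proof -
      have "?C 1 = return (?M 0) (\<lambda>_. undefined) \<bind> IT.eP 0"
        by (simp only: One_nat_def IT.C.simps add_0)
      also have "\<dots> = IT.eP 0 (\<lambda>_. undefined)"
        by (rule bind_return[OF IT.measurable_eP]) (simp add: space_PiM PiE_def)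
      finally show ?thesis .
    qed
    also have "distr \<dots> X (\<lambda>\<omega>. \<omega> 0) = distr (return X x) X (\<lambda>y. y)"
    proof -
      have f: "fun_upd (\<lambda>_. undefined) 0 \<in> return X x \<rightarrow>\<^sub>M ?M 1"
        by (intro measurable_PiM_single') (auto simp: PiE_iff extensional_def)
      show ?thesis
        unfolding IT.eP_def \<kappa>_def using m0 f
        by (simp add: distr_distr comp_def)
    qed
    also have "\<dots> = return X x" by (rule distr_id2) simp
    finally show ?thesis .
  qed
  have step: "emeasure ?Q {\<omega>\<in>space ?Q. restrict \<omega> {..n} \<in> C \<and> \<omega> (Suc n) \<in> B} =
        (\<integral>\<^sup>+\<omega>. indicator C (restrict \<omega> {..n}) * emeasure (P (\<omega> n)) B \<partial>?Q)"
    if C: "C \<in> sets (PiM {..n} (\<lambda>_. X))" and B: "B \<in> sets X" for n C B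
  proof -
    let ?N = "Suc n"
    have I: "{..n} = {0..<?N}" by auto
    have C': "C \<in> sets (?M ?N)" using C by (simp only: I)
    define D' where "D' = {\<omega>\<in>space (?M (Suc ?N)). restrict \<omega> {0..<?N} \<in> C \<and> \<omega> ?N \<in> B}"
    have r: "(\<lambda>\<omega>. restrict \<omega> {0..<?N}) \<in> ?M (Suc ?N) \<rightarrow>\<^sub>M ?M ?N"
      by (rule measurable_restrict_subset) auto
    have c: "(\<lambda>\<omega>. \<omega> ?N) \<in> ?M (Suc ?N) \<rightarrow>\<^sub>M X"
      by (rule measurable_component_singleton) simp
    have D'm: "D' \<in> sets (?M (Suc ?N))"
      unfolding D'_def using measurable_sets[OF r C'] measurable_sets[OF c B]
      by (auto intro!: sets.sets_Collect_conj simp: vimage_def Int_def conj_commute)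
    have k: "(\<lambda>\<omega>. emeasure (P (\<omega> n)) B) \<in> borel_measurable (?M ?N)"
    proof -
      have "(\<lambda>\<omega>. \<omega> n) \<in> ?M ?N \<rightarrow>\<^sub>M X" by (rule measurable_component_singleton) simp
      from measurable_compose[OF this measurable_compose[OF P' measurable_emeasure_subprob_algebra[OF B]]]
      show ?thesis .
    qed
    have g: "(\<lambda>\<omega>. indicator C \<omega> * emeasure (P (\<omega> n)) B) \<in> borel_measurable (?M ?N)"
      using k C' by (intro borel_measurable_times_ennreal borel_measurable_indicator)
    have "emeasure ?Q {\<omega>\<in>space ?Q. restrict \<omega> {..n} \<in> C \<and> \<omega> (Suc n) \<in> B}
        = emeasure (distr ?Q (?M (Suc ?N)) (\<lambda>\<omega>. restrict \<omega> {0..<Suc ?N})) D'"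
      unfolding emeasure_distr[OF m_res D'm]
      by (rule arg_cong[where f="emeasure ?Q"])
         (auto simp: D'_def I spQ space_PiM PiE_iff Int_absorb1 restrict_restrict
               intro!: arg_cong[where f="\<lambda>f. f \<in> C"])
    also have "\<dots> = emeasure (?C (Suc ?N)) D'" by (simp only: D)
    also have "\<dots> = (\<integral>\<^sup>+\<omega>. emeasure (IT.eP ?N \<omega>) D' \<partial>?C ?N)"
    proof -
      have eP': "IT.eP ?N \<in> ?C ?N \<rightarrow>\<^sub>M subprob_algebra (?M (Suc ?N))"
        unfolding measurable_cong_sets[OF sC refl] by (rule IT.measurable_eP)
      have ne: "space (?C ?N) \<noteq> {}" using prob_space.not_empty[OF pC] .
      have "?C (Suc ?N) = ?C ?N \<bind> IT.eP ?N" using IT.C.simps(2)[of 0 ?N "\<lambda>_. undefined"] by simp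
      then show ?thesis using emeasure_bind[OF ne eP' D'm] by (simp del: IT.C.simps)
    qed
    also have "\<dots> = (\<integral>\<^sup>+\<omega>. indicator C \<omega> * emeasure (P (\<omega> n)) B \<partial>?C ?N)"
    proof (rule nn_integral_cong)
      fix \<omega> assume "\<omega> \<in> space (?C ?N)"
      then have \<omega>: "\<omega> \<in> space (?M ?N)" using sets_eq_imp_space_eq[OF sC] by blast
      have "emeasure (IT.eP ?N \<omega>) D' = emeasure (P (\<omega> n)) (fun_upd \<omega> ?N -` D' \<inter> space X)"
        using IT.emeasure_eP[OF \<omega> D'm] by (simp add: \<kappa>_def)
      also have "fun_upd \<omega> ?N -` D' \<inter> space X = (if \<omega> \<in> C then B else {})"
      proof -
        have "restrict (fun_upd \<omega> ?N y) {0..<?N} = \<omega>" for y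
          using \<omega> by (auto simp: fun_eq_iff space_PiM PiE_iff extensional_def)
        moreover have "fun_upd \<omega> ?N y \<in> space (?M (Suc ?N))" if "y \<in> space X" for y
          using \<omega> that by (auto simp: space_PiM PiE_iff extensional_def)
        ultimately show ?thesis
          using sets.sets_into_space[OF B] by (auto simp: D'_def)
      qed
      finally show "emeasure (IT.eP ?N \<omega>) D' = indicator C \<omega> * emeasure (P (\<omega> n)) B"
        by (auto simp: indicator_def)
    qed
    also have "\<dots> = (\<integral>\<^sup>+\<omega>. indicator C \<omega> * emeasure (P (\<omega> n)) B
                       \<partial>distr ?Q (?M ?N) (\<lambda>\<omega>. restrict \<omega> {0..<?N}))"
      by (simp only: D)
    also have "\<dots> = (\<integral>\<^sup>+\<omega>. indicator C (restrict \<omega> {..n}) * emeasure (P (\<omega> n)) B \<partial>?Q)"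
      by (subst nn_integral_distr[OF m_res]) (use g in \<open>simp_all add: I\<close>)
    finally show ?thesis .
  qed
  show ?thesis
    unfolding is_chain_law_def using pQ sQ init step by blast
qed

lemma is_chain_law_unique:
  assumes P: "markov_kernel X P" and Q: "is_chain_law X P x Q" and Q': "is_chain_law X P x Q'"
  shows "Q = Q'"
proof -
  have P': "P \<in> X \<rightarrow>\<^sub>M subprob_algebra X"
    using P by (simp add: markov_kernel_def measurable_prob_algebraD)
  let ?M = "\<lambda>n. PiM {..n} (\<lambda>_. X)"
  have mc: "(\<lambda>\<omega>. \<omega> n) \<in> R \<rightarrow>\<^sub>M X" and mr: "(\<lambda>\<omega>. restrict \<omega> {..n}) \<in> R \<rightarrow>\<^sub>M ?M n"
    if "is_chain_law X P x R" for R n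
  proof -
    from that have s: "sets R = sets (path_space X)" by (simp add: is_chain_law_def)
    show "(\<lambda>\<omega>. \<omega> n) \<in> R \<rightarrow>\<^sub>M X"
      unfolding measurable_cong_sets[OF s refl] by (rule measurable_component_singleton) simp
    show "(\<lambda>\<omega>. restrict \<omega> {..n}) \<in> R \<rightarrow>\<^sub>M ?M n"
      unfolding measurable_cong_sets[OF s refl] by (rule measurable_restrict_subset) simp
  qed
  have fin: "distr Q (?M n) (\<lambda>\<omega>. restrict \<omega> {..n}) = distr Q' (?M n) (\<lambda>\<omega>. restrict \<omega> {..n})" for n
  proof (induction n)
    case 0
    have *: "distr R (?M 0) (\<lambda>\<omega>. restrict \<omega> {..0}) = distr (return X x) (?M 0) (\<lambda>y. \<lambda>i\<in>{..0}. y)"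
      if R: "is_chain_law X P x R" for R
    proof -
      have "(\<lambda>y. \<lambda>i\<in>{..0::nat}. y) \<in> X \<rightarrow>\<^sub>M ?M 0" by (intro measurable_restrict) simp
      then have "distr (distr R X (\<lambda>\<omega>. \<omega> 0)) (?M 0) (\<lambda>y. \<lambda>i\<in>{..0::nat}. y)
          = distr R (?M 0) (\<lambda>\<omega>. \<lambda>i\<in>{..0::nat}. \<omega> 0)"
        by (simp add: distr_distr[OF _ mc[OF R]] comp_def)
      also have "(\<lambda>\<omega>::nat \<Rightarrow> 'a. \<lambda>i\<in>{..0::nat}. \<omega> 0) = (\<lambda>\<omega>. restrict \<omega> {..0})"
        by (auto simp: fun_eq_iff restrict_def)
      finally have "distr (distr R X (\<lambda>\<omega>. \<omega> 0)) (?M 0) (\<lambda>y. \<lambda>i\<in>{..0::nat}. y)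
          = distr R (?M 0) (\<lambda>\<omega>. restrict \<omega> {..0})" .
      moreover have "distr R X (\<lambda>\<omega>. \<omega> 0) = return X x"
        using R unfolding is_chain_law_def by blast
      ultimately show ?thesis by (simp only:)
    qed
    show ?case by (simp only: *[OF Q] *[OF Q'])
  next
    case (Suc n)
    let ?f = "\<lambda>(\<omega>, y). \<lambda>i\<in>{..Suc n}. if i \<le> n then \<omega> i else (y::'a)"
    let ?h = "\<lambda>\<omega>. (restrict \<omega> {..n}, \<omega> (Suc n))"
    let ?N = "?M n \<Otimes>\<^sub>M X"
    have f: "?f \<in> ?N \<rightarrow>\<^sub>M ?M (Suc n)"
    proof -
      have "(\<lambda>p. if i \<le> n then fst p i else snd p) \<in> ?N \<rightarrow>\<^sub>M X" for i
      proof (cases "i \<le> n")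
        case True
        then show ?thesis
          using measurable_compose[OF measurable_fst measurable_component_singleton[of i "{..n}" "\<lambda>_. X"]]
          by simp
      qed (simp add: measurable_snd)
      then have "(\<lambda>p. \<lambda>i\<in>{..Suc n}. if i \<le> n then fst p i else snd p) \<in> ?N \<rightarrow>\<^sub>M ?M (Suc n)"
        by (intro measurable_restrict)
      then show ?thesis by (simp add: case_prod_beta')
    qed
    have h: "?h \<in> R \<rightarrow>\<^sub>M ?N" if "is_chain_law X P x R" for R
      using mr[OF that] mc[OF that] by (intro measurable_Pair)
    have *: "distr R (?M (Suc n)) (\<lambda>\<omega>. restrict \<omega> {..Suc n}) = distr (distr R ?N ?h) (?M (Suc n)) ?f"
      if "is_chain_law X P x R" for R
      unfolding distr_distr[OF f h[OF that]]
      by (rule arg_cong[where f="distr R (?M (Suc n))"]) (auto simp: fun_eq_iff restrict_def le_Suc_eq)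
    have rect: "emeasure (distr R ?N ?h) (C \<times> B) =
        (\<integral>\<^sup>+\<omega>. indicator C \<omega> * emeasure (P (\<omega> n)) B \<partial>distr R (?M n) (\<lambda>\<omega>. restrict \<omega> {..n}))"
      if R: "is_chain_law X P x R" and C: "C \<in> sets (?M n)" and B: "B \<in> sets X" for R C B
    proof -
      have k: "(\<lambda>\<omega>. indicator C \<omega> * emeasure (P (\<omega> n)) B) \<in> borel_measurable (?M n)"
      proof -
        have "(\<lambda>\<omega>. \<omega> n) \<in> ?M n \<rightarrow>\<^sub>M X" by (rule measurable_component_singleton) simp
        from measurable_compose[OF this measurable_compose[OF P' measurable_emeasure_subprob_algebra[OF B]]]
        show ?thesis using C by (intro borel_measurable_times_ennreal borel_measurable_indicator)
      qed
      have "emeasure (distr R ?N ?h) (C \<times> B) = emeasure R (?h -` (C \<times> B) \<inter> space R)"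
        using C B by (intro emeasure_distr h[OF R]) simp
      also have "?h -` (C \<times> B) \<inter> space R = {\<omega>\<in>space R. restrict \<omega> {..n} \<in> C \<and> \<omega> (Suc n) \<in> B}"
        by auto
      also have "emeasure R \<dots> =
          (\<integral>\<^sup>+\<omega>. indicator C (restrict \<omega> {..n}) * emeasure (P (\<omega> n)) B \<partial>R)"
        using R C B unfolding is_chain_law_def by blast
      also have "\<dots> =
          (\<integral>\<^sup>+\<omega>. indicator C \<omega> * emeasure (P (\<omega> n)) B \<partial>distr R (?M n) (\<lambda>\<omega>. restrict \<omega> {..n}))"
        by (subst nn_integral_distr[OF mr[OF R]]) (use k in simp_all)
      finally show ?thesis .
    qed
    have "distr Q ?N ?h = distr Q' ?N ?h"
    proof (rule measure_eqI_generator_eq)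
      let ?E = "{C \<times> B | C B. C \<in> sets (?M n) \<and> B \<in> sets X}"
      show "Int_stable ?E" by (rule Int_stable_pair_measure_generator)
      show "?E \<subseteq> Pow (space (?M n) \<times> space X)" by (rule pair_measure_closed)
      show "sets (distr Q ?N ?h) = sigma_sets (space (?M n) \<times> space X) ?E"
           "sets (distr Q' ?N ?h) = sigma_sets (space (?M n) \<times> space X) ?E"
        by (simp_all add: sets_pair_measure)
      show "emeasure (distr Q ?N ?h) Z = emeasure (distr Q' ?N ?h) Z" if "Z \<in> ?E" for Z
      proof -
        from that obtain C B where Z: "Z = C \<times> B" and C: "C \<in> sets (?M n)" and B: "B \<in> sets X"
          by blast
        show ?thesis by (simp only: Z rect[OF Q C B] rect[OF Q' C B] Suc.IH)
      qed
      let ?A = "\<lambda>_::nat. space (?M n) \<times> space X"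
      show "range ?A \<subseteq> ?E" by blast
      show "(\<Union>i. ?A i) = space (?M n) \<times> space X" by simp
      have "prob_space (distr Q ?N ?h)"
        using Q by (intro prob_space.prob_space_distr h) (simp_all add: is_chain_law_def)
      then show "emeasure (distr Q ?N ?h) (?A i) \<noteq> \<infinity>" for i
        by (simp add: prob_space.emeasure_le_1 finite_measure.emeasure_finite prob_space.finite_measure)
    qed
    then show ?case by (simp only: *[OF Q] *[OF Q'])
  qed
  show ?thesis
  proof (rule measure_eqI_PiM_infinite)
    show "sets Q = sets (path_space X)" "sets Q' = sets (path_space X)"
      using Q Q' by (simp_all add: is_chain_law_def)
    show "finite_measure Q" using Q by (simp add: is_chain_law_def prob_space.finite_measure)
    fix A and J :: "nat set"
    assume J: "finite J" "J \<subseteq> UNIV" and A: "\<And>i. i \<in> J \<Longrightarrow> A i \<in> sets X"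
    obtain n where n: "J \<subseteq> {..n}" using J(1) finite_nat_iff_bounded_le by blast
    let ?S = "prod_emb {..n} (\<lambda>_. X) J (Pi\<^sub>E J A)"
    have S: "?S \<in> sets (?M n)" using J n A by (intro sets_PiM_I) auto
    have *: "emeasure R (prod_emb UNIV (\<lambda>_. X) J (Pi\<^sub>E J A)) =
        emeasure (distr R (?M n) (\<lambda>\<omega>. restrict \<omega> {..n})) ?S" if R: "is_chain_law X P x R" for R
    proof -
      have "space R = space (path_space X)"
        using R by (intro sets_eq_imp_space_eq) (simp add: is_chain_law_def)
      then show ?thesis
        unfolding emeasure_distr[OF mr[OF R] S] using n
        by (intro arg_cong[where f="emeasure R"])
           (auto simp: prod_emb_def space_PiM PiE_iff restrict_restrict Int_absorb1)
    qed
    show "emeasure Q (prod_emb UNIV (\<lambda>_. X) J (Pi\<^sub>E J A)) = emeasure Q' (prod_emb UNIV (\<lambda>_. X) J (Pi\<^sub>E J A))"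
      using *[OF Q] *[OF Q'] fin by simp
  qed
qed

lemma is_chain_law_chain_law:
  assumes "markov_kernel X P" and "x \<in> space X"
  shows "is_chain_law X P x (chain_law X P x)"
proof -
  obtain Q where Q: "is_chain_law X P x Q" using is_chain_law_exists[OF assms] ..
  then show ?thesis
    unfolding chain_law_def by (rule theI) (rule is_chain_law_unique[OF assms(1) _ Q])
qed

text \<open>
  Here \<open>m\<close> may be infinite: \<open>m \<bind> f\<close> is the measure \<open>\<integral> f(x)(\<cdot>) m(dx)\<close>
  for every \<open>m\<close> on a nonempty space, see \<open>emeasure_bind\<close>. So the two sides of the equation are
  \<open>m(dx)K(x,dy)\<close> and \<open>m(dy)K'(y,dx)\<close>, evaluated at \<open>(x, y)\<close>.
\<close>
definition dual_wrt :: "'a measure \<Rightarrow> ('a \<Rightarrow> 'a measure) \<Rightarrow> ('a \<Rightarrow> 'a measure) \<Rightarrow> bool" where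
  "dual_wrt m K K' \<longleftrightarrow> markov_kernel m K \<and> markov_kernel m K' \<and>
     do {x \<leftarrow> m; y \<leftarrow> K x; return (m \<Otimes>\<^sub>M m) (x, y)} =
     do {y \<leftarrow> m; x \<leftarrow> K' y; return (m \<Otimes>\<^sub>M m) (x, y)}"

definition both_inf_often :: "'a measure \<Rightarrow> ('a \<Rightarrow> 'a measure) \<Rightarrow> 'a set \<Rightarrow> 'a set" where
  "both_inf_often X P A = {x\<in>space X.
     emeasure (chain_law X P x)
       {\<omega>\<in>space (path_space X). (\<exists>\<^sub>\<infinity>k. \<omega> k \<in> A) \<and> (\<exists>\<^sub>\<infinity>k. \<omega> k \<in> space X - A)} = 1}"

section \<open>Entrance and exit chains\<close>

text \<open>The cemetery state is \<^term>\<open>None\<close>; points of the state space are embedded by \<^term>\<open>Some\<close>.\<close>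
definition adjoin_cemetery :: "'a measure \<Rightarrow> 'a set \<Rightarrow> 'a option measure" where
  "adjoin_cemetery X B = sigma (insert None (Some ` B))
     ({Some ` C |C. C \<in> sets X \<and> C \<subseteq> B} \<union> {insert None (Some ` C) |C. C \<in> sets X \<and> C \<subseteq> B})"

lemma space_adjoin_cemetery: "space (adjoin_cemetery X B) = insert None (Some ` B)"
  by (simp add: adjoin_cemetery_def space_measure_of_conv)

lemma sets_adjoin_cemetery:
  assumes "B \<in> sets X"
  shows "sets (adjoin_cemetery X B) =
    {Some ` C |C. C \<in> sets X \<and> C \<subseteq> B} \<union> {insert None (Some ` C) |C. C \<in> sets X \<and> C \<subseteq> B}"
    (is "_ = ?F")
proof -
  have F: "Z \<in> ?F \<longleftrightarrow> Some -` Z \<in> sets X \<and> Some -` Z \<subseteq> B" for Z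
  proof
    assume "Z \<in> ?F"
    then obtain C where C: "C \<in> sets X" "C \<subseteq> B" and Z: "Z = Some ` C \<or> Z = insert None (Some ` C)"
      by blast
    have "Some -` Z = C" using Z by auto
    with C show "Some -` Z \<in> sets X \<and> Some -` Z \<subseteq> B" by simp
  next
    assume *: "Some -` Z \<in> sets X \<and> Some -` Z \<subseteq> B"
    have S: "z \<in> Some ` (Some -` Z) \<longleftrightarrow> z \<in> Z \<and> z \<noteq> None" for z
      by (cases z) auto
    show "Z \<in> ?F"
    proof (cases "None \<in> Z")
      case True
      then have "Z = insert None (Some ` (Some -` Z))" by (intro set_eqI) (metis S insert_iff)
      with * show ?thesis by blast
    next
      case False
      then have "Z = Some ` (Some -` Z)" by (intro set_eqI) (metis S)
      with * show ?thesis by blast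
    qed
  qed
  have "sigma_algebra (insert None (Some ` B)) ?F"
    unfolding sigma_algebra_iff2
  proof (intro conjI ballI allI impI)
    show "?F \<subseteq> Pow (insert None (Some ` B))" by auto
    show "{} \<in> ?F" by (simp only: F) simp
    show "insert None (Some ` B) - s \<in> ?F" if "s \<in> ?F" for s
    proof -
      have "Some -` (insert None (Some ` B) - s) = B - Some -` s" by auto
      then show ?thesis using that assms unfolding F by auto
    qed
    show "(\<Union>i. A i) \<in> ?F" if "range A \<subseteq> ?F" for A :: "nat \<Rightarrow> 'a option set"
    proof -
      have "A i \<in> ?F" for i using that by blast
      then have "Some -` A i \<in> sets X \<and> Some -` A i \<subseteq> B" for i by (simp only: F)
      then show ?thesis unfolding F vimage_UN by blast
    qed
  qed
  then show ?thesis
    unfolding adjoin_cemetery_def by (simp add: sigma_algebra.sets_measure_of_eq)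
qed

primrec entrance_time :: "'a set \<Rightarrow> nat \<Rightarrow> (nat \<Rightarrow> 'a) \<Rightarrow> enat" where
  "entrance_time B 0 \<omega> = 0"
| "entrance_time B (Suc n) \<omega> =
     Inf {enat k |k. entrance_time B n \<omega> < enat k \<and> \<omega> (k - 1) \<notin> B \<and> \<omega> k \<in> B}"

definition entrance_position :: "'a set \<Rightarrow> nat \<Rightarrow> (nat \<Rightarrow> 'a) \<Rightarrow> 'a option" where
  "entrance_position B n \<omega> = (case entrance_time B n \<omega> of enat k \<Rightarrow> Some (\<omega> k) | \<infinity> \<Rightarrow> None)"

text \<open>The position immediately before the \<open>n\<close>-th entrance into \<open>B\<close>, used only for \<open>n \<ge> 1\<close>.\<close>
definition exit_position :: "'a set \<Rightarrow> nat \<Rightarrow> (nat \<Rightarrow> 'a) \<Rightarrow> 'a option" where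
  "exit_position B n \<omega> = (case entrance_time B n \<omega> of enat k \<Rightarrow> Some (\<omega> (k - 1)) | \<infinity> \<Rightarrow> None)"

text \<open>
  The law of the first entrance position into \<open>B\<close> from an arbitrary starting point, where the chain
  started at the cemetery stays there. Restricted to starting points in \<open>B\<close> and the cemetery,
  this is the kernel of the entrance chain.
\<close>
definition entrance_law ::
    "'a measure \<Rightarrow> ('a \<Rightarrow> 'a measure) \<Rightarrow> 'a set \<Rightarrow> 'a option \<Rightarrow> 'a option measure" where
  "entrance_law X P B z = (case z of
      None \<Rightarrow> return (adjoin_cemetery X B) None
    | Some x \<Rightarrow> distr (chain_law X P x) (adjoin_cemetery X B) (entrance_position B 1))"

text \<open>
  The kernel of the chain of exits from \<open>D\<close>, on \<open>D\<close> with the cemetery adjoined; exits from \<open>D\<close>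
  occur immediately before entrances into the complement of \<open>D\<close>.
\<close>
definition exit_kernel ::
    "'a measure \<Rightarrow> ('a \<Rightarrow> 'a measure) \<Rightarrow> 'a set \<Rightarrow> 'a option \<Rightarrow> 'a option measure" where
  "exit_kernel X P D z = (case z of
      None \<Rightarrow> return (adjoin_cemetery X D) None
    | Some x \<Rightarrow>
        let B = space X - D;
            hit = {\<omega>\<in>space (path_space X). \<omega> 1 \<in> B}
        in if emeasure (chain_law X P x) hit > 0
           then do {y \<leftarrow> distr (uniform_measure (chain_law X P x) hit) X (\<lambda>\<omega>. \<omega> 1);
                    distr (chain_law X P y) (adjoin_cemetery X D) (exit_position B 1)}
           else return (adjoin_cemetery X D) None)"

definition entrance_measure ::
    "'a measure \<Rightarrow> 'a measure \<Rightarrow> ('a \<Rightarrow> 'a measure) \<Rightarrow> 'a set \<Rightarrow> 'a measure" where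
  "entrance_measure X \<mu> P B = measure_of B (sets (restrict_space X B))
     (\<lambda>C. \<integral>\<^sup>+x\<in>space X - B. emeasure (chain_law X P x) {\<omega>\<in>space (path_space X). \<omega> 1 \<in> C} \<partial>\<mu>)"

definition exit_measure ::
    "'a measure \<Rightarrow> 'a measure \<Rightarrow> ('a \<Rightarrow> 'a measure) \<Rightarrow> 'a set \<Rightarrow> 'a measure" where
  "exit_measure X \<mu> P D = density (restrict_space \<mu> D)
     (\<lambda>x. emeasure (chain_law X P x) {\<omega>\<in>space (path_space X). \<omega> 1 \<in> space X - D})"

text \<open>The measure \<open>C \<mapsto> \<nu>(C \<inter> N)\<close> for \<open>\<nu>\<close> on \<open>B\<close>; \<open>N\<close> does not contain the cemetery.\<close>
definition cut_measure ::
    "'a measure \<Rightarrow> 'a set \<Rightarrow> 'a set \<Rightarrow> 'a measure \<Rightarrow> 'a option measure" where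
  "cut_measure X B N \<nu> = measure_of (insert None (Some ` B)) (sets (adjoin_cemetery X B))
     (\<lambda>C. emeasure \<nu> (Some -` C \<inter> N))"

end

theory Submission
  imports Defs
begin

text \<open>
  Call a transition a jump if it leads from the complement of \<open>A\<close> into \<open>A\<close>, and let \<open>T\<^sub>W f(x)\<close> denote
  the integral of \<open>f(y)\<close> over the transitions \<open>(x, y) \<in> W\<close>. Splitting off the first step of the chain,
  the laws of the first entrance and exit positions become series \<open>\<Sum>n. T\<^sub>S\<^sup>n T\<^sub>J f\<close>, where \<open>J\<close> is
  the set of jumps and \<open>S\<close> its complement. Duality says that the adjoint of \<open>T\<^sub>W\<close> in \<open>L\<^sup>2(\<mu>)\<close> is the
  operator of the dual chain for the converse relation, and a jump of \<open>Y\<close> into \<open>A\<close> reversed is a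
  jump of the dual chain into the complement of \<open>A\<close>. So the series for \<open>Y\<close> and for the dual chain are
  adjoint to each other term by term. The set \<open>N\<close> is absorbing for both chains up to null
  sets, hence its indicator commutes with all the operators, and on \<open>N\<close> the cemetery is never reached.
\<close>

section \<open>The law of a Markov chain\<close>

text \<open>All functions take values in the extended nonnegative reals, so adjunction is an
  identity of integrals that may be infinite. The series represent entrance and exit laws only at
  recurrent starting points; an indicator of \<open>N\<close> must therefore stand next to a law
  before it is expanded, and is pushed through the operators to get there. The delicate point is
  invariance: \<open>P\<close> preserves \<open>N\<close>, but \<open>P'\<close> preserves the
  recurrent set of its own chain. The two sets differ by a null set, and \<open>P'\<close> does not
  charge it from almost every point because duality makes \<open>\<mu>\<close> invariant for
  \<open>P'\<close>. Equality of measures on pairs is tested on rectangles, which calls for an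
  exhaustion by sets of finite measure. It is inherited from \<open>\<mu>\<close> since the exit
  density is at most 1. The transport identities need one more ingredient: the powers between an
  entrance into \<open>A\<close> and the next departure are taken over \<open>A \<times> A\<close>,
  a relation equal to its converse. Their adjoints then form the first-jump series of the reversed
  chain for departures from the same set \<open>A\<close>, and recurrence makes this series sum to
  1.\<close>

primrec cylinder_integral ::
    "('a \<Rightarrow> 'a measure) \<Rightarrow> nat \<Rightarrow> (nat \<Rightarrow> 'a set) \<Rightarrow> ('a \<Rightarrow> ennreal) \<Rightarrow> 'a \<Rightarrow> ennreal" where
  "cylinder_integral P 0 A g x = indicator (A 0) x * g x"
| "cylinder_integral P (Suc n) A g x =
     indicator (A 0) x * (\<integral>\<^sup>+y. cylinder_integral P n (\<lambda>i. A (Suc i)) g y \<partial>P x)"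

text \<open>\<open>cylinder_integral\<close> is meant to be the mean of \<open>g\<close> at time
  \<open>n\<close> over the paths with position \<open>i\<close> in \<open>A i\<close> for all
  \<open>i \<le> n\<close>, built up from the first step. The definition of a chain law prescribes
  the last step instead; absorbing that step into \<open>g\<close> reconciles the two
  directions.\<close>

lemma cylinder_integral_Suc_last:
  "cylinder_integral P (Suc n) A g =
     cylinder_integral P n A (\<lambda>x. \<integral>\<^sup>+y. indicator (A (Suc n)) y * g y \<partial>P x)"
proof (induction n arbitrary: A)
  case (Suc n)
  show ?case
    by (rule ext, subst cylinder_integral.simps, subst Suc.IH) simp
qed (simp add: fun_eq_iff)

locale markov_chain =
  fixes X :: "'a measure" and P :: "'a \<Rightarrow> 'a measure"
  assumes markov: "markov_kernel X P"
begin

lemma kernel_prob [measurable]: "P \<in> X \<rightarrow>\<^sub>M prob_algebra X"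
  using markov by (simp add: markov_kernel_def)

lemma kernel [measurable]: "P \<in> X \<rightarrow>\<^sub>M subprob_algebra X"
  by (rule measurable_prob_algebraD) measurable

lemma sets_kernel_eq: "x \<in> space X \<Longrightarrow> sets (P x) = sets X"
  and space_kernel_eq: "x \<in> space X \<Longrightarrow> space (P x) = space X"
  and prob_space_kernel_eq: "x \<in> space X \<Longrightarrow> prob_space (P x)"
  using measurable_space[OF kernel_prob, of x]
  by (auto simp: space_prob_algebra intro!: sets_eq_imp_space_eq)

lemma measurable_cylinder_integral:
  assumes "\<And>i. A i \<in> sets X" and "g \<in> borel_measurable X"
  shows "cylinder_integral P n A g \<in> borel_measurable X"
  using assms
proof (induction n arbitrary: A)
  case 0
  have [measurable]: "A 0 \<in> sets X" "g \<in> borel_measurable X" by fact+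
  show ?case by simp
next
  case (Suc n)
  have [measurable]: "A 0 \<in> sets X" by (rule Suc)
  have [measurable]: "cylinder_integral P n (\<lambda>i. A (Suc i)) g \<in> borel_measurable X"
    by (rule Suc.IH) (use Suc in auto)
  have "(\<lambda>x. \<integral>\<^sup>+y. cylinder_integral P n (\<lambda>i. A (Suc i)) g y \<partial>P x) \<in> borel_measurable X"
    by (rule nn_integral_measurable_subprob_algebra2[OF _ kernel]) measurable
  then show ?case by simp
qed

text \<open>The Markov property passes from sets to functions \<open>g\<close> because each side is
  the integral of \<open>g\<close> against a measure on \<open>X\<close>, and the definition says
  that these two measures agree.\<close>

lemma is_chain_law_step:
  assumes Q: "is_chain_law X P x Q"
    and C: "C \<in> sets (PiM {..n} (\<lambda>_. X))" and g: "g \<in> borel_measurable X"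
  shows "(\<integral>\<^sup>+\<omega>. indicator C (restrict \<omega> {..n}) * g (\<omega> (Suc n)) \<partial>Q) =
         (\<integral>\<^sup>+\<omega>. indicator C (restrict \<omega> {..n}) * (\<integral>\<^sup>+y. g y \<partial>P (\<omega> n)) \<partial>Q)"
proof -
  have s[measurable_cong]: "sets Q = sets (path_space X)" using Q by (simp add: is_chain_law_def)
  interpret Q: prob_space Q using Q by (simp add: is_chain_law_def)
  have [measurable]: "(\<lambda>\<omega>. restrict \<omega> {..n}) \<in> Q \<rightarrow>\<^sub>M PiM {..n} (\<lambda>_. X)"
    unfolding measurable_cong_sets[OF s refl] by (rule measurable_restrict_subset) simp
  have [measurable]: "(\<lambda>\<omega>. \<omega> i) \<in> Q \<rightarrow>\<^sub>M X" for i
    unfolding measurable_cong_sets[OF s refl] by (rule measurable_component_singleton) simp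
  note C[measurable] g[measurable]
  \<comment> \<open>Weighting \<open>Q\<close> by the event in the past turns the two measures into
    the law of the position at time \<open>Suc n\<close> under \<open>R\<close> and the mixture of
    the kernels \<open>P (\<omega> n)\<close> under \<open>R\<close>.\<close>
  define R where "R = density Q (\<lambda>\<omega>. indicator C (restrict \<omega> {..n}) :: ennreal)"
  have [measurable_cong]: "sets R = sets Q" by (simp add: R_def)
  have ne: "space R \<noteq> {}" by (simp add: R_def Q.not_empty)
  have k[measurable]: "(\<lambda>\<omega>. P (\<omega> n)) \<in> R \<rightarrow>\<^sub>M subprob_algebra X" by measurable
  have "distr R X (\<lambda>\<omega>. \<omega> (Suc n)) = R \<bind> (\<lambda>\<omega>. P (\<omega> n))"
  proof (rule measure_eqI)
    show *: "sets (distr R X (\<lambda>\<omega>. \<omega> (Suc n))) = sets (R \<bind> (\<lambda>\<omega>. P (\<omega> n)))"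
      using sets_bind_measurable[OF k ne] by simp
    fix B assume "B \<in> sets (distr R X (\<lambda>\<omega>. \<omega> (Suc n)))"
    then have B[measurable]: "B \<in> sets X" by simp
    have "emeasure (distr R X (\<lambda>\<omega>. \<omega> (Suc n))) B =
        emeasure R ((\<lambda>\<omega>. \<omega> (Suc n)) -` B \<inter> space R)"
      by (intro emeasure_distr) measurable
    also have "\<dots> = (\<integral>\<^sup>+\<omega>. indicator {\<omega>\<in>space Q. restrict \<omega> {..n} \<in> C \<and> \<omega> (Suc n) \<in> B} \<omega> \<partial>Q)"
      unfolding R_def
      by (subst emeasure_density, measurable, rule nn_integral_cong) (auto split: split_indicator)
    also have "\<dots> = emeasure Q {\<omega>\<in>space Q. restrict \<omega> {..n} \<in> C \<and> \<omega> (Suc n) \<in> B}"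
      by (intro nn_integral_indicator) measurable
    also have "\<dots> = (\<integral>\<^sup>+\<omega>. indicator C (restrict \<omega> {..n}) * emeasure (P (\<omega> n)) B \<partial>Q)"
      using Q C B by (auto simp: is_chain_law_def)
    also have "\<dots> = (\<integral>\<^sup>+\<omega>. emeasure (P (\<omega> n)) B \<partial>R)"
      unfolding R_def by (intro nn_integral_density[symmetric]) measurable
    also have "\<dots> = emeasure (R \<bind> (\<lambda>\<omega>. P (\<omega> n))) B"
      by (rule emeasure_bind[symmetric, OF ne k B])
    finally show "emeasure (distr R X (\<lambda>\<omega>. \<omega> (Suc n))) B = emeasure (R \<bind> (\<lambda>\<omega>. P (\<omega> n))) B" .
  qed
  then have "(\<integral>\<^sup>+\<omega>. g (\<omega> (Suc n)) \<partial>R) = (\<integral>\<^sup>+\<omega>. \<integral>\<^sup>+y. g y \<partial>P (\<omega> n) \<partial>R)"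
    by (subst nn_integral_bind[symmetric, OF g k]) (simp add: nn_integral_distr flip: \<open>distr R _ _ = _\<close>)
  moreover have "(\<lambda>\<omega>. \<integral>\<^sup>+y. g y \<partial>P (\<omega> n)) \<in> borel_measurable Q"
    by (rule nn_integral_measurable_subprob_algebra2[where N=X]) measurable
  ultimately show ?thesis
    unfolding R_def by (simp add: nn_integral_density)
qed

text \<open>Identifies the finite-dimensional distributions. The induction removes the last step,
  which changes the test function, so \<open>g\<close> has to stay arbitrary.\<close>

lemma nn_integral_cylinder:
  assumes Q: "is_chain_law X P x Q" and x: "x \<in> space X"
    and A: "\<And>i. A i \<in> sets X" and g: "g \<in> borel_measurable X"
  shows "(\<integral>\<^sup>+\<omega>. indicator {\<omega>. \<forall>i\<le>n. \<omega> i \<in> A i} \<omega> * g (\<omega> n) \<partial>Q) = cylinder_integral P n A g x"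
  using g
proof (induction n arbitrary: g)
  have s[measurable_cong]: "sets Q = sets (path_space X)" using Q by (simp add: is_chain_law_def)
  note A[measurable]
  {
    case 0
    note 0[measurable]
    have "(\<integral>\<^sup>+\<omega>. indicator {\<omega>. \<forall>i\<le>0. \<omega> i \<in> A i} \<omega> * g (\<omega> 0) \<partial>Q) =
       (\<integral>\<^sup>+y. indicator (A 0) y * g y \<partial>distr Q X (\<lambda>\<omega>. \<omega> 0))"
      by (subst nn_integral_distr) (auto intro!: nn_integral_cong simp: indicator_def)
    also have "\<dots> = indicator (A 0) x * g x"
      using Q x by (auto simp: is_chain_law_def nn_integral_return)
    finally show ?case by simp
  next
    case (Suc n)
    note Suc.prems[measurable]
    let ?C = "Pi\<^sub>E {..n} A"
    have C: "?C \<in> sets (PiM {..n} (\<lambda>_. X))" by (rule sets_PiM_I_finite) auto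
    have g': "(\<lambda>y. indicator (A (Suc n)) y * g y) \<in> borel_measurable X" by measurable
    have 1: "indicator {\<omega>. \<forall>i\<le>Suc n. \<omega> i \<in> A i} \<omega> * g (\<omega> (Suc n)) =
        indicator ?C (restrict \<omega> {..n}) * (indicator (A (Suc n)) (\<omega> (Suc n)) * g (\<omega> (Suc n)))" for \<omega>
      by (auto simp: indicator_def le_Suc_eq PiE_iff)
    have 2: "indicator ?C (restrict \<omega> {..n}) = (indicator {\<omega>. \<forall>i\<le>n. \<omega> i \<in> A i} \<omega> :: ennreal)" for \<omega>
      by (auto simp: indicator_def PiE_iff)
    have "(\<lambda>x. \<integral>\<^sup>+y. indicator (A (Suc n)) y * g y \<partial>P x) \<in> borel_measurable X"
      by (rule nn_integral_measurable_subprob_algebra2[OF _ kernel]) measurable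
    from Suc.IH[OF this] show ?case
      unfolding 1 is_chain_law_step[OF Q C g'] unfolding 2 cylinder_integral_Suc_last .
  }
qed

section \<open>The law of the chain as a function of its starting point\<close>

abbreviation law :: "'a \<Rightarrow> (nat \<Rightarrow> 'a) measure" where
  "law \<equiv> chain_law X P"

lemma is_chain_law: "x \<in> space X \<Longrightarrow> is_chain_law X P x (law x)"
  by (rule is_chain_law_chain_law[OF markov])

lemma sets_law: "x \<in> space X \<Longrightarrow> sets (law x) = sets (path_space X)"
  and space_law: "x \<in> space X \<Longrightarrow> space (law x) = space (path_space X)"
  and prob_space_law: "x \<in> space X \<Longrightarrow> prob_space (law x)"
  using is_chain_law[of x] by (auto simp: is_chain_law_def intro!: sets_eq_imp_space_eq)

text \<open>Filling the coordinates outside \<open>J\<close> with the whole space turns a cylinder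
  over \<open>J\<close> into one over an initial segment of times.\<close>

lemma emeasure_law_prod_emb:
  assumes x: "x \<in> space X" and J: "finite J" and E: "\<And>i. i \<in> J \<Longrightarrow> E i \<in> sets X"
    and n: "J \<subseteq> {..n}"
  shows "emeasure (law x) (prod_emb UNIV (\<lambda>_. X) J (Pi\<^sub>E J E)) =
     cylinder_integral P n (\<lambda>i. if i \<in> J then E i else space X) (\<lambda>_. 1) x"
proof -
  let ?A = "\<lambda>i. if i \<in> J then E i else space X"
  let ?S = "prod_emb UNIV (\<lambda>_. X) J (Pi\<^sub>E J E)"
  have S: "?S \<in> sets (law x)"
    unfolding sets_law[OF x] using J E by (intro sets_PiM_I) auto
  have "emeasure (law x) ?S = (\<integral>\<^sup>+\<omega>. indicator ?S \<omega> \<partial>law x)"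
    using S by simp
  also have "\<dots> = (\<integral>\<^sup>+\<omega>. indicator {\<omega>. \<forall>i\<le>n. \<omega> i \<in> ?A i} \<omega> * 1 \<partial>law x)"
    using n by (intro nn_integral_cong)
      (auto simp: space_law[OF x] indicator_def prod_emb_def PiE_iff space_PiM split: if_splits)
  also have "\<dots> = cylinder_integral P n ?A (\<lambda>_. 1) x"
    by (rule nn_integral_cylinder[OF is_chain_law[OF x] x]) (use E in auto)
  finally show ?thesis .
qed

text \<open>\<open>chain_law\<close> is a definite description, which reveals nothing about its
  dependence on \<open>x\<close>. Measurability is therefore tested on the cylinders, an
  intersection-stable generator, where an explicit formula is available.\<close>

lemma measurable_law [measurable]: "law \<in> X \<rightarrow>\<^sub>M prob_algebra (path_space X)"
proof (rule measurable_prob_algebra_generated[OF sets_PiM Int_stable_prod_algebra prod_algebra_sets_into_space])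
  fix S assume "S \<in> prod_algebra UNIV (\<lambda>_::nat. X)"
  then obtain J E where S: "S = prod_emb UNIV (\<lambda>_. X) J (Pi\<^sub>E J E)" and J: "finite J"
    and E: "\<And>i. i \<in> J \<Longrightarrow> E i \<in> sets X"
    by (rule prod_algebraE) auto
  obtain n where n: "J \<subseteq> {..n}" using J finite_nat_iff_bounded_le by blast
  show "(\<lambda>x. emeasure (law x) S) \<in> borel_measurable X"
    unfolding S using E
    by (subst measurable_cong[OF emeasure_law_prod_emb[OF _ J E n]])
       (auto intro!: measurable_cylinder_integral)
qed (auto simp: prob_space_law sets_law)

lemma measurable_law_subprob [measurable]: "law \<in> X \<rightarrow>\<^sub>M subprob_algebra (path_space X)"
  by (rule measurable_prob_algebraD) measurable

lemma measurable_case_nat_path: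
  assumes x: "x \<in> space X"
  shows "case_nat x \<in> path_space X \<rightarrow>\<^sub>M path_space X"
proof (rule measurable_PiM_single')
  fix i :: nat
  show "(\<lambda>\<omega>. case_nat x \<omega> i) \<in> path_space X \<rightarrow>\<^sub>M X"
    using x by (cases i) auto
qed (use x in \<open>auto simp: space_PiM PiE_iff split: nat.split\<close>)

text \<open>\<open>case_nat x\<close> puts \<open>x\<close> in front of a path. On cylinders the
  identity is the recursion that defines \<open>cylinder_integral\<close>, and cylinders determine a
  finite measure. Every first-step argument below rests on it.\<close>

lemma law_first_step:
  assumes x: "x \<in> space X"
  shows "law x = P x \<bind> (\<lambda>y. distr (law y) (path_space X) (case_nat x))" (is "_ = ?R")
proof (rule measure_eqI_PiM_infinite)
  interpret Px: prob_space "P x" by (rule prob_space_kernel_eq[OF x])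
  interpret law: prob_space "law x" by (rule prob_space_law[OF x])
  note [measurable] = measurable_case_nat_path[OF x]
  have [measurable_cong]: "sets (P x) = sets X" by (rule sets_kernel_eq[OF x])
  have k: "(\<lambda>y. distr (law y) (path_space X) (case_nat x)) \<in> P x \<rightarrow>\<^sub>M subprob_algebra (path_space X)"
    unfolding measurable_cong_sets[OF sets_kernel_eq[OF x] refl]
    by (rule measurable_compose[OF measurable_law_subprob measurable_distr[OF measurable_case_nat_path[OF x]]])
  show "sets (law x) = sets (path_space X)" by (rule sets_law[OF x])
  show "sets ?R = sets (path_space X)" by (rule sets_bind_measurable[OF k Px.not_empty])
  show "finite_measure (law x)" by (rule law.finite_measure_axioms)
  fix E and J :: "nat set" assume J: "finite J" and E: "\<And>i. i \<in> J \<Longrightarrow> E i \<in> sets X"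
  obtain n where n: "J \<subseteq> {..n}" using J finite_nat_iff_bounded_le by blast
  define A where "A i = (if i \<in> J then E i else space X)" for i
  have A[measurable]: "A i \<in> sets X" for i using E by (auto simp: A_def)
  let ?S = "prod_emb UNIV (\<lambda>_. X) J (Pi\<^sub>E J E)"
  have S[measurable]: "?S \<in> sets (path_space X)" using J E by (intro sets_PiM_I) auto
  have n': "J \<subseteq> {..Suc n}" using n by auto
  have "emeasure (law x) ?S = cylinder_integral P (Suc n) A (\<lambda>_. 1) x"
    using emeasure_law_prod_emb[OF x J E n'] unfolding A_def by simp
  also have "\<dots> = (\<integral>\<^sup>+y. indicator (A 0) x * cylinder_integral P n (\<lambda>i. A (Suc i)) (\<lambda>_. 1) y \<partial>P x)"
    using measurable_cylinder_integral[of "\<lambda>i. A (Suc i)" "\<lambda>_. 1" n]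
    by (subst nn_integral_cmult) (auto simp: measurable_cong_sets[OF sets_kernel_eq[OF x] refl])
  also have "\<dots> = (\<integral>\<^sup>+y. emeasure (distr (law y) (path_space X) (case_nat x)) ?S \<partial>P x)"
  proof (rule nn_integral_cong)
    fix y assume "y \<in> space (P x)"
    then have y: "y \<in> space X" by (simp add: space_kernel_eq[OF x])
    have [measurable_cong]: "sets (law y) = sets (path_space X)" by (rule sets_law[OF y])
    have "emeasure (distr (law y) (path_space X) (case_nat x)) ?S
        = (\<integral>\<^sup>+\<omega>. indicator ?S \<omega> \<partial>distr (law y) (path_space X) (case_nat x))"
      by simp
    also have "\<dots> = (\<integral>\<^sup>+\<omega>. indicator ?S (case_nat x \<omega>) \<partial>law y)"
      by (rule nn_integral_distr) measurable
    also have "\<dots> = (\<integral>\<^sup>+\<omega>. indicator (A 0) x * (indicator {\<omega>. \<forall>i\<le>n. \<omega> i \<in> A (Suc i)} \<omega> * 1) \<partial>law y)"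
    proof (rule nn_integral_cong)
      fix \<omega> assume "\<omega> \<in> space (law y)"
      then have \<omega>: "\<omega> i \<in> space X" for i by (auto simp: space_law[OF y] space_PiM PiE_iff)
      have "case_nat x \<omega> \<in> ?S \<longleftrightarrow> (\<forall>i\<in>J. case_nat x \<omega> i \<in> E i)"
        using x \<omega> by (auto simp: prod_emb_def PiE_iff split: nat.split)
      also have "\<dots> \<longleftrightarrow> (\<forall>i\<le>Suc n. case_nat x \<omega> i \<in> A i)"
        using x \<omega> n' by (auto simp: A_def split: nat.split)
      also have "\<dots> \<longleftrightarrow> x \<in> A 0 \<and> (\<forall>i\<le>n. \<omega> i \<in> A (Suc i))"
        using All_less_Suc2[of "Suc n" "\<lambda>i. case_nat x \<omega> i \<in> A i"] by (simp add: less_Suc_eq_le)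
      finally show "indicator ?S (case_nat x \<omega>) =
          (indicator (A 0) x * (indicator {\<omega>. \<forall>i\<le>n. \<omega> i \<in> A (Suc i)} \<omega> * 1) :: ennreal)"
        by (auto simp: indicator_def)
    qed
    also have "\<dots> = indicator (A 0) x * cylinder_integral P n (\<lambda>i. A (Suc i)) (\<lambda>_. 1) y"
      by (subst nn_integral_cmult) (auto simp: nn_integral_cylinder[OF is_chain_law[OF y] y, of "\<lambda>i. A (Suc i)" "\<lambda>_. 1" n, simplified])
    finally show "indicator (A 0) x * cylinder_integral P n (\<lambda>i. A (Suc i)) (\<lambda>_. 1) y =
        emeasure (distr (law y) (path_space X) (case_nat x)) ?S" ..
  qed
  also have "\<dots> = emeasure ?R ?S"
    by (rule emeasure_bind[symmetric, OF Px.not_empty k S])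
  finally show "emeasure (law x) ?S = emeasure ?R ?S" .
qed

lemma nn_integral_law:
  assumes x: "x \<in> space X" and F[measurable]: "F \<in> borel_measurable (path_space X)"
  shows "(\<integral>\<^sup>+\<omega>. F \<omega> \<partial>law x) = (\<integral>\<^sup>+y. \<integral>\<^sup>+\<omega>. F (case_nat x \<omega>) \<partial>law y \<partial>P x)"
proof -
  note [measurable] = measurable_case_nat_path[OF x]
  have [measurable_cong]: "sets (P x) = sets X" by (rule sets_kernel_eq[OF x])
  have k: "(\<lambda>y. distr (law y) (path_space X) (case_nat x)) \<in> P x \<rightarrow>\<^sub>M subprob_algebra (path_space X)"
    unfolding measurable_cong_sets[OF sets_kernel_eq[OF x] refl]
    by (rule measurable_compose[OF measurable_law_subprob measurable_distr[OF measurable_case_nat_path[OF x]]])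
  have "(\<integral>\<^sup>+\<omega>. F \<omega> \<partial>distr (law y) (path_space X) (case_nat x)) = (\<integral>\<^sup>+\<omega>. F (case_nat x \<omega>) \<partial>law y)"
    if "y \<in> space (P x)" for y
  proof -
    from that have y: "y \<in> space X" by (simp add: space_kernel_eq[OF x])
    have [measurable_cong]: "sets (law y) = sets (path_space X)" by (rule sets_law[OF y])
    show ?thesis by (rule nn_integral_distr) measurable
  qed
  then show ?thesis
    unfolding law_first_step[OF x] nn_integral_bind[OF F k] by (rule nn_integral_cong)
qed

text \<open>Stands in for \<open>\<omega> 0 = x\<close> almost surely, an event that need not be
  measurable.\<close>

lemma nn_integral_law_0:
  assumes x: "x \<in> space X" and g: "g \<in> borel_measurable X"
  shows "(\<integral>\<^sup>+\<omega>. g (\<omega> 0) \<partial>law x) = g x"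
proof -
  have [measurable_cong]: "sets (law x) = sets (path_space X)" by (rule sets_law[OF x])
  have "(\<integral>\<^sup>+\<omega>. g (\<omega> 0) \<partial>law x) = (\<integral>\<^sup>+y. g y \<partial>distr (law x) X (\<lambda>\<omega>. \<omega> 0))"
    using g by (intro nn_integral_distr[symmetric]) auto
  then show ?thesis
    using is_chain_law[OF x] x g by (simp add: is_chain_law_def nn_integral_return)
qed

lemma distr_law_1:
  assumes x: "x \<in> space X"
  shows "distr (law x) X (\<lambda>\<omega>. \<omega> 1) = P x"
proof (rule measure_eqI)
  show "sets (distr (law x) X (\<lambda>\<omega>. \<omega> 1)) = sets (P x)" by (simp add: sets_kernel_eq[OF x])
  fix B assume "B \<in> sets (distr (law x) X (\<lambda>\<omega>. \<omega> 1))"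
  then have B[measurable]: "B \<in> sets X" by simp
  have [measurable_cong]: "sets (law x) = sets (path_space X)" by (rule sets_law[OF x])
  have "emeasure (distr (law x) X (\<lambda>\<omega>. \<omega> 1)) B = (\<integral>\<^sup>+\<omega>. indicator B (\<omega> 1) \<partial>law x)"
    by (subst nn_integral_distr[of _ _ X, symmetric]) auto
  also have "\<dots> = (\<integral>\<^sup>+y. \<integral>\<^sup>+\<omega>. indicator B (\<omega> 0) \<partial>law y \<partial>P x)"
    by (subst nn_integral_law[OF x]) auto
  also have "\<dots> = (\<integral>\<^sup>+y. indicator B y \<partial>P x)"
    by (intro nn_integral_cong nn_integral_law_0) (auto simp: space_kernel_eq[OF x])
  also have "\<dots> = emeasure (P x) B" by (simp add: sets_kernel_eq[OF x])
  finally show "emeasure (distr (law x) X (\<lambda>\<omega>. \<omega> 1)) B = emeasure (P x) B" .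
qed

lemma emeasure_law_1:
  assumes x: "x \<in> space X" and C[measurable]: "C \<in> sets X"
  shows "emeasure (law x) {\<omega>\<in>space (path_space X). \<omega> 1 \<in> C} = emeasure (P x) C"
proof -
  have [measurable_cong]: "sets (law x) = sets (path_space X)" by (rule sets_law[OF x])
  have "emeasure (P x) C = emeasure (distr (law x) X (\<lambda>\<omega>. \<omega> 1)) C" by (simp only: distr_law_1[OF x])
  also have "\<dots> = emeasure (law x) ((\<lambda>\<omega>. \<omega> 1) -` C \<inter> space (law x))"
    by (rule emeasure_distr) measurable
  also have "(\<lambda>\<omega>. \<omega> 1) -` C \<inter> space (law x) = {\<omega>\<in>space (path_space X). \<omega> 1 \<in> C}"
    by (auto simp: space_law[OF x])
  finally show ?thesis ..
qed

end

section \<open>First jumps\<close>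

definition transition ::
    "('a \<Rightarrow> 'a measure) \<Rightarrow> ('a \<times> 'a) set \<Rightarrow> ('a \<Rightarrow> ennreal) \<Rightarrow> 'a \<Rightarrow> ennreal" where
  "transition P W f x = (\<integral>\<^sup>+y. indicator W (x, y) * f y \<partial>P x)"

text \<open>The index is the time immediately before the jump and the entrance happens at
  \<open>Suc n\<close>, so exit and entrance positions are read off from the same
  \<open>n\<close>.\<close>

definition first_jump :: "'a set \<Rightarrow> nat \<Rightarrow> (nat \<Rightarrow> 'a) \<Rightarrow> bool" where
  "first_jump B n \<omega> \<longleftrightarrow>
     \<omega> n \<notin> B \<and> \<omega> (Suc n) \<in> B \<and> (\<forall>k<n. \<not> (\<omega> k \<notin> B \<and> \<omega> (Suc k) \<in> B))"

lemma first_jump_case_nat_0: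
  "first_jump B 0 (case_nat x \<omega>) \<longleftrightarrow> x \<notin> B \<and> \<omega> 0 \<in> B"
  by (simp add: first_jump_def)

lemma first_jump_case_nat_Suc:
  "first_jump B (Suc n) (case_nat x \<omega>) \<longleftrightarrow> \<not> (x \<notin> B \<and> \<omega> 0 \<in> B) \<and> first_jump B n \<omega>"
  by (auto simp: first_jump_def All_less_Suc2)

lemma first_jump_unique: "first_jump B n \<omega> \<Longrightarrow> first_jump B m \<omega> \<Longrightarrow> n = m"
  by (metis first_jump_def nat_neq_iff)

lemma ex_first_jump_iff: "(\<exists>n. first_jump B n \<omega>) \<longleftrightarrow> (\<exists>n. \<omega> n \<notin> B \<and> \<omega> (Suc n) \<in> B)"
  using exists_least_iff[of "\<lambda>n. \<omega> n \<notin> B \<and> \<omega> (Suc n) \<in> B"]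
  by (auto simp: first_jump_def)

text \<open>\<open>entrance_time B 0\<close> is zero, so the infimum runs over \<open>k > 0\<close>
  and \<open>k - 1\<close> is a true predecessor; the least such \<open>k\<close> is one more than
  the index of the first jump.\<close>

lemma entrance_time_first_jump:
  assumes "first_jump B n \<omega>"
  shows "entrance_time B 1 \<omega> = enat (Suc n)"
proof -
  have "Inf {enat k |k. 0 < enat k \<and> \<omega> (k - 1) \<notin> B \<and> \<omega> k \<in> B} = enat (Suc n)"
  proof (rule antisym)
    show "Inf {enat k |k. 0 < enat k \<and> \<omega> (k - 1) \<notin> B \<and> \<omega> k \<in> B} \<le> enat (Suc n)"
      using assms by (intro Inf_lower) (auto simp: first_jump_def zero_enat_def)
    have "Suc n \<le> k" if "0 < k" "\<omega> (k - 1) \<notin> B" "\<omega> k \<in> B" for k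
      using that assms by (cases k) (auto simp: first_jump_def not_less[symmetric])
    then show "enat (Suc n) \<le> Inf {enat k |k. 0 < enat k \<and> \<omega> (k - 1) \<notin> B \<and> \<omega> k \<in> B}"
      by (intro Inf_greatest) (auto simp: zero_enat_def)
  qed
  then show ?thesis by simp
qed

lemma entrance_time_no_jump:
  assumes "\<nexists>n. first_jump B n \<omega>"
  shows "entrance_time B 1 \<omega> = \<infinity>"
proof -
  have "\<not> (\<omega> (k - 1) \<notin> B \<and> \<omega> k \<in> B)" if "0 < k" for k
    using assms that unfolding ex_first_jump_iff by (cases k) auto
  then have *: "{enat k |k. 0 < enat k \<and> \<omega> (k - 1) \<notin> B \<and> \<omega> k \<in> B} = {}"
    by (auto simp: zero_enat_def)
  have "Inf {enat k |k. 0 < enat k \<and> \<omega> (k - 1) \<notin> B \<and> \<omega> k \<in> B} = \<infinity>"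
    unfolding * by (simp add: Inf_enat_def)
  then show ?thesis by simp
qed

lemma entrance_position_first_jump: "first_jump B n \<omega> \<Longrightarrow> entrance_position B 1 \<omega> = Some (\<omega> (Suc n))"
  and exit_position_first_jump: "first_jump B n \<omega> \<Longrightarrow> exit_position B 1 \<omega> = Some (\<omega> n)"
  using entrance_time_first_jump[of B n \<omega>] by (auto simp: entrance_position_def exit_position_def)

lemma entrance_position_no_jump: "\<nexists>n. first_jump B n \<omega> \<Longrightarrow> entrance_position B 1 \<omega> = None"
  and exit_position_no_jump: "\<nexists>n. first_jump B n \<omega> \<Longrightarrow> exit_position B 1 \<omega> = None"
  using entrance_time_no_jump[of B \<omega>] by (auto simp: entrance_position_def exit_position_def)

text \<open>A path without jumps can never come back to \<open>B\<close> once it is outside.\<close>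

lemma ex_first_jump_if_inf_often:
  assumes "\<exists>\<^sub>\<infinity>k. \<omega> k \<in> B" and "\<exists>\<^sub>\<infinity>k. \<omega> k \<notin> B"
  shows "\<exists>n. first_jump B n \<omega>"
proof (rule ccontr)
  assume "\<nexists>n. first_jump B n \<omega>"
  then have no: "\<omega> k \<notin> B \<Longrightarrow> \<omega> (Suc k) \<notin> B" for k by (auto simp: ex_first_jump_iff)
  obtain i where i: "\<omega> i \<notin> B" using assms(2) by (auto simp: INFM_nat)
  have "\<omega> (i + k) \<notin> B" for k by (induction k) (use i no in auto)
  moreover obtain j where "i < j" "\<omega> j \<in> B" using assms(1) by (auto simp: INFM_nat)
  ultimately show False by (metis less_imp_add_positive)
qed

section \<open>Measurability in the state space with cemetery\<close>

lemma sets_adjoin_cemetery_iff: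
  assumes B: "B \<in> sets X"
  shows "E \<in> sets (adjoin_cemetery X B) \<longleftrightarrow> E \<subseteq> insert None (Some ` B) \<and> Some -` E \<in> sets X"
proof
  assume "E \<in> sets (adjoin_cemetery X B)"
  then obtain C where "C \<in> sets X" "C \<subseteq> B" "E = Some ` C \<or> E = insert None (Some ` C)"
    unfolding sets_adjoin_cemetery[OF B] by blast
  moreover from this have "Some -` E = C" "E \<subseteq> insert None (Some ` B)" by auto
  ultimately show "E \<subseteq> insert None (Some ` B) \<and> Some -` E \<in> sets X" by simp
next
  assume E: "E \<subseteq> insert None (Some ` B) \<and> Some -` E \<in> sets X"
  have "E = Some ` (Some -` E) \<or> E = insert None (Some ` (Some -` E))"
  proof (cases "None \<in> E")
    case True
    then have "E = insert None (Some ` (Some -` E))" using E by auto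
    then show ?thesis ..
  next
    case False
    then have "E = Some ` (Some -` E)"
      by (auto simp: image_iff) (metis option.exhaust)
    then show ?thesis ..
  qed
  moreover have "Some -` E \<subseteq> B" using E by auto
  ultimately show "E \<in> sets (adjoin_cemetery X B)"
    using E unfolding sets_adjoin_cemetery[OF B] by blast
qed

text \<open>The cemetery is a measurable point by itself, so measurability is decided on the copy of
  \<open>B\<close>; at \<open>None\<close> only the value must lie in the target space.\<close>

lemma measurable_adjoin_cemetery:
  assumes B: "B \<in> sets X" and f: "(\<lambda>x. f (Some x)) \<in> restrict_space X B \<rightarrow>\<^sub>M M"
    and None: "f None \<in> space M"
  shows "f \<in> adjoin_cemetery X B \<rightarrow>\<^sub>M M"
proof (rule measurableI)
  have sp: "B \<inter> space X = B" using sets.sets_into_space[OF B] by auto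
  show "f z \<in> space M" if "z \<in> space (adjoin_cemetery X B)" for z
    using that None measurable_space[OF f] by (auto simp: space_adjoin_cemetery space_restrict_space sp)
  fix S assume S: "S \<in> sets M"
  have "Some -` (f -` S \<inter> space (adjoin_cemetery X B)) = (\<lambda>x. f (Some x)) -` S \<inter> space (restrict_space X B)"
    by (auto simp: space_adjoin_cemetery space_restrict_space sp)
  also have "\<dots> \<in> sets X"
    using measurable_sets[OF f S] B by (subst (asm) sets_restrict_space_iff) (auto simp: sp)
  finally show "f -` S \<inter> space (adjoin_cemetery X B) \<in> sets (adjoin_cemetery X B)"
    unfolding sets_adjoin_cemetery_iff[OF B] by (auto simp: space_adjoin_cemetery)
qed

lemma measurable_Some_adjoin_cemetery:
  assumes B: "B \<in> sets X"
  shows "Some \<in> restrict_space X B \<rightarrow>\<^sub>M adjoin_cemetery X B"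
  using sets.sets_into_space[OF B]
  by (intro measurableI)
     (auto simp: sets_adjoin_cemetery_iff[OF B] space_adjoin_cemetery space_restrict_space
       sets_restrict_space_iff B)

text \<open>The two conditions on the path trade places. This symmetry allows results to be reused
  with the complement of \<open>A\<close>.\<close>

lemma both_inf_often_Compl:
  assumes A: "A \<in> sets X"
  shows "both_inf_often X P (space X - A) = both_inf_often X P A"
proof -
  have *: "space X - (space X - A) = A" using sets.sets_into_space[OF A] by auto
  show ?thesis unfolding both_inf_often_def * by (simp only: conj_commute)
qed

section \<open>Operators of restricted transitions and the first-jump series\<close>

context markov_chain
begin

lemma measurable_transition [measurable]:
  assumes [measurable]: "W \<in> sets (X \<Otimes>\<^sub>M X)" "f \<in> borel_measurable X"
  shows "transition P W f \<in> borel_measurable X"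
  unfolding transition_def[abs_def]
  by (rule nn_integral_measurable_subprob_algebra2[OF _ kernel]) measurable

lemma measurable_transition_power [measurable]:
  assumes [measurable]: "W \<in> sets (X \<Otimes>\<^sub>M X)" "f \<in> borel_measurable X"
  shows "(transition P W ^^ n) f \<in> borel_measurable X"
  by (induction n) simp_all

lemma transition_suminf:
  assumes x: "x \<in> space X" and [measurable]: "W \<in> sets (X \<Otimes>\<^sub>M X)" "\<And>n. s n \<in> borel_measurable X"
  shows "transition P W (\<lambda>y. \<Sum>n. s n y) x = (\<Sum>n. transition P W (s n) x)"
proof -
  note x[measurable]
  have "(\<lambda>y. indicator W (x, y) * s n y) \<in> borel_measurable X" for n by measurable
  then have "(\<lambda>y. indicator W (x, y) * s n y) \<in> borel_measurable (P x)" for n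
    by (simp only: measurable_cong_sets[OF sets_kernel_eq[OF x] refl])
  from nn_integral_suminf[OF this] show ?thesis
    by (simp add: transition_def)
qed

end

text \<open>Instantiated later for both kernels, with \<open>A\<close> as well as its complement, so
  that \<open>jump\<close> means an entrance into \<open>A\<close> or a departure from it.\<close>

locale markov_chain_set = markov_chain +
  fixes B
  assumes B [measurable]: "B \<in> sets X"
begin

abbreviation jump :: "('a \<times> 'a) set" where
  "jump \<equiv> (space X - B) \<times> B"

abbreviation no_jump :: "('a \<times> 'a) set" where
  "no_jump \<equiv> space X \<times> space X - jump"

lemma sets_no_jump [measurable]: "no_jump \<in> sets (X \<Otimes>\<^sub>M X)"
  using B by auto

lemma measurable_first_jump [measurable]: "Measurable.pred (path_space X) (first_jump B n)"
  unfolding first_jump_def by measurable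

text \<open>First-step analysis: unless the step from \<open>x\<close> is itself a jump, prepending
  \<open>x\<close> only delays the first jump by one. \<open>C\<close> constrains the position
  before the jump and \<open>D\<close> the one after it, so a single formula serves exit and
  entrance positions.\<close>

lemma nn_integral_first_jump:
  assumes x: "x \<in> space X" and CD[measurable]: "C \<in> sets X" "D \<in> sets X"
  shows "(\<integral>\<^sup>+\<omega>. indicator {\<omega>. first_jump B n \<omega> \<and> \<omega> n \<in> C \<and> \<omega> (Suc n) \<in> D} \<omega> \<partial>law x) =
     (transition P no_jump ^^ n) (\<lambda>x. indicator C x * transition P jump (indicator D) x) x"
  using x
proof (induction n arbitrary: x)
  case (0 x)
  have "(\<integral>\<^sup>+\<omega>. indicator {\<omega>. first_jump B 0 \<omega> \<and> \<omega> 0 \<in> C \<and> \<omega> (Suc 0) \<in> D} \<omega> \<partial>law x) =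
     (\<integral>\<^sup>+y. \<integral>\<^sup>+\<omega>. indicator C x * (indicator jump (x, \<omega> 0) * indicator D (\<omega> 0)) \<partial>law y \<partial>P x)"
    using 0 by (subst nn_integral_law)
      (auto intro!: nn_integral_cong simp: first_jump_case_nat_0 indicator_def)
  also have "\<dots> = (\<integral>\<^sup>+y. indicator C x * (indicator jump (x, y) * indicator D y) \<partial>P x)"
    by (intro nn_integral_cong nn_integral_law_0) (use 0 in \<open>auto simp: space_kernel_eq\<close>)
  also have "\<dots> = indicator C x * transition P jump (indicator D) x"
  proof -
    have [measurable_cong]: "sets (P x) = sets X" using sets_kernel_eq 0 by simp
    show ?thesis unfolding transition_def using 0 by (intro nn_integral_cmult) measurable
  qed
  finally show ?case by simp
next
  case (Suc n x)
  let ?E = "\<lambda>n. {\<omega>. first_jump B n \<omega> \<and> \<omega> n \<in> C \<and> \<omega> (Suc n) \<in> D}"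
  have "(\<integral>\<^sup>+\<omega>. indicator (?E (Suc n)) \<omega> \<partial>law x) =
     (\<integral>\<^sup>+y. \<integral>\<^sup>+\<omega>. indicator (?E (Suc n)) (case_nat x \<omega>) \<partial>law y \<partial>P x)"
    using Suc.prems by (intro nn_integral_law) measurable
  also have "\<dots> = (\<integral>\<^sup>+y. indicator no_jump (x, y) * (\<integral>\<^sup>+\<omega>. indicator (?E n) \<omega> \<partial>law y) \<partial>P x)"
  proof (rule nn_integral_cong)
    fix y assume "y \<in> space (P x)"
    then have y: "y \<in> space X" using Suc.prems by (simp add: space_kernel_eq)
    have [measurable_cong]: "sets (law y) = sets (path_space X)" by (rule sets_law[OF y])
    have "(\<integral>\<^sup>+\<omega>. indicator (?E (Suc n)) (case_nat x \<omega>) \<partial>law y) =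
      (\<integral>\<^sup>+\<omega>. indicator no_jump (x, \<omega> 0) * indicator (?E n) \<omega> \<partial>law y)"
      using Suc.prems
      by (intro nn_integral_cong)
        (auto simp: first_jump_case_nat_Suc indicator_def space_law[OF y] space_PiM PiE_iff)
    also have "\<dots> = (\<integral>\<^sup>+\<omega>. indicator no_jump (x, y) * indicator (?E n) \<omega> \<partial>law y)"
    proof (rule nn_integral_cong_AE)
      \<comment> \<open>The set \<open>{y}\<close> need not be measurable, so
        \<open>\<omega> 0 = y\<close> is replaced by agreement on membership in \<open>B\<close>;
        besides membership in \<open>space X\<close>, this is all that \<open>no_jump\<close> looks
        at.\<close>
      have init: "distr (law y) X (\<lambda>\<omega>. \<omega> 0) = return X y"
        using is_chain_law[OF y] by (simp add: is_chain_law_def)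
      have "AE z in distr (law y) X (\<lambda>\<omega>. \<omega> 0). z \<in> B \<longleftrightarrow> y \<in> B"
        unfolding init by (subst AE_return[OF y]) measurable
      then have "AE \<omega> in law y. \<omega> 0 \<in> B \<longleftrightarrow> y \<in> B"
        by (subst (asm) AE_distr_iff) auto
      moreover have "AE \<omega> in law y. \<omega> 0 \<in> space X"
        by (rule AE_I2) (auto simp: space_law[OF y] space_PiM PiE_iff)
      ultimately show "AE \<omega> in law y. indicator no_jump (x, \<omega> 0) * indicator (?E n) \<omega> =
          indicator no_jump (x, y) * (indicator (?E n) \<omega> :: ennreal)"
        by eventually_elim (use y in \<open>auto simp: indicator_def\<close>)
    qed
    also have "\<dots> = indicator no_jump (x, y) * (\<integral>\<^sup>+\<omega>. indicator (?E n) \<omega> \<partial>law y)"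
      by (rule nn_integral_cmult) measurable
    finally show "(\<integral>\<^sup>+\<omega>. indicator (?E (Suc n)) (case_nat x \<omega>) \<partial>law y) =
        indicator no_jump (x, y) * (\<integral>\<^sup>+\<omega>. indicator (?E n) \<omega> \<partial>law y)" .
  qed
  also have "\<dots> = (\<integral>\<^sup>+y. indicator no_jump (x, y) *
      (transition P no_jump ^^ n) (\<lambda>x. indicator C x * transition P jump (indicator D) x) y \<partial>P x)"
    using Suc.prems by (intro nn_integral_cong) (simp add: Suc.IH space_kernel_eq)
  finally show ?case by (subst funpow.simps, subst comp_apply, subst transition_def)
qed

section \<open>Starting points from which both the set and its complement are visited infinitely
  often\<close>

abbreviation recurrent :: "'a set" where
  "recurrent \<equiv> both_inf_often X P B"

abbreviation inf_often :: "(nat \<Rightarrow> 'a) set" where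
  "inf_often \<equiv> {\<omega>\<in>space (path_space X). (\<exists>\<^sub>\<infinity>k. \<omega> k \<in> B) \<and> (\<exists>\<^sub>\<infinity>k. \<omega> k \<in> space X - B)}"

lemma sets_inf_often [measurable]: "inf_often \<in> sets (path_space X)"
  unfolding INFM_nat by measurable

lemma sets_recurrent [measurable]: "recurrent \<in> sets X"
  unfolding both_inf_often_def
  using measurable_compose[OF measurable_law_subprob measurable_emeasure_subprob_algebra[OF sets_inf_often]]
  by measurable

lemma case_nat_inf_often:
  assumes x: "x \<in> space X" and \<omega>: "\<omega> \<in> space (path_space X)"
  shows "case_nat x \<omega> \<in> inf_often \<longleftrightarrow> \<omega> \<in> inf_often"
proof -
  have *: "(\<exists>\<^sub>\<infinity>k. Q (case_nat x \<omega> k)) \<longleftrightarrow> (\<exists>\<^sub>\<infinity>k. Q (\<omega> k))" for Q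
    using MOST_Suc_iff[of "\<lambda>k. \<not> Q (case_nat x \<omega> k)"] unfolding frequently_def nat.case by simp
  show ?thesis
    using x \<omega> measurable_space[OF measurable_case_nat_path[OF x] \<omega>] 
    by (simp add: *[of "\<lambda>z. z \<in> B"] *[of "\<lambda>z. z \<in> space X \<and> z \<notin> B"])
qed

text \<open>The probability \<open>h\<close> of alternating forever is harmonic, as the first
  position of a path does not affect the event: \<open>h x\<close> is the mean of \<open>h\<close>
  under \<open>P x\<close>. Since \<open>h\<close> is at most 1, a mean equal to 1 forces
  \<open>h = 1\<close> almost everywhere.\<close>

lemma AE_kernel_recurrent:
  assumes "x \<in> recurrent"
  shows "AE y in P x. y \<in> recurrent"
proof -
  have x: "x \<in> space X" and one: "emeasure (law x) inf_often = 1"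
    using assms by (simp_all add: both_inf_often_def)
  interpret Px: prob_space "P x" by (rule prob_space_kernel_eq[OF x])
  have [measurable_cong]: "sets (P x) = sets X" by (rule sets_kernel_eq[OF x])
  define h where "h y = emeasure (law y) inf_often" for y
  have [measurable]: "h \<in> borel_measurable X"
    unfolding h_def
    by (rule measurable_compose[OF measurable_law_subprob measurable_emeasure_subprob_algebra[OF sets_inf_often]])
  have [measurable]: "h \<in> borel_measurable (P x)"
    unfolding measurable_cong_sets[OF sets_kernel_eq[OF x] refl] by measurable
  have le: "h y \<le> 1" if "y \<in> space X" for y
    unfolding h_def using prob_space.emeasure_le_1[OF prob_space_law[OF that]] .
  have "1 = (\<integral>\<^sup>+\<omega>. indicator inf_often \<omega> \<partial>law x)"
    using one sets_inf_often by (subst nn_integral_indicator) (auto simp only: sets_law[OF x])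
  also have "\<dots> = (\<integral>\<^sup>+y. \<integral>\<^sup>+\<omega>. indicator inf_often (case_nat x \<omega>) \<partial>law y \<partial>P x)"
    by (rule nn_integral_law[OF x]) measurable
  also have "\<dots> = (\<integral>\<^sup>+y. h y \<partial>P x)"
  proof (rule nn_integral_cong)
    fix y assume "y \<in> space (P x)"
    then have y: "y \<in> space X" by (simp add: space_kernel_eq[OF x])
    have "(\<integral>\<^sup>+\<omega>. indicator inf_often (case_nat x \<omega>) \<partial>law y) = (\<integral>\<^sup>+\<omega>. indicator inf_often \<omega> \<partial>law y)"
      using case_nat_inf_often[OF x] unfolding indicator_def
      by (intro nn_integral_cong) (simp only: space_law[OF y])
    also have "\<dots> = h y"
      unfolding h_def using sets_inf_often by (intro nn_integral_indicator) (simp only: sets_law[OF y])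
    finally show "(\<integral>\<^sup>+\<omega>. indicator inf_often (case_nat x \<omega>) \<partial>law y) = h y" .
  qed
  finally have int: "(\<integral>\<^sup>+y. h y \<partial>P x) = 1" ..
  have "(\<integral>\<^sup>+y. 1 - h y \<partial>P x) = (\<integral>\<^sup>+y. 1 \<partial>P x) - (\<integral>\<^sup>+y. h y \<partial>P x)"
    by (rule nn_integral_diff) (auto simp: int space_kernel_eq[OF x] intro!: le AE_I2)
  also have "\<dots> = 0" by (simp add: int Px.emeasure_space_1)
  finally have "AE y in P x. 1 - h y = 0"
    by (subst (asm) nn_integral_0_iff_AE) auto
  moreover have "AE y in P x. y \<in> space X" by (rule AE_I2) (simp add: space_kernel_eq[OF x])
  ultimately show ?thesis
  proof eventually_elim
    case (elim y)
    then have "h y = 1" using le[of y] by (metis antisym diff_eq_0_iff_ennreal)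
    then show ?case using elim by (simp add: both_inf_often_def h_def)
  qed
qed

lemma AE_ex_first_jump:
  assumes "x \<in> recurrent"
  shows "AE \<omega> in law x. \<exists>n. first_jump B n \<omega>"
proof -
  have x: "x \<in> space X" and one: "emeasure (law x) inf_often = 1"
    using assms by (simp_all add: both_inf_often_def)
  interpret prob_space "law x" by (rule prob_space_law[OF x])
  have "inf_often \<in> sets (law x)" using sets_inf_often by (simp only: sets_law[OF x])
  moreover have "prob inf_often = 1" unfolding measure_def one by simp
  ultimately have "AE \<omega> in law x. \<omega> \<in> inf_often" by (simp only: AE_in_set_eq_1)
  then show ?thesis
    by eventually_elim (auto intro!: ex_first_jump_if_inf_often elim: INFM_mono)
qed

text \<open>The events indexed by the time of the first jump are disjoint, which produces the
  series.\<close>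

lemma emeasure_ex_first_jump:
  assumes x: "x \<in> space X" and [measurable]: "C \<in> sets X" "D \<in> sets X"
  shows "emeasure (law x) {\<omega>\<in>space (path_space X). \<exists>n. first_jump B n \<omega> \<and> \<omega> n \<in> C \<and> \<omega> (Suc n) \<in> D} =
    (\<Sum>n. (transition P no_jump ^^ n) (\<lambda>x. indicator C x * transition P jump (indicator D) x) x)"
proof -
  have [measurable_cong]: "sets (law x) = sets (path_space X)" by (rule sets_law[OF x])
  let ?E = "\<lambda>n. {\<omega>\<in>space (path_space X). first_jump B n \<omega> \<and> \<omega> n \<in> C \<and> \<omega> (Suc n) \<in> D}"
  have E: "?E n \<in> sets (law x)" for n by measurable
  have "{\<omega>\<in>space (path_space X). \<exists>n. first_jump B n \<omega> \<and> \<omega> n \<in> C \<and> \<omega> (Suc n) \<in> D} = (\<Union>n. ?E n)"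
    by auto
  also have "emeasure (law x) \<dots> = (\<Sum>n. emeasure (law x) (?E n))"
    using E by (intro suminf_emeasure[symmetric])
      (auto simp: disjoint_family_on_def dest: first_jump_unique)
  also have "\<dots> = (\<Sum>n. \<integral>\<^sup>+\<omega>. indicator {\<omega>. first_jump B n \<omega> \<and> \<omega> n \<in> C \<and> \<omega> (Suc n) \<in> D} \<omega> \<partial>law x)"
  proof (rule suminf_cong)
    fix n
    have "emeasure (law x) (?E n) = (\<integral>\<^sup>+\<omega>. indicator (?E n) \<omega> \<partial>law x)"
      by (rule nn_integral_indicator[symmetric, OF E])
    also have "\<dots> = (\<integral>\<^sup>+\<omega>. indicator {\<omega>. first_jump B n \<omega> \<and> \<omega> n \<in> C \<and> \<omega> (Suc n) \<in> D} \<omega> \<partial>law x)"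
      by (rule nn_integral_cong) (simp add: space_law[OF x] indicator_def)
    finally show "emeasure (law x) (?E n) =
      (\<integral>\<^sup>+\<omega>. indicator {\<omega>. first_jump B n \<omega> \<and> \<omega> n \<in> C \<and> \<omega> (Suc n) \<in> D} \<omega> \<partial>law x)" .
  qed
  finally show ?thesis by (simp add: nn_integral_first_jump[OF x])
qed

section \<open>Measurability of entrance and exit positions\<close>

lemma measurable_entrance_position [measurable]:
  "entrance_position B 1 \<in> path_space X \<rightarrow>\<^sub>M adjoin_cemetery X B"
proof (rule measurableI)
  fix \<omega> assume "\<omega> \<in> space (path_space X)"
  show "entrance_position B 1 \<omega> \<in> space (adjoin_cemetery X B)"
  proof (cases "\<exists>n. first_jump B n \<omega>")
    case True
    then obtain n where n: "first_jump B n \<omega>" ..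
    then have "\<omega> (Suc n) \<in> B" by (simp add: first_jump_def)
    then show ?thesis unfolding entrance_position_first_jump[OF n] space_adjoin_cemetery by simp
  next
    case False
    then show ?thesis unfolding entrance_position_no_jump[OF False] space_adjoin_cemetery by simp
  qed
next
  fix E assume "E \<in> sets (adjoin_cemetery X B)"
  then have [measurable]: "Some -` E \<in> sets X" by (simp add: sets_adjoin_cemetery_iff[OF B])
  \<comment> \<open>The random time is eliminated: the event is a countable union over the index of
    the first jump, together with the event of no jump if \<open>E\<close> contains the
    cemetery.\<close>
  have "entrance_position B 1 \<omega> \<in> E \<longleftrightarrow>
      (\<exists>n. first_jump B n \<omega> \<and> \<omega> (Suc n) \<in> Some -` E) \<or> (None \<in> E \<and> (\<nexists>n. first_jump B n \<omega>))" for \<omega>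
    using entrance_position_first_jump[of B _ \<omega>] entrance_position_no_jump[of B \<omega>]
    unfolding vimage_eq by metis
  then have "entrance_position B 1 -` E \<inter> space (path_space X) = {\<omega>\<in>space (path_space X).
      (\<exists>n. first_jump B n \<omega> \<and> \<omega> (Suc n) \<in> Some -` E) \<or> (None \<in> E \<and> (\<nexists>n. first_jump B n \<omega>))}"
    unfolding vimage_def[of "entrance_position B 1"] by blast
  also have "\<dots> \<in> sets (path_space X)" by measurable
  finally show "entrance_position B 1 -` E \<inter> space (path_space X) \<in> sets (path_space X)" .
qed

lemma measurable_exit_position [measurable]:
  "exit_position B 1 \<in> path_space X \<rightarrow>\<^sub>M adjoin_cemetery X (space X - B)"
proof (rule measurableI)
  fix \<omega> assume \<omega>: "\<omega> \<in> space (path_space X)"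
  show "exit_position B 1 \<omega> \<in> space (adjoin_cemetery X (space X - B))"
  proof (cases "\<exists>n. first_jump B n \<omega>")
    case True
    then obtain n where n: "first_jump B n \<omega>" ..
    then have "\<omega> n \<in> space X - B" using \<omega> by (auto simp: first_jump_def space_PiM PiE_iff)
    then show ?thesis unfolding exit_position_first_jump[OF n] space_adjoin_cemetery by blast
  next
    case False
    then show ?thesis unfolding exit_position_no_jump[OF False] space_adjoin_cemetery by simp
  qed
next
  fix E assume "E \<in> sets (adjoin_cemetery X (space X - B))"
  then have [measurable]: "Some -` E \<in> sets X" by (simp add: sets_adjoin_cemetery_iff)
  have "exit_position B 1 \<omega> \<in> E \<longleftrightarrow>
      (\<exists>n. first_jump B n \<omega> \<and> \<omega> n \<in> Some -` E) \<or> (None \<in> E \<and> (\<nexists>n. first_jump B n \<omega>))" for \<omega>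
    using exit_position_first_jump[of B _ \<omega>] exit_position_no_jump[of B \<omega>]
    unfolding vimage_eq by metis
  then have "exit_position B 1 -` E \<inter> space (path_space X) = {\<omega>\<in>space (path_space X).
      (\<exists>n. first_jump B n \<omega> \<and> \<omega> n \<in> Some -` E) \<or> (None \<in> E \<and> (\<nexists>n. first_jump B n \<omega>))}"
    unfolding vimage_def[of "exit_position B 1"] by blast
  also have "\<dots> \<in> sets (path_space X)" by measurable
  finally show "exit_position B 1 -` E \<inter> space (path_space X) \<in> sets (path_space X)" .
qed

end

section \<open>Entrance and exit kernels on recurrent starting points\<close>

context markov_chain_set
begin

lemma transition_jump_outside: "x \<notin> space X - B \<Longrightarrow> transition P jump f x = 0"
  by (auto simp: transition_def)

lemma transition_jump:
  assumes x: "x \<in> space X"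
  shows "transition P jump f x = indicator (space X - B) x * (\<integral>\<^sup>+y. indicator B y * f y \<partial>P x)"
  using x by (auto simp: transition_def indicator_times intro!: nn_integral_cong split: split_indicator)

text \<open>Applied to the constant 1, the jump operator yields the density of the exit measure of
  the complement of \<open>B\<close>.\<close>

lemma transition_jump_space:
  assumes x: "x \<in> space X"
  shows "transition P jump (indicator (space X)) x = indicator (space X - B) x * emeasure (P x) B"
proof -
  have "(\<integral>\<^sup>+y. indicator B y * indicator (space X) y \<partial>P x) = (\<integral>\<^sup>+y. indicator B y \<partial>P x)"
    by (intro nn_integral_cong) (simp add: space_kernel_eq[OF x])
  also have "\<dots> = emeasure (P x) B" by (simp add: sets_kernel_eq[OF x])
  finally show ?thesis by (simp only: transition_jump[OF x])
qed

text \<open>From a recurrent point a jump occurs almost surely, so it does not matter whether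
  \<open>E\<close> contains the cemetery, and only its preimage under \<open>Some\<close>
  enters.\<close>

lemma emeasure_entrance_law:
  assumes x: "x \<in> recurrent" and E: "E \<in> sets (adjoin_cemetery X B)"
  shows "emeasure (entrance_law X P B (Some x)) E =
    (\<Sum>n. (transition P no_jump ^^ n) (transition P jump (indicator (Some -` E))) x)"
proof -
  have xX: "x \<in> space X" using x by (simp add: both_inf_often_def)
  define D where "D = Some -` E"
  have D[measurable]: "D \<in> sets X" using E by (simp add: sets_adjoin_cemetery_iff[OF B] D_def)
  have pos: "entrance_position B 1 -` E \<inter> space (path_space X) \<in> sets (path_space X)"
    using E by (rule measurable_sets[OF measurable_entrance_position])
  let ?S = "{\<omega>\<in>space (path_space X). \<exists>n. first_jump B n \<omega> \<and> \<omega> n \<in> space X \<and> \<omega> (Suc n) \<in> D}"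
  have S: "?S \<in> sets (path_space X)" by measurable
  have "entrance_position B 1 \<in> law x \<rightarrow>\<^sub>M adjoin_cemetery X B"
    unfolding measurable_cong_sets[OF sets_law[OF xX] refl] by (rule measurable_entrance_position)
  from emeasure_distr[OF this E] have "emeasure (entrance_law X P B (Some x)) E =
      emeasure (law x) (entrance_position B 1 -` E \<inter> space (path_space X))"
    unfolding entrance_law_def space_law[OF xX] by (simp only: option.case)
  also have "\<dots> = emeasure (law x) ?S"
  proof (rule emeasure_eq_AE)
    show "AE \<omega> in law x. \<omega> \<in> entrance_position B 1 -` E \<inter> space (path_space X) \<longleftrightarrow> \<omega> \<in> ?S"
      using AE_ex_first_jump[OF x]
    proof eventually_elim
      case (elim \<omega>)
      then obtain n where n: "first_jump B n \<omega>" ..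
      have "entrance_position B 1 \<omega> \<in> E \<longleftrightarrow> \<omega> (Suc n) \<in> D"
        unfolding entrance_position_first_jump[OF n] D_def by simp
      also have "\<dots> \<longleftrightarrow> (\<exists>n. first_jump B n \<omega> \<and> \<omega> (Suc n) \<in> D)"
        using n first_jump_unique[OF n] by blast
      finally show ?case unfolding space_PiM by blast
    qed
  qed (use pos S in \<open>simp_all only: sets_law[OF xX]\<close>)
  also have "\<dots> = (\<Sum>n. (transition P no_jump ^^ n)
      (\<lambda>x. indicator (space X) x * transition P jump (indicator D) x) x)"
    by (rule emeasure_ex_first_jump[OF xX]) measurable
  also have "(\<lambda>x. indicator (space X) x * transition P jump (indicator D) x) = transition P jump (indicator D)"
    by (auto simp: fun_eq_iff transition_jump_outside split: split_indicator)
  finally show ?thesis unfolding D_def .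
qed

lemma emeasure_exit_position:
  assumes x: "x \<in> recurrent" and E: "E \<in> sets (adjoin_cemetery X (space X - B))"
  shows "emeasure (law x) (exit_position B 1 -` E \<inter> space (path_space X)) =
    (\<Sum>n. (transition P no_jump ^^ n)
       (\<lambda>x. indicator (Some -` E) x * transition P jump (indicator (space X)) x) x)"
proof -
  have xX: "x \<in> space X" using x by (simp add: both_inf_often_def)
  define D where "D = Some -` E"
  have D[measurable]: "D \<in> sets X" using E by (simp add: sets_adjoin_cemetery_iff D_def)
  have pos: "exit_position B 1 -` E \<inter> space (path_space X) \<in> sets (path_space X)"
    using E by (rule measurable_sets[OF measurable_exit_position])
  let ?S = "{\<omega>\<in>space (path_space X). \<exists>n. first_jump B n \<omega> \<and> \<omega> n \<in> D \<and> \<omega> (Suc n) \<in> space X}"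
  have S: "?S \<in> sets (path_space X)" by measurable
  have "emeasure (law x) (exit_position B 1 -` E \<inter> space (path_space X)) = emeasure (law x) ?S"
  proof (rule emeasure_eq_AE)
    show "AE \<omega> in law x. \<omega> \<in> exit_position B 1 -` E \<inter> space (path_space X) \<longleftrightarrow> \<omega> \<in> ?S"
      using AE_ex_first_jump[OF x]
    proof eventually_elim
      case (elim \<omega>)
      then obtain n where n: "first_jump B n \<omega>" ..
      have "exit_position B 1 \<omega> \<in> E \<longleftrightarrow> \<omega> n \<in> D"
        unfolding exit_position_first_jump[OF n] D_def by simp
      also have "\<dots> \<longleftrightarrow> (\<exists>n. first_jump B n \<omega> \<and> \<omega> n \<in> D)"
        using n first_jump_unique[OF n] by blast
      finally show ?case unfolding space_PiM by blast
    qed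
  qed (use pos S in \<open>simp_all only: sets_law[OF xX]\<close>)
  also have "\<dots> = (\<Sum>n. (transition P no_jump ^^ n)
       (\<lambda>x. indicator D x * transition P jump (indicator (space X)) x) x)"
    by (rule emeasure_ex_first_jump[OF xX]) measurable
  finally show ?thesis unfolding D_def .
qed

text \<open>The terms are the probabilities that the first jump starts at time \<open>n\<close>. The
  total mass 1 is what closes the transport identity for entrance measures.\<close>

lemma suminf_first_jump_eq_1:
  assumes x: "x \<in> recurrent"
  shows "(\<Sum>n. (transition P no_jump ^^ n) (transition P jump (indicator (space X))) x) = 1"
proof -
  have xX: "x \<in> space X" using x by (simp add: both_inf_often_def)
  interpret prob_space "law x" by (rule prob_space_law[OF xX])
  have [measurable_cong]: "sets (law x) = sets (path_space X)" by (rule sets_law[OF xX])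
  have "1 = emeasure (law x) {\<omega>\<in>space (path_space X).
      \<exists>n. first_jump B n \<omega> \<and> \<omega> n \<in> space X \<and> \<omega> (Suc n) \<in> space X}"
  proof (rule emeasure_eq_1_AE[symmetric])
    show "AE \<omega> in law x. \<omega> \<in> {\<omega>\<in>space (path_space X).
        \<exists>n. first_jump B n \<omega> \<and> \<omega> n \<in> space X \<and> \<omega> (Suc n) \<in> space X}"
      using AE_ex_first_jump[OF x] AE_space
      by eventually_elim (auto simp: space_law[OF xX] space_PiM PiE_iff)
  qed measurable
  also have "\<dots> = (\<Sum>n. (transition P no_jump ^^ n)
      (\<lambda>x. indicator (space X) x * transition P jump (indicator (space X)) x) x)"
    by (rule emeasure_ex_first_jump[OF xX]) measurable
  also have "(\<lambda>x. indicator (space X) x * transition P jump (indicator (space X)) x) =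
      transition P jump (indicator (space X))"
    by (auto simp: fun_eq_iff transition_jump_outside split: split_indicator)
  finally show ?thesis ..
qed

lemma measurable_entrance_law:
  assumes C: "C \<in> sets X"
  shows "entrance_law X P B \<in> adjoin_cemetery X C \<rightarrow>\<^sub>M prob_algebra (adjoin_cemetery X B)"
proof (rule measurable_adjoin_cemetery[OF C])
  have "(\<lambda>x. distr (law x) (adjoin_cemetery X B) (entrance_position B 1)) \<in>
      X \<rightarrow>\<^sub>M prob_algebra (adjoin_cemetery X B)"
    by (rule measurable_compose[OF measurable_law measurable_distr_prob_space[OF measurable_entrance_position]])
  then show "(\<lambda>x. entrance_law X P B (Some x)) \<in> restrict_space X C \<rightarrow>\<^sub>M prob_algebra (adjoin_cemetery X B)"
    by (auto simp: entrance_law_def intro: measurable_restrict_space1)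
  show "entrance_law X P B None \<in> space (prob_algebra (adjoin_cemetery X B))"
    by (auto simp: entrance_law_def space_prob_algebra space_adjoin_cemetery intro!: prob_space_return)
qed

lemma kernel_exit_position:
  "(\<lambda>y. distr (law y) (adjoin_cemetery X (space X - B)) (exit_position B 1)) \<in>
      X \<rightarrow>\<^sub>M prob_algebra (adjoin_cemetery X (space X - B))"
  by (rule measurable_compose[OF measurable_law measurable_distr_prob_space[OF measurable_exit_position]])

text \<open>The position at time 1 has law \<open>P x\<close>; conditioning the path law on an event
  about this position and projecting to it therefore conditions \<open>P x\<close> itself.\<close>

lemma exit_kernel_Some:
  assumes x: "x \<in> space X"
  shows "exit_kernel X P (space X - B) (Some x) =
    (if emeasure (P x) B > 0
     then uniform_measure (P x) B \<bind>
       (\<lambda>y. distr (law y) (adjoin_cemetery X (space X - B)) (exit_position B 1))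
     else return (adjoin_cemetery X (space X - B)) None)"
proof -
  have [measurable_cong]: "sets (law x) = sets (path_space X)" by (rule sets_law[OF x])
  have [simp]: "space X - (space X - B) = B" using sets.sets_into_space[OF B] by auto
  let ?hit = "\<lambda>C. {\<omega>\<in>space (path_space X). \<omega> 1 \<in> C}"
  have "distr (uniform_measure (law x) (?hit B)) X (\<lambda>\<omega>. \<omega> 1) = uniform_measure (P x) B"
  proof (rule measure_eqI)
    show "sets (distr (uniform_measure (law x) (?hit B)) X (\<lambda>\<omega>. \<omega> 1)) = sets (uniform_measure (P x) B)"
      by (simp add: sets_kernel_eq[OF x])
    fix C assume "C \<in> sets (distr (uniform_measure (law x) (?hit B)) X (\<lambda>\<omega>. \<omega> 1))"
    then have C[measurable]: "C \<in> sets X" by simp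
    have hB: "?hit B \<in> sets (law x)" by measurable
    have hC: "?hit C \<in> sets (law x)" by measurable
    have "emeasure (distr (uniform_measure (law x) (?hit B)) X (\<lambda>\<omega>. \<omega> 1)) C =
        emeasure (uniform_measure (law x) (?hit B)) ((\<lambda>\<omega>. \<omega> 1) -` C \<inter> space (law x))"
      by (subst emeasure_distr) auto
    also have "(\<lambda>\<omega>. \<omega> 1) -` C \<inter> space (law x) = ?hit C" by (auto simp: space_law[OF x])
    also have "emeasure (uniform_measure (law x) (?hit B)) (?hit C) =
        emeasure (law x) (?hit B \<inter> ?hit C) / emeasure (law x) (?hit B)"
      by (rule emeasure_uniform_measure[OF hB hC])
    also have "?hit B \<inter> ?hit C = ?hit (B \<inter> C)" by auto
    also have "emeasure (law x) (?hit (B \<inter> C)) / emeasure (law x) (?hit B) =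
        emeasure (P x) (B \<inter> C) / emeasure (P x) B"
      by (simp only: emeasure_law_1[OF x] sets.Int B C)
    also have "\<dots> = emeasure (uniform_measure (P x) B) C"
      by (rule emeasure_uniform_measure[symmetric]) (auto simp: sets_kernel_eq[OF x])
    finally show "emeasure (distr (uniform_measure (law x) (?hit B)) X (\<lambda>\<omega>. \<omega> 1)) C =
        emeasure (uniform_measure (P x) B) C" .
  qed
  then show ?thesis by (simp add: exit_kernel_def Let_def emeasure_law_1[OF x B] del: One_nat_def)
qed

lemma emeasure_exit_kernel:
  assumes x: "x \<in> space X" and E: "E \<in> sets (adjoin_cemetery X (space X - B))"
  shows "emeasure (exit_kernel X P (space X - B) (Some x)) E =
    (if emeasure (P x) B > 0
     then (\<integral>\<^sup>+y. indicator B y * emeasure (law y) (exit_position B 1 -` E \<inter> space (path_space X)) \<partial>P x)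
       / emeasure (P x) B
     else indicator E None)"
proof (cases "emeasure (P x) B > 0")
  case False
  then show ?thesis using E by (simp add: exit_kernel_Some[OF x])
next
  case True
  have B': "B \<in> sets (P x)" using B by (simp only: sets_kernel_eq[OF x])
  let ?K = "\<lambda>y. distr (law y) (adjoin_cemetery X (space X - B)) (exit_position B 1)"
  have "emeasure (uniform_measure (P x) B \<bind> ?K) E = (\<integral>\<^sup>+y. emeasure (?K y) E \<partial>uniform_measure (P x) B)"
  proof (rule emeasure_bind)
    show "space (uniform_measure (P x) B) \<noteq> {}" using x by (auto simp: space_kernel_eq[OF x])
    show "?K \<in> uniform_measure (P x) B \<rightarrow>\<^sub>M subprob_algebra (adjoin_cemetery X (space X - B))"
      using measurable_prob_algebraD[OF kernel_exit_position]
      by (subst measurable_cong_sets[of _ X]) (auto simp: sets_kernel_eq[OF x])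
  qed fact
  also have "\<dots> = (\<integral>\<^sup>+y. emeasure (?K y) E * indicator B y \<partial>P x) / emeasure (P x) B"
  proof (rule nn_integral_uniform_measure[OF _ B'])
    show "(\<lambda>y. emeasure (?K y) E) \<in> borel_measurable (P x)"
      unfolding measurable_cong_sets[OF sets_kernel_eq[OF x] refl]
      by (rule measurable_compose[OF measurable_prob_algebraD[OF kernel_exit_position]
            measurable_emeasure_subprob_algebra[OF E]])
  qed
  also have "(\<integral>\<^sup>+y. emeasure (?K y) E * indicator B y \<partial>P x) =
     (\<integral>\<^sup>+y. indicator B y * emeasure (law y) (exit_position B 1 -` E \<inter> space (path_space X)) \<partial>P x)"
  proof (rule nn_integral_cong)
    fix y assume "y \<in> space (P x)"
    then have y: "y \<in> space X" by (simp add: space_kernel_eq[OF x])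
    have "exit_position B 1 \<in> law y \<rightarrow>\<^sub>M adjoin_cemetery X (space X - B)"
      unfolding measurable_cong_sets[OF sets_law[OF y] refl] by (rule measurable_exit_position)
    from emeasure_distr[OF this E]
    show "emeasure (?K y) E * indicator B y =
        indicator B y * emeasure (law y) (exit_position B 1 -` E \<inter> space (path_space X))"
      by (simp only: space_law[OF y] mult.commute)
  qed
  finally show ?thesis using True by (simp add: exit_kernel_Some[OF x] del: One_nat_def)
qed

lemma measurable_emeasure_exit_position:
  assumes E: "E \<in> sets (adjoin_cemetery X (space X - B))"
  shows "(\<lambda>y. emeasure (law y) (exit_position B 1 -` E \<inter> space (path_space X))) \<in> borel_measurable X"
  by (rule measurable_compose[OF measurable_law_subprob measurable_emeasure_subprob_algebra[OF
      measurable_sets[OF measurable_exit_position E]]])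

text \<open>The conditioned kernel involves a quotient and a case distinction, so measurability in
  \<open>x\<close> is tested set by set on the formula for \<open>emeasure\<close>, with the
  sigma-algebra as its own generator.\<close>

lemma measurable_exit_kernel:
  "exit_kernel X P (space X - B) \<in>
     adjoin_cemetery X (space X - B) \<rightarrow>\<^sub>M prob_algebra (adjoin_cemetery X (space X - B))" (is "_ \<in> ?M \<rightarrow>\<^sub>M _")
proof (rule measurable_adjoin_cemetery)
  show "exit_kernel X P (space X - B) None \<in> space (prob_algebra ?M)"
    by (auto simp: exit_kernel_def space_prob_algebra space_adjoin_cemetery intro!: prob_space_return)
  show "(\<lambda>x. exit_kernel X P (space X - B) (Some x)) \<in> restrict_space X (space X - B) \<rightarrow>\<^sub>M prob_algebra ?M"
  proof (rule measurable_restrict_space1, rule measurable_prob_algebra_generated)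
    show "sets ?M = sigma_sets (space ?M) (sets ?M)" by (simp only: sets.sigma_sets_eq)
    show "Int_stable (sets ?M)" by (auto simp: Int_stable_def)
    show "sets ?M \<subseteq> Pow (space ?M)" by (rule sets.space_closed)
    fix x assume x: "x \<in> space X"
    have B': "B \<in> sets (P x)" using B by (simp only: sets_kernel_eq[OF x])
    let ?K = "\<lambda>y. distr (law y) ?M (exit_position B 1)"
    have *: "uniform_measure (P x) B \<bind> ?K \<in> space (prob_algebra ?M)" if "emeasure (P x) B > 0"
    proof -
      have "uniform_measure (P x) B \<in> space (prob_algebra X)"
        using that prob_space.emeasure_le_1[OF prob_space_kernel_eq[OF x], of B]
        by (auto simp: space_prob_algebra sets_kernel_eq[OF x] top_unique intro!: prob_space_uniform_measure)
      \<comment> \<open>A constant map on a one-point space lets the measurability rule for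
        \<open>bind\<close> show that this single mixture is a probability measure.\<close>
      then have "(\<lambda>_. uniform_measure (P x) B) \<in> count_space (UNIV :: unit set) \<rightarrow>\<^sub>M prob_algebra X"
        by simp
      from measurable_space[OF measurable_bind_prob_space[OF this kernel_exit_position], of "()"]
      show ?thesis by simp
    qed
    have "exit_kernel X P (space X - B) (Some x) \<in> space (prob_algebra ?M)"
      using * by (auto simp: exit_kernel_Some[OF x] space_prob_algebra space_adjoin_cemetery
        intro!: prob_space_return simp del: One_nat_def)
    then show "prob_space (exit_kernel X P (space X - B) (Some x))"
      and "sets (exit_kernel X P (space X - B) (Some x)) = sets ?M"
      by (simp_all add: space_prob_algebra)
  next
    fix E assume E: "E \<in> sets ?M"
    note [measurable] = measurable_emeasure_exit_position[OF E]
    have [measurable]: "(\<lambda>x. emeasure (P x) B) \<in> borel_measurable X"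
      by (rule measurable_compose[OF kernel measurable_emeasure_subprob_algebra[OF B]])
    have [measurable]: "(\<lambda>x. \<integral>\<^sup>+y. indicator B y *
        emeasure (law y) (exit_position B 1 -` E \<inter> space (path_space X)) \<partial>P x) \<in> borel_measurable X"
      by (rule nn_integral_measurable_subprob_algebra2[OF _ kernel]) measurable
    show "(\<lambda>x. emeasure (exit_kernel X P (space X - B) (Some x)) E) \<in> borel_measurable X"
      by (subst measurable_cong[OF emeasure_exit_kernel[OF _ E]]) measurable
  qed
qed measurable

text \<open>The factor \<open>emeasure (P x) B\<close> is the normalisation in the exit kernel and
  at the same time the density of the exit measure; multiplying by it removes the conditioning.
  Where it vanishes both sides are 0, whatever the kernel is there.\<close>

lemma transition_exit_kernel:
  assumes x: "x \<in> space X" and E: "E \<in> sets (adjoin_cemetery X (space X - B))"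
  shows "transition P jump (\<lambda>y. emeasure (law y) (exit_position B 1 -` E \<inter> space (path_space X))) x =
    indicator (space X - B) x * emeasure (P x) B * emeasure (exit_kernel X P (space X - B) (Some x)) E"
    (is "transition P jump ?e x = _")
proof -
  interpret Px: prob_space "P x" by (rule prob_space_kernel_eq[OF x])
  let ?I = "\<integral>\<^sup>+y. indicator B y * ?e y \<partial>P x"
  have "emeasure (P x) B * emeasure (exit_kernel X P (space X - B) (Some x)) E = ?I"
  proof (cases "emeasure (P x) B = 0")
    case True
    then have "B \<in> null_sets (P x)" by (auto simp: sets_kernel_eq[OF x])
    from AE_not_in[OF this] have "AE y in P x. indicator B y * ?e y = 0" by eventually_elim simp
    then have "?I = (\<integral>\<^sup>+y. 0 \<partial>P x)" by (rule nn_integral_cong_AE)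
    then show ?thesis using True by simp
  next
    case False
    have "emeasure (P x) B * (?I / emeasure (P x) B) = ?I * emeasure (P x) B / emeasure (P x) B"
      by (simp only: ennreal_times_divide mult.commute)
    also have "\<dots> = ?I" by (rule ennreal_mult_divide_eq[OF False]) simp
    finally show ?thesis
      unfolding emeasure_exit_kernel[OF x E] using False by (simp add: zero_less_iff_neq_zero del: One_nat_def)
  qed
  then show ?thesis by (simp only: transition_jump[OF x] mult.assoc)
qed

text \<open>A path that starts outside \<open>B\<close> and has not jumped is still outside. Unlike
  \<open>no_jump\<close>, the relation on the right is its own converse, which the transport
  identity exploits.\<close>

lemma transition_power_before_jump:
  assumes "x \<in> space X"
  shows "indicator (space X - B) x * (transition P no_jump ^^ n) (transition P jump f) x =
    (transition P ((space X - B) \<times> (space X - B)) ^^ n) (transition P jump f) x"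
  using assms
proof (induction n arbitrary: x)
  case 0
  then show ?case by (simp add: transition_jump_outside split: split_indicator)
next
  case (Suc n)
  let ?g = "(transition P no_jump ^^ n) (transition P jump f)"
  let ?h = "(transition P ((space X - B) \<times> (space X - B)) ^^ n) (transition P jump f)"
  have "indicator (space X - B) x * transition P no_jump ?g x =
      transition P ((space X - B) \<times> (space X - B)) ?h x"
  proof (cases "x \<in> B")
    case True
    then show ?thesis by (simp add: transition_def[of P "(space X - B) \<times> (space X - B)" ?h])
  next
    case False
    have "transition P no_jump ?g x = transition P ((space X - B) \<times> (space X - B)) ?h x"
      unfolding transition_def[of P no_jump ?g] transition_def[of P "(space X - B) \<times> (space X - B)" ?h]
    proof (rule nn_integral_cong)
      fix y assume "y \<in> space (P x)"
      then have y: "y \<in> space X" using Suc.prems by (simp add: space_kernel_eq)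
      show "indicator no_jump (x, y) * ?g y = indicator ((space X - B) \<times> (space X - B)) (x, y) * ?h y"
        using Suc.prems False y Suc.IH[OF y] by (auto split: split_indicator)
    qed
    then show ?thesis using False Suc.prems by simp
  qed
  then show ?case by simp
qed

end

section \<open>Measures cut down to a subset, on the space with cemetery\<close>

lemma sets_cut_measure: "sets (cut_measure X B N \<nu>) = sets (adjoin_cemetery X B)"
  and space_cut_measure: "space (cut_measure X B N \<nu>) = insert None (Some ` B)"
proof -
  have "sets (adjoin_cemetery X B) \<subseteq> Pow (insert None (Some ` B))"
    using sets.space_closed[of "adjoin_cemetery X B"] by (simp only: space_adjoin_cemetery)
  moreover have "sigma_sets (insert None (Some ` B)) (sets (adjoin_cemetery X B)) = sets (adjoin_cemetery X B)"
    using sets.sigma_sets_eq[of "adjoin_cemetery X B"] by (simp only: space_adjoin_cemetery)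
  ultimately show "sets (cut_measure X B N \<nu>) = sets (adjoin_cemetery X B)"
    and "space (cut_measure X B N \<nu>) = insert None (Some ` B)"
    by (simp_all add: cut_measure_def)
qed

text \<open>\<open>measure_of\<close> yields the zero measure when the set function given to it is
  not a measure. Exhibiting the cut measure as the image of a density rules this out.\<close>

lemma cut_measure_density:
  fixes X \<mu> :: "'a measure"
  assumes \<mu>[measurable_cong]: "sets \<mu> = sets X" and B: "B \<in> sets X" and N: "N \<in> sets X" and r: "r \<in> borel_measurable X"
  shows "cut_measure X B N (density (restrict_space \<mu> B) r) =
    distr (density (restrict_space \<mu> B) (\<lambda>x. r x * indicator N x)) (adjoin_cemetery X B) Some"
    (is "_ = ?M")
proof -
  note [measurable] = B N r
  have r': "f \<in> borel_measurable (restrict_space \<mu> B)" if "f \<in> borel_measurable X" for f :: "'a \<Rightarrow> ennreal"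
    using that by (intro measurable_restrict_space1) measurable
  have "(\<lambda>x. r x * indicator N x) \<in> borel_measurable X" by measurable
  note r2 = r'[OF this]
  have sp: "space (restrict_space \<mu> B) = B"
    using sets.sets_into_space[OF B] sets_eq_imp_space_eq[OF \<mu>] by (auto simp: space_restrict_space)
  have sr: "sets (restrict_space \<mu> B) = sets (restrict_space X B)"
    by (rule sets_restrict_space_cong[OF \<mu>])
  have S: "Some \<in> density (restrict_space \<mu> B) (\<lambda>x. r x * indicator N x) \<rightarrow>\<^sub>M adjoin_cemetery X B"
    using measurable_Some_adjoin_cemetery[OF B] sr
    by (subst measurable_cong_sets[of _ "restrict_space X B"]) auto
  \<comment> \<open>Reading the known measure as a \<open>measure_of\<close> as well leaves only the
    values on measurable sets to compare.\<close>
  have "?M = measure_of (space ?M) (sets ?M) (emeasure ?M)" by (rule measure_of_of_measure[symmetric])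
  also have "\<dots> = measure_of (insert None (Some ` B)) (sets (adjoin_cemetery X B)) (emeasure ?M)"
    by (simp add: space_adjoin_cemetery)
  also have "\<dots> = cut_measure X B N (density (restrict_space \<mu> B) r)"
    unfolding cut_measure_def
  proof (rule measure_of_eq)
    show "sets (adjoin_cemetery X B) \<subseteq> Pow (insert None (Some ` B))"
      using sets.space_closed[of "adjoin_cemetery X B"] by (simp only: space_adjoin_cemetery)
    fix C assume "C \<in> sigma_sets (insert None (Some ` B)) (sets (adjoin_cemetery X B))"
    then have C: "C \<in> sets (adjoin_cemetery X B)"
      using sets.sigma_sets_eq[of "adjoin_cemetery X B"] by (simp only: space_adjoin_cemetery)
    then have D: "Some -` C \<in> sets X" "Some -` C \<subseteq> B" by (auto simp: sets_adjoin_cemetery_iff[OF B])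
    have D': "Some -` C \<in> sets (restrict_space \<mu> B)"
      using D B sets.sets_into_space[OF B] sets_eq_imp_space_eq[OF \<mu>]
      by (subst sets_restrict_space_iff) (auto simp: \<mu> Int_absorb2)
    have DN: "Some -` C \<inter> N \<in> sets (restrict_space \<mu> B)"
      using D B N sets.sets_into_space[OF B] sets_eq_imp_space_eq[OF \<mu>]
      by (subst sets_restrict_space_iff) (auto simp: \<mu> Int_absorb2)
    have "emeasure ?M C = emeasure (density (restrict_space \<mu> B) (\<lambda>x. r x * indicator N x)) (Some -` C)"
      using D by (subst emeasure_distr[OF S C]) (simp add: sp Int_absorb2)
    also have "\<dots> = emeasure (density (restrict_space \<mu> B) r) (Some -` C \<inter> N)"
      unfolding emeasure_density[OF r2 D'] emeasure_density[OF r'[OF r] DN]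
      by (intro nn_integral_cong) (auto split: split_indicator)
    finally show "emeasure ?M C = emeasure (density (restrict_space \<mu> B) r) (Some -` C \<inter> N)" .
  qed
  finally show ?thesis ..
qed

text \<open>The cemetery has no mass, so \<open>f None\<close> drops out and an integral over
  \<open>\<mu>\<close> remains.\<close>

lemma nn_integral_cut_measure:
  fixes X \<mu> :: "'a measure"
  assumes \<mu>[measurable_cong]: "sets \<mu> = sets X" and B: "B \<in> sets X" and N: "N \<in> sets X" and r: "r \<in> borel_measurable X"
    and f: "f \<in> borel_measurable (adjoin_cemetery X B)"
  shows "(\<integral>\<^sup>+z. f z \<partial>cut_measure X B N (density (restrict_space \<mu> B) r)) =
    (\<integral>\<^sup>+x. indicator N x * (indicator B x * r x) * f (Some x) \<partial>\<mu>)"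
proof -
  note [measurable] = B N r
  have sr: "sets (restrict_space \<mu> B) = sets (restrict_space X B)"
    by (rule sets_restrict_space_cong[OF \<mu>])
  have S: "Some \<in> density (restrict_space \<mu> B) (\<lambda>x. r x * indicator N x) \<rightarrow>\<^sub>M adjoin_cemetery X B"
    using measurable_Some_adjoin_cemetery[OF B] sr
    by (subst measurable_cong_sets[of _ "restrict_space X B"]) auto
  have r2: "(\<lambda>x. r x * indicator N x) \<in> borel_measurable (restrict_space \<mu> B)"
    by (intro measurable_restrict_space1) measurable
  have f2: "(\<lambda>x. f (Some x)) \<in> borel_measurable (restrict_space \<mu> B)"
    using measurable_compose[OF S f] by simp
  have f3: "f \<in> borel_measurable (distr (density (restrict_space \<mu> B) (\<lambda>x. r x * indicator N x))
      (adjoin_cemetery X B) Some)"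
    using f by simp
  have "B \<inter> space \<mu> \<in> sets \<mu>" using B by (auto simp: \<mu>)
  then show ?thesis
    unfolding cut_measure_density[OF \<mu> B N r] nn_integral_distr[OF S f3] nn_integral_density[OF r2 f2]
    by (subst nn_integral_restrict_space) (auto intro!: nn_integral_cong simp: ac_simps)
qed

section \<open>Duality\<close>

text \<open>The map \<open>h\<close> covers both orders of the pair in \<open>dual_wrt\<close>,
  which keeps the order on one side and swaps it on the other.\<close>

lemma nn_integral_bind_bind_return:
  assumes K: "K \<in> m \<rightarrow>\<^sub>M subprob_algebra m" and h: "(\<lambda>(x, y). h x y) \<in> m \<Otimes>\<^sub>M m \<rightarrow>\<^sub>M M"
    and f: "f \<in> borel_measurable M"
  shows "(\<integral>\<^sup>+z. f z \<partial>do {x \<leftarrow> m; y \<leftarrow> K x; return M (h x y)}) = (\<integral>\<^sup>+x. \<integral>\<^sup>+y. f (h x y) \<partial>K x \<partial>m)"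
proof -
  have ret: "(\<lambda>(x, y). return M (h x y)) \<in> m \<Otimes>\<^sub>M m \<rightarrow>\<^sub>M subprob_algebra M"
    using measurable_compose[OF h return_measurable] by (simp add: case_prod_beta')
  have "(\<lambda>x. K x \<bind> (\<lambda>y. return M (h x y))) \<in> m \<rightarrow>\<^sub>M subprob_algebra M"
    by (rule measurable_bind'[OF K ret])
  then have "(\<integral>\<^sup>+z. f z \<partial>do {x \<leftarrow> m; y \<leftarrow> K x; return M (h x y)}) =
      (\<integral>\<^sup>+x. \<integral>\<^sup>+z. f z \<partial>(K x \<bind> (\<lambda>y. return M (h x y))) \<partial>m)"
    by (rule nn_integral_bind[OF f])
  also have "\<dots> = (\<integral>\<^sup>+x. \<integral>\<^sup>+y. f (h x y) \<partial>K x \<partial>m)"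
  proof (rule nn_integral_cong)
    fix x assume x: "x \<in> space m"
    have sK: "sets (K x) = sets m" by (rule sets_kernel[OF K x])
    have hx: "h x \<in> m \<rightarrow>\<^sub>M M"
      using measurable_compose[OF measurable_Pair1'[OF x] h] by simp
    have "h x \<in> K x \<rightarrow>\<^sub>M M" using hx by (simp only: measurable_cong_sets[OF sK refl])
    then have "(\<lambda>y. return M (h x y)) \<in> K x \<rightarrow>\<^sub>M subprob_algebra M"
      by (rule measurable_compose[OF _ return_measurable])
    then have "(\<integral>\<^sup>+z. f z \<partial>(K x \<bind> (\<lambda>y. return M (h x y)))) = (\<integral>\<^sup>+y. \<integral>\<^sup>+z. f z \<partial>return M (h x y) \<partial>K x)"
      by (rule nn_integral_bind[OF f])
    also have "\<dots> = (\<integral>\<^sup>+y. f (h x y) \<partial>K x)"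
      using measurable_space[OF hx] f sets_eq_imp_space_eq[OF sK]
      by (intro nn_integral_cong nn_integral_return) auto
    finally show "(\<integral>\<^sup>+z. f z \<partial>(K x \<bind> (\<lambda>y. return M (h x y)))) = (\<integral>\<^sup>+y. f (h x y) \<partial>K x)" .
  qed
  finally show ?thesis .
qed

lemma sets_bind_bind_return:
  assumes K: "K \<in> m \<rightarrow>\<^sub>M subprob_algebra m" and h: "(\<lambda>(x, y). h x y) \<in> m \<Otimes>\<^sub>M m \<rightarrow>\<^sub>M M"
    and m: "space m \<noteq> {}"
  shows "sets (do {x \<leftarrow> m; y \<leftarrow> K x; return M (h x y)}) = sets M"
proof -
  have "(\<lambda>(x, y). return M (h x y)) \<in> m \<Otimes>\<^sub>M m \<rightarrow>\<^sub>M subprob_algebra M"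
    using measurable_compose[OF h return_measurable] by (simp add: case_prod_beta')
  then have "(\<lambda>x. K x \<bind> (\<lambda>y. return M (h x y))) \<in> m \<rightarrow>\<^sub>M subprob_algebra M"
    by (rule measurable_bind'[OF K])
  from sets_bind_measurable[OF this m] show ?thesis .
qed

lemma dual_wrt_nn_integral:
  assumes dual: "dual_wrt m K K'" and f: "(\<lambda>(x, y). f x y) \<in> borel_measurable (m \<Otimes>\<^sub>M m)"
  shows "(\<integral>\<^sup>+x. \<integral>\<^sup>+y. f x y \<partial>K x \<partial>m) = (\<integral>\<^sup>+y. \<integral>\<^sup>+x. f x y \<partial>K' y \<partial>m)"
proof -
  have K: "K \<in> m \<rightarrow>\<^sub>M subprob_algebra m" "K' \<in> m \<rightarrow>\<^sub>M subprob_algebra m"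
    using dual by (auto simp: dual_wrt_def markov_kernel_def intro: measurable_prob_algebraD)
  have "(\<integral>\<^sup>+x. \<integral>\<^sup>+y. f x y \<partial>K x \<partial>m) =
      (\<integral>\<^sup>+z. (\<lambda>(x, y). f x y) z \<partial>do {x \<leftarrow> m; y \<leftarrow> K x; return (m \<Otimes>\<^sub>M m) (x, y)})"
    by (subst nn_integral_bind_bind_return[OF K(1) _ f]) simp_all
  also have "\<dots> = (\<integral>\<^sup>+z. (\<lambda>(x, y). f x y) z \<partial>do {y \<leftarrow> m; x \<leftarrow> K' y; return (m \<Otimes>\<^sub>M m) (x, y)})"
    using dual by (simp only: dual_wrt_def)
  also have "\<dots> = (\<integral>\<^sup>+y. \<integral>\<^sup>+x. f x y \<partial>K' y \<partial>m)"
    by (subst nn_integral_bind_bind_return[OF K(2) _ f]) simp_all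
  finally show ?thesis .
qed

lemma emeasure_bind_bind_return:
  assumes K: "K \<in> m \<rightarrow>\<^sub>M subprob_algebra m" and h: "(\<lambda>(x, y). h x y) \<in> m \<Otimes>\<^sub>M m \<rightarrow>\<^sub>M M"
    and m: "space m \<noteq> {}" and S: "S \<in> sets M"
  shows "emeasure (do {x \<leftarrow> m; y \<leftarrow> K x; return M (h x y)}) S = (\<integral>\<^sup>+x. \<integral>\<^sup>+y. indicator S (h x y) \<partial>K x \<partial>m)"
proof -
  have "S \<in> sets (do {x \<leftarrow> m; y \<leftarrow> K x; return M (h x y)})"
    using S by (simp only: sets_bind_bind_return[OF K h m])
  from nn_integral_indicator[OF this, symmetric] show ?thesis
    using S by (subst (asm) nn_integral_bind_bind_return[OF K h]) auto
qed

lemma dual_wrtI_sets: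
  assumes kernels: "markov_kernel m K" "markov_kernel m K'"
    and eq: "\<And>S. S \<in> sets (m \<Otimes>\<^sub>M m) \<Longrightarrow>
      (\<integral>\<^sup>+x. \<integral>\<^sup>+y. indicator S (x, y) \<partial>K x \<partial>m) = (\<integral>\<^sup>+y. \<integral>\<^sup>+x. indicator S (x, y) \<partial>K' y \<partial>m)"
  shows "dual_wrt m K K'"
proof -
  have K: "K \<in> m \<rightarrow>\<^sub>M subprob_algebra m" "K' \<in> m \<rightarrow>\<^sub>M subprob_algebra m"
    using kernels by (auto simp: markov_kernel_def intro: measurable_prob_algebraD)
  have id: "(\<lambda>(x, y). (x, y)) \<in> m \<Otimes>\<^sub>M m \<rightarrow>\<^sub>M m \<Otimes>\<^sub>M m" by simp
  have swap: "(\<lambda>(y, x). (x, y)) \<in> m \<Otimes>\<^sub>M m \<rightarrow>\<^sub>M m \<Otimes>\<^sub>M m" by measurable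
  have "do {x \<leftarrow> m; y \<leftarrow> K x; return (m \<Otimes>\<^sub>M m) (x, y)} = do {y \<leftarrow> m; x \<leftarrow> K' y; return (m \<Otimes>\<^sub>M m) (x, y)}"
    (is "?L = ?R")
  proof (cases "space m = {}")
    \<comment> \<open>On an empty space \<open>bind\<close> gives the empty measure by convention,
      whatever the kernel is.\<close>
    case True
    then show ?thesis by (simp add: bind_empty)
  next
    case False
    show ?thesis
    proof (rule measure_eqI)
      show "sets ?L = sets ?R"
        by (simp only: sets_bind_bind_return[OF K(1) id False] sets_bind_bind_return[OF K(2) swap False])
      fix S assume "S \<in> sets ?L"
      then have S: "S \<in> sets (m \<Otimes>\<^sub>M m)" by (simp only: sets_bind_bind_return[OF K(1) id False])
      show "emeasure ?L S = emeasure ?R S"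
        by (simp only: eq[OF S] emeasure_bind_bind_return[OF K(1) id False S]
            emeasure_bind_bind_return[OF K(2) swap False S])
    qed
  qed
  then show ?thesis using kernels by (simp add: dual_wrt_def)
qed

lemma dual_wrt_sym:
  assumes "dual_wrt m K K'"
  shows "dual_wrt m K' K"
proof (rule dual_wrtI_sets)
  show "markov_kernel m K'" "markov_kernel m K" using assms by (simp_all add: dual_wrt_def)
  fix S assume [measurable]: "S \<in> sets (m \<Otimes>\<^sub>M m)"
  have "(\<lambda>(x, y). indicator S (y, x) :: ennreal) \<in> borel_measurable (m \<Otimes>\<^sub>M m)" by measurable
  from dual_wrt_nn_integral[OF assms this]
  show "(\<integral>\<^sup>+x. \<integral>\<^sup>+y. indicator S (x, y) \<partial>K' x \<partial>m) = (\<integral>\<^sup>+y. \<integral>\<^sup>+x. indicator S (x, y) \<partial>K y \<partial>m)" ..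
qed

text \<open>Rectangles form an intersection-stable generator, and equality on them extends along an
  exhaustion by sets of finite mass. The sets \<open>F i \<times> space m\<close> provide one
  because the kernels have mass at most 1.\<close>

lemma dual_wrtI:
  fixes F :: "nat \<Rightarrow> 'a set"
  assumes kernels: "markov_kernel m K" "markov_kernel m K'"
    and F: "range F \<subseteq> sets m" "(\<Union>i. F i) = space m" "\<And>i. emeasure m (F i) \<noteq> \<infinity>"
    and eq: "\<And>C D. C \<in> sets m \<Longrightarrow> D \<in> sets m \<Longrightarrow>
      (\<integral>\<^sup>+x. indicator C x * emeasure (K x) D \<partial>m) = (\<integral>\<^sup>+y. indicator D y * emeasure (K' y) C \<partial>m)"
  shows "dual_wrt m K K'"
proof (rule dual_wrtI_sets[OF kernels])
  have K: "K \<in> m \<rightarrow>\<^sub>M subprob_algebra m" "K' \<in> m \<rightarrow>\<^sub>M subprob_algebra m"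
    using kernels by (auto simp: markov_kernel_def intro: measurable_prob_algebraD)
  have id: "(\<lambda>(x, y). (x, y)) \<in> m \<Otimes>\<^sub>M m \<rightarrow>\<^sub>M m \<Otimes>\<^sub>M m" by simp
  have swap: "(\<lambda>(y, x). (x, y)) \<in> m \<Otimes>\<^sub>M m \<rightarrow>\<^sub>M m \<Otimes>\<^sub>M m" by measurable
  fix S assume S: "S \<in> sets (m \<Otimes>\<^sub>M m)"
  show "(\<integral>\<^sup>+x. \<integral>\<^sup>+y. indicator S (x, y) \<partial>K x \<partial>m) = (\<integral>\<^sup>+y. \<integral>\<^sup>+x. indicator S (x, y) \<partial>K' y \<partial>m)"
  proof (cases "space m = {}")
    case True
    then show ?thesis by (simp add: nn_integral_empty)
  next
    case False
    let ?L = "do {x \<leftarrow> m; y \<leftarrow> K x; return (m \<Otimes>\<^sub>M m) (x, y)}"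
    let ?R = "do {y \<leftarrow> m; x \<leftarrow> K' y; return (m \<Otimes>\<^sub>M m) (x, y)}"
    note sL = sets_bind_bind_return[OF K(1) id False]
    note sR = sets_bind_bind_return[OF K(2) swap False]
    note eL = emeasure_bind_bind_return[OF K(1) id False]
    note eR = emeasure_bind_bind_return[OF K(2) swap False]
    have rectL: "emeasure ?L (C \<times> D) = (\<integral>\<^sup>+x. indicator C x * emeasure (K x) D \<partial>m)"
      if C: "C \<in> sets m" and D: "D \<in> sets m" for C D
    proof -
      have "emeasure ?L (C \<times> D) = (\<integral>\<^sup>+x. \<integral>\<^sup>+y. indicator (C \<times> D) (x, y) \<partial>K x \<partial>m)"
        by (rule eL) (use C D in auto)
      also have "\<dots> = (\<integral>\<^sup>+x. indicator C x * emeasure (K x) D \<partial>m)"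
        using D by (intro nn_integral_cong)
          (auto simp: indicator_times nn_integral_cmult_indicator sets_kernel[OF K(1)])
      finally show ?thesis .
    qed
    have rectR: "emeasure ?R (C \<times> D) = (\<integral>\<^sup>+y. indicator D y * emeasure (K' y) C \<partial>m)"
      if C: "C \<in> sets m" and D: "D \<in> sets m" for C D
    proof -
      have "emeasure ?R (C \<times> D) = (\<integral>\<^sup>+y. \<integral>\<^sup>+x. indicator (C \<times> D) (x, y) \<partial>K' y \<partial>m)"
        by (rule eR) (use C D in auto)
      also have "\<dots> = (\<integral>\<^sup>+y. indicator D y * emeasure (K' y) C \<partial>m)"
      proof (rule nn_integral_cong)
        fix y assume "y \<in> space m"
        then have "C \<in> sets (K' y)" using C by (simp add: sets_kernel[OF K(2)])
        from nn_integral_cmult_indicator[OF this, of "indicator D y"]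
        show "(\<integral>\<^sup>+x. indicator (C \<times> D) (x, y) \<partial>K' y) = indicator D y * emeasure (K' y) C"
          by (simp add: indicator_times mult.commute)
      qed
      finally show ?thesis .
    qed
    have "?L = ?R"
    proof (rule measure_eqI_generator_eq)
      let ?E = "{C \<times> D |C D. C \<in> sets m \<and> D \<in> sets m}"
      show "Int_stable ?E" by (rule Int_stable_pair_measure_generator)
      show "?E \<subseteq> Pow (space m \<times> space m)" by (rule pair_measure_closed)
      show "sets ?L = sigma_sets (space m \<times> space m) ?E" "sets ?R = sigma_sets (space m \<times> space m) ?E"
        unfolding sL sR sets_pair_measure by (rule refl)+
      show "emeasure ?L Z = emeasure ?R Z" if "Z \<in> ?E" for Z
        using that by (auto simp only: rectL rectR eq mem_Collect_eq)
      let ?A = "\<lambda>i. F i \<times> space m"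
      show "range ?A \<subseteq> ?E" using F(1) by blast
      show "(\<Union>i. ?A i) = space m \<times> space m" using F(2) by blast
      show "emeasure ?L (?A i) \<noteq> \<infinity>" for i
      proof -
        have Fi: "F i \<in> sets m" using F(1) by blast
        have "emeasure ?L (?A i) = (\<integral>\<^sup>+x. indicator (F i) x * emeasure (K x) (space m) \<partial>m)"
          by (rule rectL[OF Fi]) simp
        also have "\<dots> \<le> (\<integral>\<^sup>+x. indicator (F i) x \<partial>m)"
        proof (rule nn_integral_mono)
          fix x assume "x \<in> space m"
          then have "emeasure (K x) (space m) \<le> 1"
            using measurable_space[OF K(1)] by (auto simp: space_subprob_algebra intro: subprob_space.subprob_emeasure_le_1)
          from mult_left_mono[OF this, of "indicator (F i) x"]
          show "indicator (F i) x * emeasure (K x) (space m) \<le> indicator (F i) x" by simp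
        qed
        also have "\<dots> = emeasure m (F i)" using Fi by simp
        finally show ?thesis using F(3)[of i] by (auto simp: top_unique)
      qed
    qed
    then show ?thesis unfolding eL[OF S, symmetric] eR[OF S, symmetric] by simp
  qed
qed

section \<open>Dual chains and adjoint operators\<close>

locale dual_chains =
  fixes X \<mu> :: "'a measure" and P P' :: "'a \<Rightarrow> 'a measure"
  assumes sets_\<mu> [measurable_cong]: "sets \<mu> = sets X"
    and dual: "dual_wrt \<mu> P P'"
begin

lemma space_\<mu>: "space \<mu> = space X"
  by (rule sets_eq_imp_space_eq[OF sets_\<mu>])

lemma swap: "dual_chains X \<mu> P' P"
  using sets_\<mu> dual_wrt_sym[OF dual] by (rule dual_chains.intro)

end

sublocale dual_chains \<subseteq> fwd: markov_chain X P
proof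
  have "prob_algebra \<mu> = prob_algebra X" by (simp add: prob_algebra_def subprob_algebra_cong[OF sets_\<mu>])
  then show "markov_kernel X P"
    using dual by (simp add: dual_wrt_def markov_kernel_def measurable_cong_sets[OF sets_\<mu> refl])
qed

sublocale dual_chains \<subseteq> bwd: markov_chain X P'
proof
  have "prob_algebra \<mu> = prob_algebra X" by (simp add: prob_algebra_def subprob_algebra_cong[OF sets_\<mu>])
  then show "markov_kernel X P'"
    using dual by (simp add: dual_wrt_def markov_kernel_def measurable_cong_sets[OF sets_\<mu> refl])
qed

context dual_chains
begin

lemma duality:
  assumes "(\<lambda>(x, y). f x y) \<in> borel_measurable (X \<Otimes>\<^sub>M X)"
  shows "(\<integral>\<^sup>+x. \<integral>\<^sup>+y. f x y \<partial>P x \<partial>\<mu>) = (\<integral>\<^sup>+y. \<integral>\<^sup>+x. f x y \<partial>P' y \<partial>\<mu>)"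
proof (rule dual_wrt_nn_integral[OF dual])
  show "(\<lambda>(x, y). f x y) \<in> borel_measurable (\<mu> \<Otimes>\<^sub>M \<mu>)"
    using assms measurable_cong_sets[OF sets_pair_measure_cong[OF sets_\<mu> sets_\<mu>] refl] by blast
qed

lemma sets_converse [measurable]:
  assumes W: "W \<in> sets (X \<Otimes>\<^sub>M X)"
  shows "W\<inverse> \<in> sets (X \<Otimes>\<^sub>M X)"
proof -
  have "W\<inverse> = (\<lambda>(x, y). (y, x)) -` W \<inter> space (X \<Otimes>\<^sub>M X)"
    using sets.sets_into_space[OF W] by (auto simp: space_pair_measure)
  also have "\<dots> \<in> sets (X \<Otimes>\<^sub>M X)"
    by (rule measurable_sets[OF measurable_pair_swap' W])
  finally show ?thesis .
qed

lemma nn_integral_mult_transition: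
  assumes [measurable]: "W \<in> sets (X \<Otimes>\<^sub>M X)" "f \<in> borel_measurable X"
  shows "(\<integral>\<^sup>+x. g x * transition P W f x \<partial>\<mu>) = (\<integral>\<^sup>+x. \<integral>\<^sup>+y. g x * (indicator W (x, y) * f y) \<partial>P x \<partial>\<mu>)"
  unfolding transition_def
proof (rule nn_integral_cong)
  fix x assume "x \<in> space \<mu>"
  then have x[measurable]: "x \<in> space X" by (simp add: space_\<mu>)
  have "(\<lambda>y. indicator W (x, y) * f y) \<in> borel_measurable X" by measurable
  then show "g x * (\<integral>\<^sup>+y. indicator W (x, y) * f y \<partial>P x) = (\<integral>\<^sup>+y. g x * (indicator W (x, y) * f y) \<partial>P x)"
    by (intro nn_integral_cmult[symmetric])
      (simp only: measurable_cong_sets[OF fwd.sets_kernel_eq[OF x] refl])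
qed

lemma transition_adjoint:
  assumes W[measurable]: "W \<in> sets (X \<Otimes>\<^sub>M X)"
    and [measurable]: "f \<in> borel_measurable X" "g \<in> borel_measurable X"
  shows "(\<integral>\<^sup>+x. g x * transition P W f x \<partial>\<mu>) = (\<integral>\<^sup>+y. transition P' (W\<inverse>) g y * f y \<partial>\<mu>)"
proof -
  have "(\<integral>\<^sup>+x. g x * transition P W f x \<partial>\<mu>) = (\<integral>\<^sup>+x. \<integral>\<^sup>+y. g x * (indicator W (x, y) * f y) \<partial>P x \<partial>\<mu>)"
    by (rule nn_integral_mult_transition) measurable
  also have "\<dots> = (\<integral>\<^sup>+y. \<integral>\<^sup>+x. g x * (indicator W (x, y) * f y) \<partial>P' y \<partial>\<mu>)"
    by (rule duality) measurable
  also have "\<dots> = (\<integral>\<^sup>+y. transition P' (W\<inverse>) g y * f y \<partial>\<mu>)"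
    unfolding transition_def
  proof (rule nn_integral_cong)
    fix y assume "y \<in> space \<mu>"
    then have y[measurable]: "y \<in> space X" by (simp add: space_\<mu>)
    have "(\<lambda>x. indicator (W\<inverse>) (y, x) * g x) \<in> borel_measurable X" by measurable
    then have "(\<integral>\<^sup>+x. indicator (W\<inverse>) (y, x) * g x * f y \<partial>P' y) = (\<integral>\<^sup>+x. indicator (W\<inverse>) (y, x) * g x \<partial>P' y) * f y"
      by (intro nn_integral_multc)
        (simp only: measurable_cong_sets[OF bwd.sets_kernel_eq[OF y] refl])
    then show "(\<integral>\<^sup>+x. g x * (indicator W (x, y) * f y) \<partial>P' y) = (\<integral>\<^sup>+x. indicator (W\<inverse>) (y, x) * g x \<partial>P' y) * f y"
      by (simp add: ac_simps indicator_def)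
  qed
  finally show ?thesis .
qed

text \<open>The outermost operator is moved onto \<open>g\<close>, so the induction needs all
  \<open>g\<close> at once. The moved factors pile up in reverse order, which is harmless for powers
  of a single operator.\<close>

lemma transition_power_adjoint:
  assumes W[measurable]: "W \<in> sets (X \<Otimes>\<^sub>M X)"
    and "f \<in> borel_measurable X" "g \<in> borel_measurable X"
  shows "(\<integral>\<^sup>+x. g x * (transition P W ^^ n) f x \<partial>\<mu>) = (\<integral>\<^sup>+y. (transition P' (W\<inverse>) ^^ n) g y * f y \<partial>\<mu>)"
  using assms(2,3)
proof (induction n arbitrary: g)
  case (Suc n)
  note [measurable] = Suc.prems
  have "(\<integral>\<^sup>+x. g x * (transition P W ^^ Suc n) f x \<partial>\<mu>) =
      (\<integral>\<^sup>+y. transition P' (W\<inverse>) g y * (transition P W ^^ n) f y \<partial>\<mu>)"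
    by (simp add: transition_adjoint)
  also have "\<dots> = (\<integral>\<^sup>+y. (transition P' (W\<inverse>) ^^ n) (transition P' (W\<inverse>) g) y * f y \<partial>\<mu>)"
    by (rule Suc.IH) measurable
  also have "(transition P' (W\<inverse>) ^^ n) (transition P' (W\<inverse>) g) = (transition P' (W\<inverse>) ^^ Suc n) g"
    by (simp add: funpow_swap1)
  finally show ?case .
qed simp

end

text \<open>
  Both kernels are required to preserve \<open>N\<close> up to null sets; duality turns the second requirement
  into \<open>P\<close> not entering \<open>N\<close> from outside.
\<close>
locale dual_chains_invariant = dual_chains +
  fixes N
  assumes N [measurable]: "N \<in> sets X"
    and invariant: "AE x in \<mu>. x \<in> N \<longrightarrow> (AE y in P x. y \<in> N)"
    and invariant': "AE x in \<mu>. x \<in> N \<longrightarrow> (AE y in P' x. y \<in> N)"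
begin

text \<open>Since \<open>P x\<close> is carried by \<open>N\<close> for almost every
  \<open>x\<close> in \<open>N\<close>, the indicator at the target comes for free.\<close>

lemma nn_integral_leaves_N:
  assumes [measurable]: "(\<lambda>(x, y). f x y) \<in> borel_measurable (X \<Otimes>\<^sub>M X)"
  shows "(\<integral>\<^sup>+x. \<integral>\<^sup>+y. indicator N x * f x y \<partial>P x \<partial>\<mu>) = (\<integral>\<^sup>+x. \<integral>\<^sup>+y. indicator N x * indicator N y * f x y \<partial>P x \<partial>\<mu>)"
proof (rule nn_integral_cong_AE)
  show "AE x in \<mu>. (\<integral>\<^sup>+y. indicator N x * f x y \<partial>P x) = (\<integral>\<^sup>+y. indicator N x * indicator N y * f x y \<partial>P x)"
    using invariant
  proof eventually_elim
    case (elim x)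
    show ?case
    proof (cases "x \<in> N")
      case True
      with elim have "AE y in P x. y \<in> N" by simp
      then show ?thesis by (intro nn_integral_cong_AE) (auto elim!: eventually_mono)
    qed simp
  qed
qed

end

text \<open>The assumptions are symmetric in the two kernels, so the facts of the locale are also
  available for the reversed chain under the prefix \<open>rev\<close>.\<close>

sublocale dual_chains_invariant \<subseteq> rev: dual_chains_invariant X \<mu> P' P N
  by (intro dual_chains_invariant.intro swap dual_chains_invariant_axioms.intro N invariant invariant')

context dual_chains_invariant
begin

text \<open>An indicator of \<open>N\<close> at the target is exchanged for one at the source. Seen
  from the target, the reversed kernel stays in \<open>N\<close>, which adds the indicator at the
  source; seen from the source, \<open>P\<close> stays in \<open>N\<close>, which makes the one at
  the target redundant.\<close>

lemma transition_indicator: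
  assumes [measurable]: "W \<in> sets (X \<Otimes>\<^sub>M X)" "f \<in> borel_measurable X" "g \<in> borel_measurable X"
  shows "(\<integral>\<^sup>+x. g x * transition P W (\<lambda>y. indicator N y * f y) x \<partial>\<mu>) =
    (\<integral>\<^sup>+x. indicator N x * g x * transition P W f x \<partial>\<mu>)"
proof -
  let ?h = "\<lambda>x y. g x * (indicator W (x, y) * f y)"
  have "(\<integral>\<^sup>+x. g x * transition P W (\<lambda>y. indicator N y * f y) x \<partial>\<mu>) = (\<integral>\<^sup>+x. \<integral>\<^sup>+y. indicator N y * ?h x y \<partial>P x \<partial>\<mu>)"
    by (subst nn_integral_mult_transition) (simp_all add: ac_simps)
  also have "\<dots> = (\<integral>\<^sup>+y. \<integral>\<^sup>+x. indicator N y * ?h x y \<partial>P' y \<partial>\<mu>)" by (rule duality) measurable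
  also have "\<dots> = (\<integral>\<^sup>+y. \<integral>\<^sup>+x. indicator N y * indicator N x * ?h x y \<partial>P' y \<partial>\<mu>)"
    by (rule rev.nn_integral_leaves_N) measurable
  also have "\<dots> = (\<integral>\<^sup>+x. \<integral>\<^sup>+y. indicator N y * indicator N x * ?h x y \<partial>P x \<partial>\<mu>)"
    by (rule duality[symmetric]) measurable
  also have "\<dots> = (\<integral>\<^sup>+x. \<integral>\<^sup>+y. indicator N x * ?h x y \<partial>P x \<partial>\<mu>)"
    by (subst nn_integral_leaves_N) (measurable, simp add: ac_simps)
  also have "\<dots> = (\<integral>\<^sup>+x. indicator N x * g x * transition P W f x \<partial>\<mu>)"
    by (subst nn_integral_mult_transition) (simp_all add: ac_simps)
  finally show ?thesis .
qed

text \<open>The outermost operator is parked in \<open>g\<close> by adjunction while the induction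
  hypothesis deals with the others; then it is brought back and commuted by itself.\<close>

lemma transition_power_indicator:
  assumes [measurable]: "W \<in> sets (X \<Otimes>\<^sub>M X)" "f \<in> borel_measurable X" and "g \<in> borel_measurable X"
  shows "(\<integral>\<^sup>+x. g x * (transition P W ^^ n) (\<lambda>y. indicator N y * f y) x \<partial>\<mu>) =
    (\<integral>\<^sup>+x. indicator N x * g x * (transition P W ^^ n) f x \<partial>\<mu>)"
  using assms(3)
proof (induction n arbitrary: g)
  case 0
  show ?case by (simp add: ac_simps)
next
  case (Suc n)
  note [measurable] = Suc.prems
  have "(\<integral>\<^sup>+x. g x * (transition P W ^^ Suc n) (\<lambda>y. indicator N y * f y) x \<partial>\<mu>) =
      (\<integral>\<^sup>+x. transition P' (W\<inverse>) g x * (transition P W ^^ n) (\<lambda>y. indicator N y * f y) x \<partial>\<mu>)"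
    by (simp add: transition_adjoint)
  also have "\<dots> = (\<integral>\<^sup>+x. indicator N x * transition P' (W\<inverse>) g x * (transition P W ^^ n) f x \<partial>\<mu>)"
    by (rule Suc.IH) measurable
  also have "\<dots> = (\<integral>\<^sup>+x. transition P' (W\<inverse>) g x * (indicator N x * (transition P W ^^ n) f x) \<partial>\<mu>)"
    by (simp add: ac_simps)
  also have "\<dots> = (\<integral>\<^sup>+x. g x * transition P W (\<lambda>x. indicator N x * (transition P W ^^ n) f x) x \<partial>\<mu>)"
    by (rule transition_adjoint[symmetric]) measurable
  also have "\<dots> = (\<integral>\<^sup>+x. indicator N x * g x * (transition P W ^^ Suc n) f x \<partial>\<mu>)"
    by (simp add: transition_indicator)
  finally show ?case .
qed

end

lemma markov_kernel_cong:
  assumes "sets m = sets M"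
  shows "markov_kernel m K \<longleftrightarrow> K \<in> M \<rightarrow>\<^sub>M prob_algebra M"
  unfolding markov_kernel_def prob_algebra_def subprob_algebra_cong[OF assms]
    measurable_cong_sets[OF assms refl] ..

lemma nn_integral_mult_suminf:
  fixes g :: "'a \<Rightarrow> ennreal"
  assumes [measurable]: "g \<in> borel_measurable M" "\<And>n. s n \<in> borel_measurable M"
  shows "(\<integral>\<^sup>+x. g x * (\<Sum>n. s n x) \<partial>M) = (\<Sum>n. \<integral>\<^sup>+x. g x * s n x \<partial>M)"
  by (simp add: nn_integral_suminf flip: ennreal_suminf_cmult)

lemma emeasure_cut_measure:
  fixes X \<mu> :: "'a measure"
  assumes \<mu>: "sets \<mu> = sets X" and B: "B \<in> sets X" and N: "N \<in> sets X" and r: "r \<in> borel_measurable X"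
    and E: "E \<in> sets (adjoin_cemetery X B)"
  shows "emeasure (cut_measure X B N (density (restrict_space \<mu> B) r)) E =
    (\<integral>\<^sup>+x. indicator N x * (indicator B x * r x) * indicator (Some -` E) x \<partial>\<mu>)"
proof -
  let ?m = "cut_measure X B N (density (restrict_space \<mu> B) r)"
  have "emeasure ?m E = (\<integral>\<^sup>+z. indicator E z \<partial>?m)"
    using E by (simp add: sets_cut_measure)
  also have "\<dots> = (\<integral>\<^sup>+x. indicator N x * (indicator B x * r x) * indicator E (Some x) \<partial>\<mu>)"
    by (rule nn_integral_cut_measure[OF \<mu> B N r]) (use E in simp)
  finally show ?thesis by (simp add: indicator_def)
qed

text \<open>Sets of finite \<open>\<mu>\<close>-measure keep finite measure under a density bounded
  by 1. Each is enlarged by the cemetery so that the whole space is covered; this adds no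
  mass.\<close>

lemma cut_measure_cover:
  fixes X \<mu> :: "'a measure"
  assumes \<mu>: "sets \<mu> = sets X" and sf: "sigma_finite_measure \<mu>"
    and B: "B \<in> sets X" and N: "N \<in> sets X" and r: "r \<in> borel_measurable X"
    and le: "\<And>x. x \<in> space X \<Longrightarrow> r x \<le> 1"
  obtains F :: "nat \<Rightarrow> 'a option set" where
    "range F \<subseteq> sets (cut_measure X B N (density (restrict_space \<mu> B) r))"
    "(\<Union>i. F i) = space (cut_measure X B N (density (restrict_space \<mu> B) r))"
    "\<And>i. emeasure (cut_measure X B N (density (restrict_space \<mu> B) r)) (F i) \<noteq> \<infinity>"
proof -
  obtain G :: "nat \<Rightarrow> 'a set" where G: "range G \<subseteq> sets \<mu>" "(\<Union>i. G i) = space \<mu>" "\<And>i. emeasure \<mu> (G i) \<noteq> \<infinity>"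
    using sigma_finite_measure.sigma_finite[OF sf] by blast
  have GX: "G i \<in> sets X" for i using G(1) \<mu> by blast
  have BX: "B \<subseteq> (\<Union>i. G i)"
    using sets.sets_into_space[OF B] G(2) sets_eq_imp_space_eq[OF \<mu>] by simp
  let ?m = "cut_measure X B N (density (restrict_space \<mu> B) r)"
  define F where "F i = insert None (Some ` (G i \<inter> B))" for i
  have F: "F i \<in> sets (adjoin_cemetery X B)" for i
  proof -
    have "Some -` F i = G i \<inter> B" by (auto simp: F_def)
    then show ?thesis using GX[of i] B by (auto simp: sets_adjoin_cemetery_iff[OF B] F_def)
  qed
  show thesis
  proof
    show "range F \<subseteq> sets ?m" using F by (auto simp: sets_cut_measure)
    show "(\<Union>i. F i) = space ?m" using BX by (auto simp: space_cut_measure F_def)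
    fix i
    have "emeasure ?m (F i) = (\<integral>\<^sup>+x. indicator N x * (indicator B x * r x) * indicator (Some -` F i) x \<partial>\<mu>)"
      by (rule emeasure_cut_measure[OF \<mu> B N r F])
    also have "\<dots> \<le> (\<integral>\<^sup>+x. indicator (G i) x \<partial>\<mu>)"
    proof (rule nn_integral_mono)
      fix x assume "x \<in> space \<mu>"
      then have "r x \<le> 1" using le sets_eq_imp_space_eq[OF \<mu>] by simp
      then show "indicator N x * (indicator B x * r x) * indicator (Some -` F i) x \<le> (indicator (G i) x :: ennreal)"
        by (auto simp: F_def split: split_indicator)
    qed
    also have "\<dots> = emeasure \<mu> (G i)" using G(1) by (intro nn_integral_indicator) auto
    finally show "emeasure ?m (F i) \<noteq> \<infinity>" using G(3)[of i] by (auto simp: top_unique)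
  qed
qed

text \<open>Serves to exchange the recurrent sets of the two chains, which agree up to a null
  set.\<close>

lemma cut_measure_cong_AE:
  fixes X \<mu> :: "'a measure"
  assumes \<mu>: "sets \<mu> = sets X" and B: "B \<in> sets X" and r: "r \<in> borel_measurable X"
    and N: "N \<in> sets X" and N': "N' \<in> sets X" and eq: "AE x in \<mu>. x \<in> N \<longleftrightarrow> x \<in> N'"
  shows "cut_measure X B N (density (restrict_space \<mu> B) r) =
    cut_measure X B N' (density (restrict_space \<mu> B) r)" (is "?L = ?R")
proof (rule measure_eqI)
  show "sets ?L = sets ?R" by (simp only: sets_cut_measure)
  fix E assume "E \<in> sets ?L"
  then have E: "E \<in> sets (adjoin_cemetery X B)" by (simp only: sets_cut_measure)
  show "emeasure ?L E = emeasure ?R E"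
    unfolding emeasure_cut_measure[OF \<mu> B N r E] emeasure_cut_measure[OF \<mu> B N' r E]
    using eq by (intro nn_integral_cong_AE) (auto elim!: eventually_mono simp: indicator_def)
qed

lemma (in markov_chain) measurable_emeasure_kernel:
  "B \<in> sets X \<Longrightarrow> (\<lambda>x. emeasure (P x) B) \<in> borel_measurable X"
  by (rule measurable_compose[OF kernel measurable_emeasure_subprob_algebra])

lemma (in markov_chain) exit_measure_eq:
  assumes \<mu>: "sets \<mu> = sets X" and D: "D \<in> sets X"
  shows "exit_measure X \<mu> P D = density (restrict_space \<mu> D) (\<lambda>x. emeasure (P x) (space X - D))"
proof -
  have sp: "space \<mu> = space X" by (rule sets_eq_imp_space_eq[OF \<mu>])
  have meas: "f \<in> borel_measurable (restrict_space \<mu> D)" if "f \<in> borel_measurable X" for f :: "'a \<Rightarrow> ennreal"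
    using that by (intro measurable_restrict_space1) (simp only: measurable_cong_sets[OF \<mu> refl])
  have "{\<omega>\<in>space (path_space X). \<omega> 1 \<in> space X - D} \<in> sets (path_space X)"
    using D by measurable
  from measurable_compose[OF measurable_law_subprob measurable_emeasure_subprob_algebra[OF this]]
  show ?thesis
    unfolding exit_measure_def
  proof (rule density_cong[OF meas meas])
    show "(\<lambda>x. emeasure (P x) (space X - D)) \<in> borel_measurable X"
      using D by (intro measurable_emeasure_kernel) auto
    have "emeasure (law x) {\<omega>\<in>space (path_space X). \<omega> 1 \<in> space X - D} = emeasure (P x) (space X - D)"
      if "x \<in> space (restrict_space \<mu> D)" for x
      by (rule emeasure_law_1) (use D that sets.sets_into_space[OF D] in \<open>auto simp: space_restrict_space sp\<close>)
    then show "AE x in restrict_space \<mu> D.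
        emeasure (law x) {\<omega>\<in>space (path_space X). \<omega> 1 \<in> space X - D} = emeasure (P x) (space X - D)"
      by (rule AE_I2)
  qed
qed

context dual_chains
begin

text \<open>An entrance into \<open>B\<close>, read backwards, is an exit from \<open>B\<close> of
  the reversed chain. This also confirms that the set function defining the entrance measure is a
  measure, and supplies its density.\<close>

lemma entrance_measure_eq_exit_measure:
  assumes B: "B \<in> sets X"
  shows "entrance_measure X \<mu> P B = exit_measure X \<mu> P' B"
proof -
  let ?r = "\<lambda>x. emeasure (P' x) (space X - B)"
  let ?M = "density (restrict_space \<mu> B) ?r"
  have r: "?r \<in> borel_measurable X" using B by (intro bwd.measurable_emeasure_kernel) auto
  have BX: "B \<subseteq> space X" by (rule sets.sets_into_space[OF B])
  have sp: "space ?M = B" using BX by (auto simp: space_restrict_space space_\<mu>)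
  have sM: "sets ?M = sets (restrict_space X B)"
    using sets_restrict_space_cong[OF sets_\<mu>] by simp
  have "?M = measure_of (space ?M) (sets ?M) (emeasure ?M)" by (rule measure_of_of_measure[symmetric])
  also have "\<dots> = measure_of B (sets (restrict_space X B)) (emeasure ?M)" by (simp only: sp sM)
  also have "\<dots> = entrance_measure X \<mu> P B"
    unfolding entrance_measure_def
  proof (rule measure_of_eq)
    show closed: "sets (restrict_space X B) \<subseteq> Pow B"
      using sets.space_closed[of "restrict_space X B"] BX by (auto simp: space_restrict_space)
    fix C assume "C \<in> sigma_sets B (sets (restrict_space X B))"
    then have C: "C \<in> sets (restrict_space X B)"
      using sets.sigma_sets_eq[of "restrict_space X B"] BX by (simp add: space_restrict_space Int_absorb2)
    then have CX[measurable]: "C \<in> sets X" and CB: "C \<subseteq> B"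
      using B BX by (auto simp: sets_restrict_space_iff Int_absorb2)
    note B[measurable]
    have C': "C \<in> sets (restrict_space \<mu> B)" using C sM by simp
    have r': "?r \<in> borel_measurable (restrict_space \<mu> B)"
      using r by (intro measurable_restrict_space1) measurable
    have "B \<inter> space \<mu> \<in> sets \<mu>" by (simp add: sets_\<mu> space_\<mu> B)
    then have "emeasure ?M C = (\<integral>\<^sup>+x. ?r x * indicator C x * indicator B x \<partial>\<mu>)"
      unfolding emeasure_density[OF r' C'] by (rule nn_integral_restrict_space)
    also have "\<dots> = (\<integral>\<^sup>+y. \<integral>\<^sup>+x. indicator C y * indicator (space X - B) x \<partial>P' y \<partial>\<mu>)"
    proof (rule nn_integral_cong)
      fix y assume "y \<in> space \<mu>"
      then have "space X - B \<in> sets (P' y)" by (auto simp: space_\<mu> bwd.sets_kernel_eq)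
      from nn_integral_cmult_indicator[OF this, of "indicator C y"]
      show "?r y * indicator C y * indicator B y = (\<integral>\<^sup>+x. indicator C y * indicator (space X - B) x \<partial>P' y)"
        using CB by (auto split: split_indicator)
    qed
    also have "\<dots> = (\<integral>\<^sup>+x. \<integral>\<^sup>+y. indicator C y * indicator (space X - B) x \<partial>P x \<partial>\<mu>)"
      by (rule duality[symmetric]) measurable
    also have "\<dots> = (\<integral>\<^sup>+x\<in>space X - B. emeasure (chain_law X P x) {\<omega>\<in>space (path_space X). \<omega> 1 \<in> C} \<partial>\<mu>)"
    proof (rule nn_integral_cong)
      fix x assume "x \<in> space \<mu>"
      then have x: "x \<in> space X" by (simp add: space_\<mu>)
      have "C \<in> sets (P x)" using x by (simp add: fwd.sets_kernel_eq)
      from nn_integral_cmult_indicator[OF this, of "indicator (space X - B) x"]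
      show "(\<integral>\<^sup>+y. indicator C y * indicator (space X - B) x \<partial>P x) =
          emeasure (chain_law X P x) {\<omega>\<in>space (path_space X). \<omega> 1 \<in> C} * indicator (space X - B) x"
        unfolding fwd.emeasure_law_1[OF x CX] by (simp add: mult.commute)
    qed
    finally show "emeasure ?M C =
        (\<integral>\<^sup>+x\<in>space X - B. emeasure (chain_law X P x) {\<omega>\<in>space (path_space X). \<omega> 1 \<in> C} \<partial>\<mu>)" .
  qed
  also have "?M = exit_measure X \<mu> P' B"
    by (rule bwd.exit_measure_eq[OF sets_\<mu> B, symmetric])
  finally show ?thesis ..
qed

end

section \<open>The duality and transport identities\<close>

locale dual_chains_recurrent = dual_chains +
  fixes A
  assumes \<sigma>: "sigma_finite_measure \<mu>"
    and A [measurable]: "A \<in> sets X"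
    and null: "emeasure \<mu> (sym_diff (both_inf_often X P A) (both_inf_often X P' A)) = 0"
begin

abbreviation "Ac \<equiv> space X - A"
abbreviation "N \<equiv> both_inf_often X P A"
abbreviation "N' \<equiv> both_inf_often X P' A"

lemma Ac [measurable]: "Ac \<in> sets X"
  using A by auto

lemma compl_Ac: "space X - Ac = A"
  using sets.sets_into_space[OF A] by auto

interpretation fwd_A: markov_chain_set X P A by unfold_locales (rule A)
interpretation fwd_Ac: markov_chain_set X P Ac by unfold_locales (rule Ac)
interpretation bwd_A: markov_chain_set X P' A by unfold_locales (rule A)
interpretation bwd_Ac: markov_chain_set X P' Ac by unfold_locales (rule Ac)

lemma swap_recurrent: "dual_chains_recurrent X \<mu> P' P A"
proof (intro dual_chains_recurrent.intro swap dual_chains_recurrent_axioms.intro \<sigma> A)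
  show "emeasure \<mu> (sym_diff N' N) = 0" using null by (simp add: Un_commute)
qed

lemma Compl_recurrent: "dual_chains_recurrent X \<mu> P P' Ac"
  using null
  by (intro dual_chains_recurrent.intro dual_chains_axioms dual_chains_recurrent_axioms.intro \<sigma> Ac)
     (simp add: both_inf_often_Compl[OF A])

lemma N [measurable]: "N \<in> sets X" and N' [measurable]: "N' \<in> sets X"
  by (rule fwd_A.sets_recurrent bwd_A.sets_recurrent)+

lemma AE_N_iff: "AE x in \<mu>. x \<in> N \<longleftrightarrow> x \<in> N'"
proof -
  have "sym_diff N N' \<in> null_sets \<mu>" using null N N' by (auto simp: null_sets_def sets_\<mu>)
  from AE_not_in[OF this] show ?thesis by eventually_elim blast
qed

text \<open>Each kernel preserves the recurrent set of its own chain. For \<open>P'\<close> this is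
  \<open>N'\<close>, and passing to \<open>N\<close> requires that \<open>P'\<close> does not charge
  the exceptional set, at least from almost every starting point.\<close>

sublocale dual_chains_invariant X \<mu> P P' N
proof
  show "N \<in> sets X" by (rule N)
  show "AE x in \<mu>. x \<in> N \<longrightarrow> (AE y in P x. y \<in> N)"
    using fwd_A.AE_kernel_recurrent by (intro AE_I2) blast
  have "AE x in \<mu>. AE y in P' x. y \<in> N \<longleftrightarrow> y \<in> N'"
  proof -
    \<comment> \<open>Duality makes \<open>\<mu>\<close> invariant for \<open>P'\<close>: integrated
      over all starting points, the mass that \<open>P'\<close> puts on this set is its
      \<open>\<mu>\<close>-measure, which is 0.\<close>
    have S[measurable]: "sym_diff N N' \<in> sets X" using N N' by auto
    have "(\<integral>\<^sup>+y. \<integral>\<^sup>+x. indicator (sym_diff N N') x \<partial>P' y \<partial>\<mu>) = (\<integral>\<^sup>+x. \<integral>\<^sup>+y. indicator (sym_diff N N') x \<partial>P x \<partial>\<mu>)"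
      by (rule duality[symmetric]) measurable
    also have "\<dots> = (\<integral>\<^sup>+x. indicator (sym_diff N N') x \<partial>\<mu>)"
      by (intro nn_integral_cong) (simp add: space_\<mu> prob_space.emeasure_space_1[OF fwd.prob_space_kernel_eq])
    also have "\<dots> = 0" using null S by (subst nn_integral_indicator) (simp_all add: sets_\<mu>)
    finally have "AE y in \<mu>. (\<integral>\<^sup>+x. indicator (sym_diff N N') x \<partial>P' y) = 0"
      by (subst (asm) nn_integral_0_iff_AE)
        (auto intro!: nn_integral_measurable_subprob_algebra2[OF _ bwd.kernel] simp: measurable_cong_sets[OF sets_\<mu> refl])
    moreover have "AE y in \<mu>. y \<in> space X" by (rule AE_I2) (simp add: space_\<mu>)
    ultimately show ?thesis
    proof eventually_elim
      case (elim y)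
      have "sym_diff N N' \<in> sets (P' y)" using S elim(2) by (simp only: bwd.sets_kernel_eq)
      with elim(1) have "sym_diff N N' \<in> null_sets (P' y)" by (auto simp del: sets.Diff sets.Un)
      from AE_not_in[OF this] show ?case by eventually_elim blast
    qed
  qed
  with AE_N_iff show "AE x in \<mu>. x \<in> N \<longrightarrow> (AE y in P' x. y \<in> N)"
  proof eventually_elim
    case (elim x)
    show ?case
    proof
      assume "x \<in> N"
      with elim have "AE y in P' x. y \<in> N'" using bwd_A.AE_kernel_recurrent by blast
      with elim(2) show "AE y in P' x. y \<in> N" by eventually_elim blast
    qed
  qed
qed

abbreviation "enter_A \<equiv> Ac \<times> A"
abbreviation "leave_A \<equiv> A \<times> Ac"

lemma converse_jumps:
  "enter_A\<inverse> = leave_A" "leave_A\<inverse> = enter_A"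
  "(space X \<times> space X - enter_A)\<inverse> = space X \<times> space X - leave_A"
  "(space X \<times> space X - leave_A)\<inverse> = space X \<times> space X - enter_A"
  "(A \<times> A)\<inverse> = A \<times> A"
  by auto

lemma sets_jumps [measurable]:
  "enter_A \<in> sets (X \<Otimes>\<^sub>M X)" "leave_A \<in> sets (X \<Otimes>\<^sub>M X)" "A \<times> A \<in> sets (X \<Otimes>\<^sub>M X)"
  "space X \<times> space X - enter_A \<in> sets (X \<Otimes>\<^sub>M X)" "space X \<times> space X - leave_A \<in> sets (X \<Otimes>\<^sub>M X)"
  using A by auto

lemmas adjoint_enter = transition_adjoint[OF sets_jumps(1), unfolded converse_jumps]
lemmas adjoint_leave = transition_adjoint[OF sets_jumps(2), unfolded converse_jumps]
lemmas adjoint_stay = transition_power_adjoint[OF sets_jumps(3), unfolded converse_jumps]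
lemmas adjoint_not_leave = rev.transition_power_adjoint[OF sets_jumps(5), unfolded converse_jumps]

text \<open>Instances for the complement speak of its own complement and recurrent set; rewriting
  both makes every series refer to \<open>A\<close>, \<open>N\<close> and \<open>N'\<close>.\<close>

lemmas bwd_Ac_facts =
  bwd_Ac.emeasure_entrance_law[unfolded compl_Ac both_inf_often_Compl[OF A]]
  bwd_Ac.suminf_first_jump_eq_1[unfolded compl_Ac both_inf_often_Compl[OF A]]
  bwd_Ac.transition_jump_space[unfolded compl_Ac]
  bwd_Ac.transition_power_before_jump[unfolded compl_Ac]

lemmas fwd_Ac_facts =
  fwd_Ac.emeasure_entrance_law[unfolded compl_Ac both_inf_often_Compl[OF A]]
  fwd_Ac.transition_power_before_jump[unfolded compl_Ac]
  fwd_Ac.transition_jump_outside[unfolded compl_Ac]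

text \<open>A path from an exit in \<open>C\<close> to the next exit in \<open>D\<close>, read
  backwards, is a path of the reversed chain from a point of \<open>D\<close> to its next entrance
  into \<open>Ac\<close>, at a point of \<open>C\<close>. The exit density accounts for the extra
  step into \<open>A\<close> that an exit involves.\<close>

lemma exit_entrance_dual:
  "dual_wrt (cut_measure X Ac N (exit_measure X \<mu> P Ac)) (exit_kernel X P Ac) (entrance_law X P' Ac)"
proof -
  let ?r = "\<lambda>x. emeasure (P x) A"
  have r[measurable]: "?r \<in> borel_measurable X" by (rule fwd.measurable_emeasure_kernel[OF A])
  define m where "m = cut_measure X Ac N (density (restrict_space \<mu> Ac) ?r)"
  have m: "cut_measure X Ac N (exit_measure X \<mu> P Ac) = m"
    unfolding m_def fwd.exit_measure_eq[OF sets_\<mu> Ac] compl_Ac ..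
  have sm: "sets m = sets (adjoin_cemetery X Ac)" unfolding m_def by (rule sets_cut_measure)
  obtain F :: "nat \<Rightarrow> 'a option set" where F: "range F \<subseteq> sets m" "(\<Union>i. F i) = space m" "\<And>i. emeasure m (F i) \<noteq> \<infinity>"
    using cut_measure_cover[OF sets_\<mu> \<sigma> Ac N r prob_space.emeasure_le_1[OF fwd.prob_space_kernel_eq]] unfolding m_def by blast
  have exitK: "exit_kernel X P Ac \<in> adjoin_cemetery X Ac \<rightarrow>\<^sub>M prob_algebra (adjoin_cemetery X Ac)"
    by (rule fwd_A.measurable_exit_kernel)
  have entrK: "entrance_law X P' Ac \<in> adjoin_cemetery X Ac \<rightarrow>\<^sub>M prob_algebra (adjoin_cemetery X Ac)"
    by (rule bwd_Ac.measurable_entrance_law[OF Ac])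
  have "dual_wrt m (exit_kernel X P Ac) (entrance_law X P' Ac)"
  proof (rule dual_wrtI[OF _ _ F])
    show "markov_kernel m (exit_kernel X P Ac)" "markov_kernel m (entrance_law X P' Ac)"
      using exitK entrK by (simp_all only: markov_kernel_cong[OF sm])
    fix C D assume "C \<in> sets m" "D \<in> sets m"
    then have C: "C \<in> sets (adjoin_cemetery X Ac)" and D: "D \<in> sets (adjoin_cemetery X Ac)"
      by (simp_all only: sm)
    define C0 where "C0 = Some -` C"
    define D0 where "D0 = Some -` D"
    have [measurable]: "C0 \<in> sets X" "D0 \<in> sets X"
      using C D by (simp_all add: C0_def D0_def sets_adjoin_cemetery_iff[OF Ac])
    define e where "e y = emeasure (chain_law X P y) (exit_position A 1 -` D \<inter> space (path_space X))" for y
    have [measurable]: "e \<in> borel_measurable X"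
      unfolding e_def by (rule fwd_A.measurable_emeasure_exit_position[OF D])
    define u where "u x = indicator D0 x * transition P enter_A (indicator (space X)) x" for x
    have [measurable]: "u \<in> borel_measurable X" unfolding u_def by measurable
    define s where "s n = (transition P (space X \<times> space X - enter_A) ^^ n) u" for n
    have [measurable]: "s n \<in> borel_measurable X" for n unfolding s_def by measurable
    define v where "v = transition P' leave_A (indicator C0)"
    have [measurable]: "v \<in> borel_measurable X" unfolding v_def by measurable
    have e: "e y = (\<Sum>n. s n y)" if "y \<in> N" for y
      using fwd_A.emeasure_exit_position[OF that D] unfolding e_def s_def u_def D0_def by simp
    have meas_exit: "(\<lambda>z. emeasure (exit_kernel X P Ac z) D) \<in> borel_measurable (adjoin_cemetery X Ac)"
      by (rule measurable_compose[OF measurable_prob_algebraD[OF exitK] measurable_emeasure_subprob_algebra[OF D]])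
    have meas_entr: "(\<lambda>z. emeasure (entrance_law X P' Ac z) C) \<in> borel_measurable (adjoin_cemetery X Ac)"
      by (rule measurable_compose[OF measurable_prob_algebraD[OF entrK] measurable_emeasure_subprob_algebra[OF C]])
    have "(\<integral>\<^sup>+z. indicator C z * emeasure (exit_kernel X P Ac z) D \<partial>m) =
        (\<integral>\<^sup>+x. indicator N x * (indicator Ac x * ?r x) * (indicator C (Some x) * emeasure (exit_kernel X P Ac (Some x)) D) \<partial>\<mu>)"
      unfolding m_def
      by (rule nn_integral_cut_measure[OF sets_\<mu> Ac N r]) (use C meas_exit in measurable)
    also have "\<dots> = (\<integral>\<^sup>+x. indicator N x * indicator C0 x * transition P enter_A e x \<partial>\<mu>)"
    proof (rule nn_integral_cong)
      fix x assume "x \<in> space \<mu>"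
      then have x: "x \<in> space X" by (simp add: space_\<mu>)
      have "transition P enter_A e x = indicator Ac x * ?r x * emeasure (exit_kernel X P Ac (Some x)) D"
        using fwd_A.transition_exit_kernel[OF x D] unfolding e_def[abs_def] .
      moreover have "indicator C (Some x) = (indicator C0 x :: ennreal)" by (simp add: C0_def indicator_def)
      ultimately show "indicator N x * (indicator Ac x * ?r x) * (indicator C (Some x) * emeasure (exit_kernel X P Ac (Some x)) D) =
          indicator N x * indicator C0 x * transition P enter_A e x"
        by (simp add: ac_simps)
    qed
    \<comment> \<open>The series for \<open>e\<close> is valid only on \<open>N\<close>, so the
      indicator is moved to the target of the step, where \<open>e\<close> can be expanded, and
      afterwards back to the source.\<close>
    also have "\<dots> = (\<integral>\<^sup>+x. indicator C0 x * transition P enter_A (\<lambda>y. indicator N y * e y) x \<partial>\<mu>)"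
      by (rule transition_indicator[symmetric]) measurable
    also have "(\<lambda>y. indicator N y * e y) = (\<lambda>y. indicator N y * (\<Sum>n. s n y))"
      using e by (auto simp: fun_eq_iff split: split_indicator)
    also have "(\<integral>\<^sup>+x. indicator C0 x * transition P enter_A (\<lambda>y. indicator N y * (\<Sum>n. s n y)) x \<partial>\<mu>) =
        (\<integral>\<^sup>+x. indicator N x * indicator C0 x * transition P enter_A (\<lambda>y. \<Sum>n. s n y) x \<partial>\<mu>)"
      by (rule transition_indicator) measurable
    also have "\<dots> = (\<integral>\<^sup>+x. indicator N x * indicator C0 x * (\<Sum>n. transition P enter_A (s n) x) \<partial>\<mu>)"
      by (intro nn_integral_cong arg_cong2[where f="(*)"] refl fwd.transition_suminf) (auto simp: space_\<mu>)
    also have "\<dots> = (\<Sum>n. \<integral>\<^sup>+x. indicator N x * indicator C0 x * transition P enter_A (s n) x \<partial>\<mu>)"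
      by (rule nn_integral_mult_suminf) measurable
    \<comment> \<open>Verified from right to left: adjunction returns the powers to
      \<open>P\<close>, the indicator crosses them, and the leaving step in \<open>v\<close> turns
      into the entering step, which the indicator crosses last.\<close>
    also have "\<dots> = (\<Sum>n. \<integral>\<^sup>+x. indicator N x * u x * (transition P' (space X \<times> space X - leave_A) ^^ n) v x \<partial>\<mu>)"
    proof (rule suminf_cong)
      fix n
      have "(\<integral>\<^sup>+x. indicator N x * u x * (transition P' (space X \<times> space X - leave_A) ^^ n) v x \<partial>\<mu>) =
          (\<integral>\<^sup>+x. (transition P (space X \<times> space X - enter_A) ^^ n) (\<lambda>x. indicator N x * u x) x * v x \<partial>\<mu>)"
        by (rule adjoint_not_leave) measurable
      also have "\<dots> = (\<integral>\<^sup>+x. v x * (transition P (space X \<times> space X - enter_A) ^^ n) (\<lambda>x. indicator N x * u x) x \<partial>\<mu>)"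
        by (simp only: mult.commute)
      also have "\<dots> = (\<integral>\<^sup>+x. indicator N x * v x * s n x \<partial>\<mu>)"
        unfolding s_def by (rule transition_power_indicator) measurable
      also have "\<dots> = (\<integral>\<^sup>+x. transition P' leave_A (indicator C0) x * (indicator N x * s n x) \<partial>\<mu>)"
        unfolding v_def by (simp only: ac_simps)
      also have "\<dots> = (\<integral>\<^sup>+x. indicator C0 x * transition P enter_A (\<lambda>x. indicator N x * s n x) x \<partial>\<mu>)"
        by (rule adjoint_enter[symmetric]) measurable
      also have "\<dots> = (\<integral>\<^sup>+x. indicator N x * indicator C0 x * transition P enter_A (s n) x \<partial>\<mu>)"
        by (rule transition_indicator) measurable
      finally show "(\<integral>\<^sup>+x. indicator N x * indicator C0 x * transition P enter_A (s n) x \<partial>\<mu>) =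
          (\<integral>\<^sup>+x. indicator N x * u x * (transition P' (space X \<times> space X - leave_A) ^^ n) v x \<partial>\<mu>)" ..
    qed
    also have "\<dots> = (\<integral>\<^sup>+x. indicator N x * u x * (\<Sum>n. (transition P' (space X \<times> space X - leave_A) ^^ n) v x) \<partial>\<mu>)"
      by (rule nn_integral_mult_suminf[symmetric]) measurable
    \<comment> \<open>\<open>u\<close> is the exit density cut down to \<open>D\<close>. The series
      is the entrance law for starting points in \<open>N'\<close>, so the identity on
      \<open>N\<close> holds almost everywhere.\<close>
    also have "\<dots> = (\<integral>\<^sup>+y. indicator N y * (indicator Ac y * ?r y) * (indicator D (Some y) * emeasure (entrance_law X P' Ac (Some y)) C) \<partial>\<mu>)"
    proof (rule nn_integral_cong_AE)
      have "AE y in \<mu>. y \<in> space X" by (rule AE_I2) (simp add: space_\<mu>)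
      with AE_N_iff show "AE y in \<mu>. indicator N y * u y * (\<Sum>n. (transition P' (space X \<times> space X - leave_A) ^^ n) v y) =
        indicator N y * (indicator Ac y * ?r y) * (indicator D (Some y) * emeasure (entrance_law X P' Ac (Some y)) C)"
      proof eventually_elim
        case (elim y)
        have u: "u y = indicator Ac y * ?r y * indicator D (Some y)"
          using fwd_A.transition_jump_space[OF elim(2)] by (simp add: u_def D0_def indicator_def mult.commute)
        have "(\<Sum>n. (transition P' (space X \<times> space X - leave_A) ^^ n) v y) = emeasure (entrance_law X P' Ac (Some y)) C"
          if "y \<in> N"
          using that elim(1) bwd_Ac_facts(1)[OF _ C, of y] unfolding v_def C0_def by simp
        then show ?case by (auto simp: u ac_simps split: split_indicator)
      qed
    qed
    also have "\<dots> = (\<integral>\<^sup>+z. indicator D z * emeasure (entrance_law X P' Ac z) C \<partial>m)"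
      unfolding m_def
      by (rule nn_integral_cut_measure[OF sets_\<mu> Ac N r, symmetric]) (use D meas_entr in measurable)
    finally show "(\<integral>\<^sup>+z. indicator C z * emeasure (exit_kernel X P Ac z) D \<partial>m) =
        (\<integral>\<^sup>+z. indicator D z * emeasure (entrance_law X P' Ac z) C \<partial>m)" .
  qed
  then show ?thesis by (simp only: m)
qed

text \<open>The powers describe the stay between an entrance into \<open>A\<close> and the next
  departure. Transferred to the reversed chain they describe the time until it departs from
  \<open>A\<close>, and summing over this time gives 1. A single departing step of \<open>P\<close>
  remains, whose image is the entrance measure of \<open>Ac\<close>.\<close>

lemma entrance_measure_transport:
  "cut_measure X A N (entrance_measure X \<mu> P A) \<bind> entrance_law X P Ac =
   cut_measure X Ac N (entrance_measure X \<mu> P Ac)"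
proof -
  let ?r = "\<lambda>x. emeasure (P' x) Ac"
  let ?q = "\<lambda>x. emeasure (P' x) A"
  have r[measurable]: "?r \<in> borel_measurable X" by (rule bwd.measurable_emeasure_kernel[OF Ac])
  have q[measurable]: "?q \<in> borel_measurable X" by (rule bwd.measurable_emeasure_kernel[OF A])
  define m where "m = cut_measure X A N (density (restrict_space \<mu> A) ?r)"
  define m' where "m' = cut_measure X Ac N (density (restrict_space \<mu> Ac) ?q)"
  have m: "cut_measure X A N (entrance_measure X \<mu> P A) = m"
    unfolding m_def entrance_measure_eq_exit_measure[OF A] bwd.exit_measure_eq[OF sets_\<mu> A] ..
  have m': "cut_measure X Ac N (entrance_measure X \<mu> P Ac) = m'"
    unfolding m'_def entrance_measure_eq_exit_measure[OF Ac] bwd.exit_measure_eq[OF sets_\<mu> Ac] compl_Ac ..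
  have sm: "sets m = sets (adjoin_cemetery X A)" unfolding m_def by (rule sets_cut_measure)
  have sm': "sets m' = sets (adjoin_cemetery X Ac)" unfolding m'_def by (rule sets_cut_measure)
  have ne: "space m \<noteq> {}" by (simp add: m_def space_cut_measure)
  have K0: "entrance_law X P Ac \<in> adjoin_cemetery X A \<rightarrow>\<^sub>M subprob_algebra (adjoin_cemetery X Ac)"
    by (rule measurable_prob_algebraD[OF fwd_Ac.measurable_entrance_law[OF A]])
  then have K: "entrance_law X P Ac \<in> m \<rightarrow>\<^sub>M subprob_algebra (adjoin_cemetery X Ac)"
    by (simp only: measurable_cong_sets[OF sm refl])
  have "m \<bind> entrance_law X P Ac = m'"
  proof (rule measure_eqI)
    show "sets (m \<bind> entrance_law X P Ac) = sets m'"
      by (simp only: sm' sets_bind_measurable[OF K ne])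
    fix D assume "D \<in> sets (m \<bind> entrance_law X P Ac)"
    then have D: "D \<in> sets (adjoin_cemetery X Ac)" by (simp only: sets_bind_measurable[OF K ne])
    define D0 where "D0 = Some -` D"
    have [measurable]: "D0 \<in> sets X"
      using D by (simp add: D0_def sets_adjoin_cemetery_iff[OF Ac])
    define h where "h = transition P leave_A (indicator D0)"
    have [measurable]: "h \<in> borel_measurable X" unfolding h_def by measurable
    define k where "k = transition P' leave_A (indicator (space X))"
    have [measurable]: "k \<in> borel_measurable X" unfolding k_def by measurable
    have k: "k x = indicator A x * ?r x" if "x \<in> space X" for x
      using bwd_Ac_facts(3)[OF that] by (simp add: k_def)
    let ?L = "space X \<times> space X - leave_A"
    have "emeasure (m \<bind> entrance_law X P Ac) D = (\<integral>\<^sup>+z. emeasure (entrance_law X P Ac z) D \<partial>m)"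
      by (rule emeasure_bind[OF ne K D])
    also have "\<dots> = (\<integral>\<^sup>+x. indicator N x * (indicator A x * ?r x) * emeasure (entrance_law X P Ac (Some x)) D \<partial>\<mu>)"
      unfolding m_def
      by (rule nn_integral_cut_measure[OF sets_\<mu> A N r])
         (rule measurable_compose[OF K0 measurable_emeasure_subprob_algebra[OF D]])
    \<comment> \<open>Until it departs the chain stays in \<open>A\<close>, so the powers may be
      taken over \<open>A \<times> A\<close>. The converse of \<open>?L\<close> would forbid
      entering \<open>A\<close> instead of leaving it.\<close>
    also have "\<dots> = (\<integral>\<^sup>+x. indicator N x * k x * (\<Sum>n. (transition P (A \<times> A) ^^ n) h x) \<partial>\<mu>)"
    proof (rule nn_integral_cong)
      fix x assume "x \<in> space \<mu>"
      then have x: "x \<in> space X" by (simp add: space_\<mu>)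
      have "emeasure (entrance_law X P Ac (Some x)) D = (\<Sum>n. (transition P (A \<times> A) ^^ n) h x)"
        if "x \<in> N" "x \<in> A"
      proof -
        have "(transition P ?L ^^ n) h x = (transition P (A \<times> A) ^^ n) h x" for n
          using fwd_Ac_facts(2)[OF x, of n "indicator D0"] \<open>x \<in> A\<close> unfolding h_def by simp
        then show ?thesis
          using fwd_Ac_facts(1)[OF \<open>x \<in> N\<close> D] unfolding h_def D0_def by (simp only:)
      qed
      then show "indicator N x * (indicator A x * ?r x) * emeasure (entrance_law X P Ac (Some x)) D =
          indicator N x * k x * (\<Sum>n. (transition P (A \<times> A) ^^ n) h x)"
        by (auto simp: k[OF x] split: split_indicator)
    qed
    also have "\<dots> = (\<Sum>n. \<integral>\<^sup>+x. indicator N x * k x * (transition P (A \<times> A) ^^ n) h x \<partial>\<mu>)"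
      by (rule nn_integral_mult_suminf) measurable
    also have "\<dots> = (\<Sum>n. \<integral>\<^sup>+x. indicator N x * h x * (transition P' ?L ^^ n) k x \<partial>\<mu>)"
    proof (rule suminf_cong)
      fix n
      have "(\<integral>\<^sup>+x. indicator N x * k x * (transition P (A \<times> A) ^^ n) h x \<partial>\<mu>) =
          (\<integral>\<^sup>+x. k x * (transition P (A \<times> A) ^^ n) (\<lambda>x. indicator N x * h x) x \<partial>\<mu>)"
        by (rule transition_power_indicator[symmetric]) measurable
      also have "\<dots> = (\<integral>\<^sup>+x. (transition P' (A \<times> A) ^^ n) k x * (indicator N x * h x) \<partial>\<mu>)"
        by (rule adjoint_stay) measurable
      \<comment> \<open>\<open>h\<close> vanishes outside \<open>A\<close>, and inside
        \<open>A\<close> the restricted powers of the reversed chain agree again with those over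
        \<open>?L\<close>.\<close>
      also have "\<dots> = (\<integral>\<^sup>+x. indicator N x * h x * (transition P' ?L ^^ n) k x \<partial>\<mu>)"
      proof (rule nn_integral_cong)
        fix x assume "x \<in> space \<mu>"
        then have x: "x \<in> space X" by (simp add: space_\<mu>)
        show "(transition P' (A \<times> A) ^^ n) k x * (indicator N x * h x) =
            indicator N x * h x * (transition P' ?L ^^ n) k x"
        proof (cases "x \<in> A")
          case True
          then have "(transition P' (A \<times> A) ^^ n) k x = (transition P' ?L ^^ n) k x"
            using bwd_Ac_facts(4)[OF x, of n "indicator (space X)"] unfolding k_def by simp
          then show ?thesis by (simp only: mult.commute)
        next
          case False
          then have "h x = 0" unfolding h_def by (rule fwd_Ac_facts(3))
          then show ?thesis by simp
        qed
      qed
      finally show "(\<integral>\<^sup>+x. indicator N x * k x * (transition P (A \<times> A) ^^ n) h x \<partial>\<mu>) =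
          (\<integral>\<^sup>+x. indicator N x * h x * (transition P' ?L ^^ n) k x \<partial>\<mu>)" .
    qed
    also have "\<dots> = (\<integral>\<^sup>+x. indicator N x * h x * (\<Sum>n. (transition P' ?L ^^ n) k x) \<partial>\<mu>)"
      by (rule nn_integral_mult_suminf[symmetric]) measurable
    \<comment> \<open>Started in \<open>N'\<close>, the reversed chain almost surely makes a step
      from \<open>A\<close> to \<open>Ac\<close>, so its first-jump series sums to 1.\<close>
    also have "\<dots> = (\<integral>\<^sup>+x. indicator N x * indicator (space X) x * transition P leave_A (indicator D0) x \<partial>\<mu>)"
    proof (rule nn_integral_cong_AE)
      have "AE x in \<mu>. x \<in> space X" by (rule AE_I2) (simp add: space_\<mu>)
      with AE_N_iff show "AE x in \<mu>. indicator N x * h x * (\<Sum>n. (transition P' ?L ^^ n) k x) =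
          indicator N x * indicator (space X) x * transition P leave_A (indicator D0) x"
      proof eventually_elim
        case (elim x)
        then have "(\<Sum>n. (transition P' ?L ^^ n) k x) = 1" if "x \<in> N"
          using that bwd_Ac_facts(2)[of x] by (simp add: k_def)
        then show ?case using elim(2) by (auto simp: h_def split: split_indicator)
      qed
    qed
    \<comment> \<open>The indicator moves to the point of entrance into \<open>Ac\<close>, as the
      cut measure there requires; adjunction then produces the density \<open>?q\<close>.\<close>
    also have "\<dots> = (\<integral>\<^sup>+x. indicator (space X) x * transition P leave_A (\<lambda>y. indicator N y * indicator D0 y) x \<partial>\<mu>)"
      by (rule transition_indicator[symmetric]) measurable
    also have "\<dots> = (\<integral>\<^sup>+y. transition P' enter_A (indicator (space X)) y * (indicator N y * indicator D0 y) \<partial>\<mu>)"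
      by (rule adjoint_leave) measurable
    also have "\<dots> = (\<integral>\<^sup>+x. indicator N x * (indicator Ac x * ?q x) * indicator D0 x \<partial>\<mu>)"
      by (intro nn_integral_cong) (simp add: space_\<mu> bwd_A.transition_jump_space ac_simps)
    also have "\<dots> = emeasure m' D"
      unfolding m'_def D0_def by (rule emeasure_cut_measure[OF sets_\<mu> Ac N q D, symmetric])
    finally show "emeasure (m \<bind> entrance_law X P Ac) D = emeasure m' D" .
  qed
  then show ?thesis by (simp only: m m')
qed

text \<open>Exchanging the kernels and replacing \<open>A\<close> by its complement turns the exit
  statement into this one: exits of the reversed chain from \<open>A\<close> against entrances of
  the original chain into \<open>A\<close>. The set obtained in this way is \<open>N'\<close>, which
  equals \<open>N\<close> almost everywhere.\<close>

lemma entrance_exit_dual: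
  "dual_wrt (cut_measure X A N (entrance_measure X \<mu> P A)) (entrance_law X P A) (exit_kernel X P' A)"
proof -
  interpret swapped: dual_chains_recurrent X \<mu> P' P A by (rule swap_recurrent)
  interpret swapped_Ac: dual_chains_recurrent X \<mu> P' P Ac by (rule swapped.Compl_recurrent)
  have "cut_measure X A N (entrance_measure X \<mu> P A) = cut_measure X A N' (exit_measure X \<mu> P' A)"
    unfolding entrance_measure_eq_exit_measure[OF A] bwd.exit_measure_eq[OF sets_\<mu> A]
    using bwd.measurable_emeasure_kernel[OF Ac] by (rule cut_measure_cong_AE[OF sets_\<mu> A _ N N' AE_N_iff])
  then show ?thesis
    using dual_wrt_sym[OF swapped_Ac.exit_entrance_dual] by (simp only: compl_Ac both_inf_often_Compl[OF A])
qed

end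

text \<open>The last two conjuncts start the chain in one set and record its first entrance into the
  other: \<open>bind\<close> integrates the entrance law, defined for all starting points, against a
  possibly infinite measure.\<close>

theorem proposition4p1:
  fixes X \<mu> :: "'a measure" and P P' :: "'a \<Rightarrow> 'a measure" and A :: "'a set"
  assumes "sets \<mu> = sets X"
    and "sigma_finite_measure \<mu>"
    and "dual_wrt \<mu> P P'"
    and "A \<in> sets X"
    and "emeasure \<mu> (sym_diff (both_inf_often X P A) (both_inf_often X P' A)) = 0"
  defines "N \<equiv> both_inf_often X P A"
    and "Ac \<equiv> space X - A"
  defines "exit_Ac \<equiv> cut_measure X Ac N (exit_measure X \<mu> P Ac)"
    and "entr_A \<equiv> cut_measure X A N (entrance_measure X \<mu> P A)"
    and "entr_Ac \<equiv> cut_measure X Ac N (entrance_measure X \<mu> P Ac)"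
  shows "dual_wrt exit_Ac (exit_kernel X P Ac) (entrance_law X P' Ac)
    \<and> dual_wrt entr_A (entrance_law X P A) (exit_kernel X P' A)
    \<and> entr_A \<bind> entrance_law X P Ac = entr_Ac
    \<and> entr_Ac \<bind> entrance_law X P A = entr_A"
proof -
  interpret dual_chains_recurrent X \<mu> P P' A
    by (intro dual_chains_recurrent.intro dual_chains.intro dual_chains_recurrent_axioms.intro assms)
  \<comment> \<open>The last identity is the transport identity for the complement of
    \<open>A\<close>, which has the same recurrent set.\<close>
  interpret Compl: dual_chains_recurrent X \<mu> P P' "space X - A" by (rule Compl_recurrent)
  have "entr_Ac \<bind> entrance_law X P A = entr_A"
    using Compl.entrance_measure_transport
    unfolding compl_Ac both_inf_often_Compl[OF A] entr_A_def entr_Ac_def Ac_def N_def .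
  then show ?thesis
    using exit_entrance_dual entrance_exit_dual entrance_measure_transport
    unfolding exit_Ac_def entr_A_def entr_Ac_def Ac_def N_def by blast
qed

end
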